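(* Let $b,\omega:\mathbb{R}\to\mathbb{R}^+$ be continuous with $0<\beta_0\le b(t)\le b_1$ and $0\le\gamma_0\le\omega(t)\le\omega_1<\pi^2$ for all $t$, and assume $b(t)\to b_0\ge\beta_0$ and $\omega(t)\to\omega_0\ge\gamma_0$ as $t\to+\infty$. Let $\{\mathcal{A}(t)\}_{t\in\mathbb{R}}$ be the pullback attractor of the nonautonomous problem $(P)$ and $\mathcal{A}$ the global attractor of the autonomous problem $(P_{b_0,\omega_0})$ (both stated in the context). Then $$\lim_{t\to+\infty}dist_X(\mathcal{A}(t),\mathcal{A})=0.$$
   Context: $X=L^2(0,1)$ with its norm metric $\rho$; $\mathbb{R}^+=[0,\infty)$; $dist_X(B,A)=\sup_{b\in B}\inf_{a\in A}\rho(b,a)$ is the Hausdorff semidistance. $H_0$ is the set-valued Heaviside function: $H_0(u)=-1$ if $u<0$, $H_0(u)=[-1,1]$ if $u=0$, $H_0(u)=1$ if $u>0$. Problem $(P)$ with initial time $\tau\in\mathbb{R}$ and initial datum $u_\tau\in L^2(0,1)$: $$\frac{\partial u}{\partial t}-\frac{\partial^2u}{\partial x^2}\in b(t)H_0(u)+\omega(t)u\ \text{ on }(\tau,\infty)\times(0,1),\quad u(t,0)=u(t,1)=0,\quad u(\tau,x)=u_\tau(x).$$ $(P_{b_0,\omega_0})$ denotes the same problem with $b(t)\equiv b_0$, $\omega(t)\equiv\omega_0$ and initial time $\tau=0$. Let $A=-d^2/dx^2$ with $D(A)=H^2(0,1)\cap H_0^1(0,1)$. A function $u\in C([\tau,+\infty),L^2(0,1))$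 is a strong solution of $(P)$ if $u(\tau)=u_\tau$; $u$ is absolutely continuous on $[T_1,T_2]$ and $u(t)\in D(A)$ for a.a. $t\in(T_1,T_2)$, for any $\tau<T_1<T_2$; and there exists $f\in L^2_{loc}(\tau,+\infty;L^2(0,1))$ with $f(t,x)\in H_0(u(t,x))$ for a.e. $(t,x)\in(\tau,+\infty)\times(0,1)$ and $\frac{du}{dt}(t)+Au(t)=b(t)f(t)+\omega(t)u(t)$ in $L^2(0,1)$ for a.e. $t\in(\tau,+\infty)$. Strong solutions of $(P_{b_0,\omega_0})$ are defined in the same way. $U(t,s,x)=\{u(t):u\text{ is a strong solution of }(P)\text{ with initial time }s,\ u(s)=x\}$ for $t\ge s$, $x\in X$, and $U(t,s,B)=\cup_{x\in B}U(t,s,x)$. A pullback attractor for $U$ is a family of compact sets $\{\mathcal{A}(t)\}_{t\in\mathbb{R}}$ such that $dist_X(U(t,s,B),\mathcal{A}(t))\to0$ as $s\to-\infty$ for all $t$ and all bounded $B$; $\mathcal{A}(t)\subset U(t,s,\mathcal{A}(s))$ for $s\le t$; and it is contained in any other such attracting family of closed sets. It is known that $U$ has a pullback attractor, that $\mathcal{A}(t)=U(t,s,\mathcal{A}(s))$ for $s\le t$, and that $\cup_{t}\mathcal{A}(t)$ is bounded in $H_0^1(0,1)$ with compact closure in $L^2(0,1)$. $G(t,x)=\{u(t):u\text{ is a strong solution of }(P_{b_0,\omega_0}),\ u(0)=x\}$, $t\ge0$, $G(t,B)=\cup_{x\in B}G(t,x)$. A global attractor for $G$ is a compact set $\mathcal{A}$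 with $dist_X(G(t,B),\mathcal{A})\to0$ as $t\to+\infty$ for any bounded $B$ and $\mathcal{A}\subset G(t,\mathcal{A})$ for all $t\ge0$. It is known that $G$ has a global attractor, which is invariant ($\mathcal{A}=G(t,\mathcal{A})$ for all $t\ge0$). *)

theory Defs
  imports "HOL-Analysis.Analysis"
begin

section \<open>The Hilbert space \<open>L\<^sup>2(0,1)\<close>\<close>

abbreviation unit_measure :: "real measure" where
  "unit_measure \<equiv> lebesgue_on {0<..<1}"

definition square_integrable :: "(real \<Rightarrow> real) \<Rightarrow> bool" where
  "square_integrable f \<longleftrightarrow>
     f \<in> borel_measurable unit_measure \<and> integrable unit_measure (\<lambda>x. (f x)\<^sup>2)"

definition l2_eq :: "(real \<Rightarrow> real) \<Rightarrow> (real \<Rightarrow> real) \<Rightarrow> bool" where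
  "l2_eq f g \<longleftrightarrow> square_integrable f \<and> square_integrable g \<and> (AE x in unit_measure. f x = g x)"

lemma square_integrable_mult:
  assumes "square_integrable f" "square_integrable g"
  shows "integrable unit_measure (\<lambda>x. f x * g x)"
proof (rule Bochner_Integration.integrable_bound)
  show "integrable unit_measure (\<lambda>x. (f x)\<^sup>2 + (g x)\<^sup>2)"
    using assms by (auto simp: square_integrable_def)
  show "(\<lambda>x. f x * g x) \<in> borel_measurable unit_measure"
    using assms by (auto simp: square_integrable_def)
  have "\<bar>a * b\<bar> \<le> a\<^sup>2 + b\<^sup>2" for a b :: real
  proof -
    have "0 \<le> (\<bar>a\<bar> - \<bar>b\<bar>)\<^sup>2 + a\<^sup>2 + b\<^sup>2" by simp
    then show ?thesis by (simp add: power2_eq_square algebra_simps abs_mult)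
  qed
  then show "AE x in unit_measure. norm (f x * g x) \<le> norm ((f x)\<^sup>2 + (g x)\<^sup>2)"
    by simp
qed

lemma square_integrable_zero: "square_integrable (\<lambda>_. 0)"
  by (simp add: square_integrable_def)

lemma square_integrable_add:
  assumes "square_integrable f" "square_integrable g"
  shows "square_integrable (\<lambda>x. f x + g x)"
proof -
  have "integrable unit_measure (\<lambda>x. (f x)\<^sup>2 + (g x)\<^sup>2 + 2 * (f x * g x))"
    using assms square_integrable_mult[OF assms]
    by (intro Bochner_Integration.integrable_add integrable_mult_right)
      (auto simp: square_integrable_def)
  moreover have "(f x)\<^sup>2 + (g x)\<^sup>2 + 2 * (f x * g x) = (f x + g x)\<^sup>2" for x
    by (simp add: power2_sum)
  ultimately show ?thesis
    using assms by (auto simp: square_integrable_def)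
qed

lemma square_integrable_scale:
  assumes "square_integrable f"
  shows "square_integrable (\<lambda>x. c * f x)"
  using assms by (auto simp: square_integrable_def power_mult_distrib)

quotient_type l2 = "real \<Rightarrow> real" / partial: l2_eq
  morphisms rep_l2 abs_l2
proof (rule part_equivpI)
  show "\<exists>f. l2_eq f f"
    by (rule exI[of _ "\<lambda>_. 0"]) (simp add: l2_eq_def square_integrable_zero)
  show "symp l2_eq"
    by (auto simp: symp_def l2_eq_def)
  show "transp l2_eq"
    by (auto simp: transp_def l2_eq_def)
qed

instantiation l2 :: real_inner
begin

lift_definition zero_l2 :: l2 is "\<lambda>_. 0"
  by (simp add: l2_eq_def square_integrable_zero)

lift_definition plus_l2 :: "l2 \<Rightarrow> l2 \<Rightarrow> l2" is "\<lambda>f g x. f x + g x"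
  by (auto simp: l2_eq_def square_integrable_add)

lift_definition scaleR_l2 :: "real \<Rightarrow> l2 \<Rightarrow> l2" is "\<lambda>c f x. c * f x"
  by (auto simp: l2_eq_def square_integrable_scale)

lift_definition uminus_l2 :: "l2 \<Rightarrow> l2" is "\<lambda>f x. - f x"
  using square_integrable_scale[of _ "-1"] by (auto simp: l2_eq_def)

definition minus_l2 :: "l2 \<Rightarrow> l2 \<Rightarrow> l2" where
  "minus_l2 u v = u + - v"

lift_definition inner_l2 :: "l2 \<Rightarrow> l2 \<Rightarrow> real" is
  "\<lambda>f g. integral\<^sup>L unit_measure (\<lambda>x. f x * g x)"
  by (rule integral_cong_AE)
    (auto simp: l2_eq_def square_integrable_def)

definition norm_l2 :: "l2 \<Rightarrow> real" where
  "norm_l2 u = sqrt (inner u u)"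

definition sgn_l2 :: "l2 \<Rightarrow> l2" where
  "sgn_l2 u = inverse (norm u) *\<^sub>R u"

definition dist_l2 :: "l2 \<Rightarrow> l2 \<Rightarrow> real" where
  "dist_l2 u v = norm (u - v)"

definition uniformity_l2 :: "(l2 \<times> l2) filter" where
  "uniformity_l2 = (INF e\<in>{0 <..}. principal {(u, v). dist u v < e})"

definition open_l2 :: "l2 set \<Rightarrow> bool" where
  "open_l2 S = (\<forall>u\<in>S. \<forall>\<^sub>F (u', v) in uniformity. u' = u \<longrightarrow> v \<in> S)"

instance
proof
  fix u v w :: l2 and r s :: real
  show "u + v + w = u + (v + w)"
    by transfer (auto simp: l2_eq_def add.assoc intro!: square_integrable_add)
  show "u + v = v + u"
    by transfer (auto simp: l2_eq_def add.commute intro!: square_integrable_add)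
  show "0 + u = u"
    by transfer (auto simp: l2_eq_def)
  show "- u + u = 0"
    by transfer (auto simp: l2_eq_def square_integrable_zero)
  show "u - v = u + - v"
    by (simp add: minus_l2_def)
  show "r *\<^sub>R (u + v) = r *\<^sub>R u + r *\<^sub>R v"
    by transfer (auto simp: l2_eq_def algebra_simps
        intro!: square_integrable_add square_integrable_scale)
  show "(r + s) *\<^sub>R u = r *\<^sub>R u + s *\<^sub>R u"
    by transfer (auto simp: l2_eq_def ring_distribs
        intro!: square_integrable_add square_integrable_scale)
  show "r *\<^sub>R s *\<^sub>R u = (r * s) *\<^sub>R u"
    by transfer (auto simp: l2_eq_def mult.assoc intro!: square_integrable_scale)
  show "1 *\<^sub>R u = u"
    by transfer (auto simp: l2_eq_def)
  show "sgn u = inverse (norm u) *\<^sub>R u"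
    by (simp add: sgn_l2_def)
  show "dist u v = norm (u - v)"
    by (simp add: dist_l2_def)
  show "uniformity = (INF e\<in>{0 <..}. principal {(u :: l2, v). dist u v < e})"
    by (simp add: uniformity_l2_def)
  show "open S = (\<forall>u\<in>S. \<forall>\<^sub>F (u', v) in uniformity. u' = u \<longrightarrow> v \<in> S)" for S :: "l2 set"
    by (simp add: open_l2_def)
  show "inner u v = inner v u"
    by transfer (simp add: mult.commute)
  show "inner (u + v) w = inner u w + inner v w"
  proof transfer
    fix f g h :: "real \<Rightarrow> real"
    assume "l2_eq f f" "l2_eq g g" "l2_eq h h"
    then have "integrable unit_measure (\<lambda>x. f x * h x)" "integrable unit_measure (\<lambda>x. g x * h x)"
      by (auto simp: l2_eq_def intro: square_integrable_mult)
    then show "integral\<^sup>L unit_measure (\<lambda>x. (f x + g x) * h x) =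
        integral\<^sup>L unit_measure (\<lambda>x. f x * h x) + integral\<^sup>L unit_measure (\<lambda>x. g x * h x)"
      by (simp add: distrib_right Bochner_Integration.integral_add)
  qed
  show "inner (r *\<^sub>R u) v = r * inner u v"
    by transfer (simp add: mult.assoc)
  show "0 \<le> inner u u"
    by transfer (rule Bochner_Integration.integral_nonneg, simp)
  show "inner u u = 0 \<longleftrightarrow> u = 0"
  proof transfer
    fix f :: "real \<Rightarrow> real"
    assume "l2_eq f f"
    then have f: "square_integrable f"
      by (simp add: l2_eq_def)
    have "integral\<^sup>L unit_measure (\<lambda>x. f x * f x) = 0 \<longleftrightarrow> (AE x in unit_measure. f x * f x = 0)"
      by (rule integral_nonneg_eq_0_iff_AE) (use square_integrable_mult[OF f f] in auto)
    then show "integral\<^sup>L unit_measure (\<lambda>x. f x * f x) = 0 \<longleftrightarrow> l2_eq f (\<lambda>_. 0)"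
      using f by (simp add: l2_eq_def square_integrable_zero)
  qed
  show "norm u = sqrt (inner u u)"
    by (simp add: norm_l2_def)
qed

end


section \<open>Sobolev spaces and the Dirichlet Laplacian\<close>

definition test_function :: "(real \<Rightarrow> real) \<Rightarrow> bool" where
  "test_function \<phi> \<longleftrightarrow>
     (\<forall>n x. (deriv ^^ n) \<phi> field_differentiable at x) \<and>
     (\<exists>K. compact K \<and> K \<subseteq> {0<..<1} \<and> (\<forall>x. x \<notin> K \<longrightarrow> \<phi> x = 0))"

definition has_weak_deriv :: "l2 \<Rightarrow> l2 \<Rightarrow> bool" where
  "has_weak_deriv u g \<longleftrightarrow>
     (\<forall>\<phi>. test_function \<phi> \<longrightarrow>
       (LINT x|unit_measure. rep_l2 u x * deriv \<phi> x) = - (LINT x|unit_measure. rep_l2 g x * \<phi> x))"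

definition weak_deriv :: "l2 \<Rightarrow> l2" where
  "weak_deriv u = (THE g. has_weak_deriv u g)"

definition H1 :: "l2 set" where
  "H1 = {u. \<exists>g. has_weak_deriv u g}"

definition H2 :: "l2 set" where
  "H2 = {u \<in> H1. weak_deriv u \<in> H1}"

text \<open>\<open>H10\<close> is \<open>H\<^sub>0\<^sup>1(0,1)\<close>, the closure of the test functions in the norm of \<open>H\<^sup>1(0,1)\<close>.\<close>

definition H10 :: "l2 set" where
  "H10 = {u \<in> H1. \<exists>\<phi> :: nat \<Rightarrow> real \<Rightarrow> real. (\<forall>n. test_function (\<phi> n)) \<and>
      (\<lambda>n. abs_l2 (\<phi> n)) \<longlonglongrightarrow> u \<and> (\<lambda>n. abs_l2 (deriv (\<phi> n))) \<longlonglongrightarrow> weak_deriv u}"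

definition dom_A :: "l2 set" where
  "dom_A = H2 \<inter> H10"

definition op_A :: "l2 \<Rightarrow> l2" where
  "op_A u = - weak_deriv (weak_deriv u)"


section \<open>Strong solutions of the differential inclusion\<close>

definition heaviside :: "real \<Rightarrow> real set" where
  "heaviside r = (if r < 0 then {-1} else if r = 0 then {-1..1} else {1})"

definition abs_continuous_on_interval :: "real \<Rightarrow> real \<Rightarrow> (real \<Rightarrow> 'a::metric_space) \<Rightarrow> bool" where
  "abs_continuous_on_interval T1 T2 u \<longleftrightarrow>
     (\<forall>\<epsilon>>0. \<exists>\<delta>>0. \<forall>(n::nat) l r.
        (\<forall>i<n. T1 \<le> l i \<and> l i \<le> r i \<and> r i \<le> T2) \<and>
        (\<forall>i<n. \<forall>j<n. i \<noteq> j \<longrightarrow> {l i<..<r i} \<inter> {l j<..<r j} = {}) \<and>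
        (\<Sum>i<n. r i - l i) < \<delta>
        \<longrightarrow> (\<Sum>i<n. dist (u (l i)) (u (r i))) < \<epsilon>)"

text \<open>Since \<open>L\<^sup>2(0,1)\<close> is separable, Borel measurability of an \<open>L\<^sup>2(0,1)\<close>-valued function
  coincides with strong measurability.\<close>

definition L2_loc :: "real \<Rightarrow> (real \<Rightarrow> l2) set" where
  "L2_loc \<tau> = {f. f \<in> borel_measurable (lebesgue_on {\<tau><..}) \<and>
     (\<forall>T1 T2. \<tau> < T1 \<longrightarrow> T1 < T2 \<longrightarrow> set_integrable lebesgue {T1..T2} (\<lambda>t. (norm (f t))\<^sup>2))}"

text \<open>A function of time with values in \<open>L\<^sup>2(0,1)\<close> is read as a function of \<open>(t,x)\<close> by means of a
  jointly measurable representative, which is unique up to a null set of \<open>(\<tau>,\<infinity>) \<times> (0,1)\<close>.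
  (The pointwise choice \<open>rep_l2 (g t) x\<close> need not be jointly measurable.)\<close>

definition joint_rep :: "real \<Rightarrow> (real \<Rightarrow> l2) \<Rightarrow> (real \<times> real \<Rightarrow> real) \<Rightarrow> bool" where
  "joint_rep \<tau> g F \<longleftrightarrow>
     F \<in> borel_measurable (lebesgue_on ({\<tau><..} \<times> {0<..<1})) \<and>
     (AE t in lebesgue_on {\<tau><..}.
        square_integrable (\<lambda>x. F (t, x)) \<and> abs_l2 (\<lambda>x. F (t, x)) = g t)"

definition heaviside_selection :: "real \<Rightarrow> (real \<Rightarrow> l2) \<Rightarrow> (real \<Rightarrow> l2) \<Rightarrow> bool" where
  "heaviside_selection \<tau> u f \<longleftrightarrow>
     (\<exists>F V. joint_rep \<tau> f F \<and> joint_rep \<tau> u V \<and>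
        (AE p in lebesgue_on ({\<tau><..} \<times> {0<..<1}). F p \<in> heaviside (V p)))"

text \<open>A solution is a total function of time, but only its restriction to \<open>[\<tau>,\<infinity>)\<close> is constrained.\<close>

definition strong_solution ::
  "(real \<Rightarrow> real) \<Rightarrow> (real \<Rightarrow> real) \<Rightarrow> real \<Rightarrow> l2 \<Rightarrow> (real \<Rightarrow> l2) \<Rightarrow> bool" where
  "strong_solution b \<omega> \<tau> u\<tau> u \<longleftrightarrow>
     continuous_on {\<tau>..} u \<and> u \<tau> = u\<tau> \<and>
     (\<forall>T1 T2. \<tau> < T1 \<longrightarrow> T1 < T2 \<longrightarrow>
        abs_continuous_on_interval T1 T2 u \<and>
        (AE t in lebesgue_on {T1<..<T2}. u t \<in> dom_A)) \<and>
     (\<exists>f \<in> L2_loc \<tau>. heaviside_selection \<tau> u f \<and>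
        (AE t in lebesgue_on {\<tau><..}.
           \<exists>du. (u has_vector_derivative du) (at t) \<and>
             du + op_A (u t) = b t *\<^sub>R f t + \<omega> t *\<^sub>R u t))"

definition evolution_process ::
  "(real \<Rightarrow> real) \<Rightarrow> (real \<Rightarrow> real) \<Rightarrow> real \<Rightarrow> real \<Rightarrow> l2 \<Rightarrow> l2 set" where
  "evolution_process b \<omega> t s x = {u t |u. strong_solution b \<omega> s x u}"

definition semiflow :: "real \<Rightarrow> real \<Rightarrow> real \<Rightarrow> l2 \<Rightarrow> l2 set" where
  "semiflow b0 \<omega>0 t x = {u t |u. strong_solution (\<lambda>_. b0) (\<lambda>_. \<omega>0) 0 x u}"


section \<open>Attractors\<close>

text \<open>The semidistance takes extended values, so that it is \<open>\<infinity>\<close> from a nonempty set to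
  the empty set and the suprema of unbounded families are meaningful.\<close>

definition semidist :: "'a::metric_space set \<Rightarrow> 'a set \<Rightarrow> ennreal" where
  "semidist B A = (SUP b\<in>B. INF a\<in>A. ennreal (dist b a))"

definition pullback_attracting ::
  "(real \<Rightarrow> real \<Rightarrow> 'a::metric_space \<Rightarrow> 'a set) \<Rightarrow> (real \<Rightarrow> 'a set) \<Rightarrow> bool" where
  "pullback_attracting U K \<longleftrightarrow>
     (\<forall>t B. bounded B \<longrightarrow> ((\<lambda>s. semidist (\<Union>x\<in>B. U t s x) (K t)) \<longlongrightarrow> 0) at_bot)"

definition pullback_attractor ::
  "(real \<Rightarrow> real \<Rightarrow> 'a::metric_space \<Rightarrow> 'a set) \<Rightarrow> (real \<Rightarrow> 'a set) \<Rightarrow> bool" where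
  "pullback_attractor U A \<longleftrightarrow>
     (\<forall>t. compact (A t)) \<and>
     pullback_attracting U A \<and>
     (\<forall>s t. s \<le> t \<longrightarrow> A t \<subseteq> (\<Union>x\<in>A s. U t s x)) \<and>
     (\<forall>K. (\<forall>t. closed (K t)) \<and> pullback_attracting U K \<longrightarrow> (\<forall>t. A t \<subseteq> K t))"

definition global_attractor :: "(real \<Rightarrow> 'a::metric_space \<Rightarrow> 'a set) \<Rightarrow> 'a set \<Rightarrow> bool" where
  "global_attractor G A \<longleftrightarrow>
     compact A \<and>
     (\<forall>B. bounded B \<longrightarrow> ((\<lambda>t. semidist (\<Union>x\<in>B. G t x) A) \<longlongrightarrow> 0) at_top) \<and>
     (\<forall>t\<ge>0. A \<subseteq> (\<Union>x\<in>A. G t x))"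

end

theory Submission
  imports Defs "HOL-Complex_Analysis.Great_Picard"
begin

text \<open>If the claim fails, there are \<open>t\<^sub>n \<rightarrow> \<infinity>\<close> and \<open>y\<^sub>n \<in> \<A> t\<^sub>n\<close> that stay away from \<open>\<A>lim\<close>. Since
  \<open>\<omega>1 < pi\<^sup>2\<close>, the energy estimate confines all solutions starting in \<open>\<A> 0\<close> to a fixed ball, so \<open>y\<^sub>n\<close>
  is the value at time \<open>T\<close> of a solution of the problem shifted by \<open>t\<^sub>n - T\<close>, where \<open>T\<close> is a time at
  which the limit semiflow has moved that ball close to \<open>\<A>lim\<close>. Along a subsequence the
  shifted solutions converge to a solution of the limit problem, which is a contradiction.

  Everything is done in the modes \<open>\<langle>u, sin (k \<pi> x)\<rangle>\<close>: each mode is equi-Lipschitz in time, and by smoothing the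
  tails of the Fourier series are uniformly small, which gives pointwise convergence in \<open>L\<^sup>2\<close>. The
  selections \<open>f\<^sub>n\<close> converge only weakly. Convex combinations of their tails converge almost
  everywhere (Mazur), and such combinations keep the value \<open>\<plusminus>1\<close> wherever the limit solution is
  nonzero. The limit solves the equation mode by mode, and a weighted \<open>H\<^sup>2\<close> bound shows that
  it is a strong solution.\<close>

section \<open>Absolutely continuous functions and Lebesgue points\<close>

text \<open>The nonlinearity enters with the sign that destroys uniqueness: from the datum 0 a
  solution may leave upwards, downwards or not at all. Two solutions with nearby data therefore
  cannot be compared by a Gronwall argument, and the limit solution that shadows a given trajectory
  has to come from compactness. Its initial value is not prescribed, only its norm is bounded; so
  the time \<open>T\<close> is fixed for a whole ball before the sequence of counterexamples is
  chosen.

  The sines diagonalise the Dirichlet Laplacian. Each mode solves a scalar linear equation with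
  bounded forcing, and the condition on \<open>\<omega>1\<close> keeps the growth rate below the
  smallest eigenvalue. The price is a translation, in both directions, between the weak derivatives
  that define \<open>op_A\<close> and multiplication by \<open>eig k\<close>.

  The condition that \<open>f\<close> selects from the Heaviside graph is invisible in the modes. It
  is followed on jointly measurable representatives in space-time, where a subsequence of the
  solutions converges almost everywhere. The graph is closed and has convex values, so averages of
  selections are as good as selections.\<close>

lemma abs_continuous_FTC:
  fixes f :: "real \<Rightarrow> 'a::real_normed_vector"
  assumes ab: "a \<le> b" and AC: "abs_continuous_on_interval a b f" and N: "negligible N"
    and deriv: "\<And>x. x \<in> {a..b} - N \<Longrightarrow> (f has_vector_derivative f' x) (at x within {a..b})"
  shows "(f' has_integral f b - f a) {a..b}"
proof (cases "a = b")
  case True then show ?thesis using has_integral_refl(2)[of f' b] by simp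
next
  case False
  with ab have ab': "a < b" by simp
  define g where "g x = (if x \<in> N then 0 else f' x)" for x
  have "(g has_integral f b - f a) {a..b}"
    unfolding has_integral_factor_content_real
  proof (intro allI impI)
    fix e :: real assume e: "e > 0"
    \<comment> \<open>Half of the admissible error \<open>e * (b - a)\<close>, reserved for the tags
      in \<open>N\<close>; the tags outside \<open>N\<close> receive the other half.\<close>
    define \<epsilon> where "\<epsilon> = e * (b - a) / 2"
    have \<epsilon>: "\<epsilon> > 0" using e ab' by (simp add: \<epsilon>_def)
    obtain \<delta> where \<delta>: "\<delta> > 0" and AC\<delta>: "\<forall>(n::nat) l r.
        (\<forall>i<n. a \<le> l i \<and> l i \<le> r i \<and> r i \<le> b) \<and>
        (\<forall>i<n. \<forall>j<n. i \<noteq> j \<longrightarrow> {l i<..<r i} \<inter> {l j<..<r j} = {}) \<and>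
        (\<Sum>i<n. r i - l i) < \<delta> \<longrightarrow> (\<Sum>i<n. dist (f (l i)) (f (r i))) < \<epsilon>"
      using AC[unfolded abs_continuous_on_interval_def] \<epsilon> by blast
    obtain U where U: "open U" "N \<subseteq> U" "U \<in> lmeasurable" "measure lebesgue U < \<delta>"
    proof -
      have "N \<in> sets lebesgue" using N by (simp add: negligible_imp_sets)
      then obtain U where "open U" "N \<subseteq> U" "U - N \<in> lmeasurable" "emeasure lebesgue (U - N) < ennreal \<delta>"
        using sets_lebesgue_outer_open \<delta> by metis
      moreover have "U = (U - N) \<union> N" using \<open>N \<subseteq> U\<close> by auto
      moreover have "N \<in> lmeasurable" using N by (simp add: negligible_imp_measurable)
      ultimately have "U \<in> lmeasurable" by (metis fmeasurable.Un)
      moreover have "measure lebesgue U = measure lebesgue (U - N)"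
        using N by (metis Diff_Diff_Int Int_commute inf_le1 measure_negligible_symdiff negligible_Un negligible_subset
          sup_bot_right Diff_subset \<open>N \<subseteq> U\<close> \<open>U - N \<in> lmeasurable\<close> \<open>U \<in> lmeasurable\<close> fmeasurableD measure_Diff_null_set negligible_iff_null_sets)
      moreover have "measure lebesgue (U - N) < \<delta>"
        using \<open>emeasure lebesgue (U - N) < ennreal \<delta>\<close> \<open>U - N \<in> lmeasurable\<close> \<delta>
        by (simp add: emeasure_eq_measure2 ennreal_less_iff)
      ultimately show ?thesis using that \<open>open U\<close> \<open>N \<subseteq> U\<close> by auto
    qed
    \<comment> \<open>At a tag in \<open>N\<close> the Riemann sum of \<open>g\<close> contributes
      nothing, but the increment of \<open>f\<close> remains. The gauge confines such intervals to
      the small open set \<open>U\<close>, where absolute continuity makes the increments small in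
      total. At the other tags differentiability controls each interval separately.\<close>
    have "\<exists>d>0. (x \<in> N \<longrightarrow> ball x d \<subseteq> U) \<and> (x \<in> {a..b} - N \<longrightarrow>
        (\<forall>y\<in>{a..b}. \<bar>y - x\<bar> < d \<longrightarrow> norm (f y - f x - (y - x) *\<^sub>R f' x) \<le> e/2 * \<bar>y - x\<bar>))" for x
    proof (cases "x \<in> N")
      case True
      then show ?thesis using U(1,2) open_contains_ball by (metis DiffE subsetD)
    next
      case F: False
      show ?thesis
      proof (cases "x \<in> {a..b}")
        case True
        then have "(f has_derivative (\<lambda>h. h *\<^sub>R f' x)) (at x within {a..b})"
          using deriv F by (simp add: has_vector_derivative_def)
        then show ?thesis using e F
          unfolding has_derivative_within_alt by (metis half_gt_zero real_norm_def)
      next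
        case False then show ?thesis using F by (intro exI[of _ 1]) auto
      qed
    qed
    then obtain d where d: "\<And>x. d x > 0" and dN: "\<And>x. x \<in> N \<Longrightarrow> ball x (d x) \<subseteq> U"
      and dd: "\<And>x y. x \<in> {a..b} - N \<Longrightarrow> y \<in> {a..b} \<Longrightarrow> \<bar>y - x\<bar> < d x \<Longrightarrow>
          norm (f y - f x - (y - x) *\<^sub>R f' x) \<le> e/2 * \<bar>y - x\<bar>"
      by metis
    show "\<exists>d. gauge d \<and> (\<forall>p. p tagged_division_of {a..b} \<and> d fine p \<longrightarrow>
        norm ((\<Sum>(x, k)\<in>p. measure lborel k *\<^sub>R g x) - (f b - f a)) \<le> e * measure lborel {a..b})"
    proof (intro exI[of _ "\<lambda>x. ball x (d x)"] conjI allI impI)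
      show "gauge (\<lambda>x. ball x (d x))" using d by (simp add: gauge_def)
      fix p assume "p tagged_division_of {a..b} \<and> (\<lambda>x. ball x (d x)) fine p"
      then have p: "p tagged_division_of {a..b}" and fine: "(\<lambda>x. ball x (d x)) fine p" by auto
      have fp: "finite p" using p by blast
      have k: "k = {Inf k..Sup k} \<and> Inf k \<le> x \<and> x \<le> Sup k \<and> a \<le> Inf k \<and> Sup k \<le> b \<and> k \<subseteq> ball x (d x)"
        if "(x, k) \<in> p" for x k
      proof -
        obtain u v where uv: "k = cbox u v" using tagged_division_ofD(4)[OF p \<open>(x,k) \<in> p\<close>] by auto
        have "x \<in> k" "k \<subseteq> {a..b}" using tagged_division_ofD(2,3)[OF p \<open>(x,k) \<in> p\<close>] by auto
        moreover have "k \<subseteq> ball x (d x)" using fine \<open>(x,k) \<in> p\<close> by (auto simp: fine_def)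
        ultimately show ?thesis using uv by auto
      qed
      have cont: "measure lborel k = Sup k - Inf k" if "(x, k) \<in> p" for x k
        using k[OF that] by (metis content_real order_trans)
      define pN where "pN = {q \<in> p. fst q \<in> N}"
      have fpN: "finite pN" using fp by (simp add: pN_def)
      define Del where "Del k = f (Sup k) - f (Inf k)" for k
      have good: "norm (measure lborel k *\<^sub>R g x - Del k) \<le> e/2 * measure lborel k" if xk: "(x, k) \<in> p" and "x \<notin> N" for x k
      proof -
        let ?u = "Inf k" and ?v = "Sup k"
        note K = k[OF xk]
        have xin: "x \<in> {a..b} - N" using K that by auto
        have "?u \<in> k" "?v \<in> k" using K by (metis atLeastAtMost_iff order_refl order_trans)+
        then have "\<bar>?u - x\<bar> < d x" "\<bar>?v - x\<bar> < d x" using K by (auto simp: dist_real_def abs_minus_commute)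
        then have 1: "norm (f ?v - f x - (?v - x) *\<^sub>R f' x) \<le> e/2 * \<bar>?v - x\<bar>"
          and 2: "norm (f ?u - f x - (?u - x) *\<^sub>R f' x) \<le> e/2 * \<bar>?u - x\<bar>"
          using dd[OF xin, of ?u] dd[OF xin, of ?v] K by auto
        let ?A = "f ?u - f x - (?u - x) *\<^sub>R f' x" and ?B = "f ?v - f x - (?v - x) *\<^sub>R f' x"
        have "measure lborel k *\<^sub>R g x - Del k = ?A - ?B"
          using that unfolding g_def Del_def cont[OF xk] by (simp add: algebra_simps)
        also have "norm (?A - ?B) \<le> norm ?A + norm ?B" by (rule norm_triangle_ineq4)
        also have "\<dots> \<le> e/2 * \<bar>?u - x\<bar> + e/2 * \<bar>?v - x\<bar>" using 1 2 by linarith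
        also have "\<dots> = e/2 * measure lborel k"
          unfolding cont[OF xk] using K by (simp add: field_simps)
        finally show ?thesis .
      qed
      have bad: "(\<Sum>(x,k)\<in>pN. norm (Del k)) < \<epsilon>"
      proof -
        obtain \<phi> where \<phi>: "bij_betw \<phi> {..<card pN} pN"
          using ex_bij_betw_nat_finite[OF fpN] by (auto simp: atLeast0LessThan)
        define n where "n = card pN"
        define l r where "l i = Inf (snd (\<phi> i))" and "r i = Sup (snd (\<phi> i))" for i
        have \<phi>in: "\<phi> i \<in> pN" if "i < n" for i using \<phi> that by (auto simp: bij_betw_def n_def)
        have mem: "(fst (\<phi> i), snd (\<phi> i)) \<in> p" "fst (\<phi> i) \<in> N" if "i < n" for i
          using \<phi>in[OF that] by (auto simp: pN_def)
        have lr: "a \<le> l i \<and> l i \<le> r i \<and> r i \<le> b" if "i < n" for i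
          using k[OF mem(1)[OF that]] unfolding l_def r_def by linarith
        have disj: "{l i<..<r i} \<inter> {l j<..<r j} = {}" if "i < n" "j < n" "i \<noteq> j" for i j
        proof -
          have "\<phi> i \<noteq> \<phi> j" using \<phi> that by (metis bij_betw_def inj_on_def lessThan_iff n_def)
          then have "interior (snd (\<phi> i)) \<inter> interior (snd (\<phi> j)) = {}"
            using tagged_division_ofD(5)[OF p mem(1)[OF that(1)] mem(1)[OF that(2)]] by (metis prod.collapse)
          then show ?thesis
            using k[OF mem(1)[OF that(1)]] k[OF mem(1)[OF that(2)]] unfolding l_def r_def
            by (metis interior_atLeastAtMost_real)
        qed
        have "(\<Sum>i<n. r i - l i) = (\<Sum>i<n. measure lebesgue {l i<..<r i})"
          using lr by (intro sum.cong) auto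
        also have "\<dots> = measure lebesgue (\<Union>i<n. {l i<..<r i})"
        proof (rule measure_finite_Union[symmetric])
          show "disjoint_family_on (\<lambda>i. {l i<..<r i}) {..<n}"
            using disj by (auto simp: disjoint_family_on_def simp del: Int_greaterThanLessThan)
          show "emeasure lebesgue {l i<..<r i} \<noteq> \<infinity>" if "i \<in> {..<n}" for i
            using lr[of i] that by simp
        qed auto
        also have "\<dots> \<le> measure lebesgue U"
        proof (rule measure_mono_fmeasurable)
          show "(\<Union>i<n. {l i<..<r i}) \<subseteq> U"
          proof (intro UN_least)
            fix i assume "i \<in> {..<n}"
            then have i: "i < n" by simp
            have "{l i<..<r i} \<subseteq> snd (\<phi> i)"
              using k[OF mem(1)[OF i]] unfolding l_def r_def by (metis greaterThanLessThan_subseteq_atLeastAtMost_iff order_refl)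
            also have "\<dots> \<subseteq> U" using k[OF mem(1)[OF i]] dN[OF mem(2)[OF i]] by blast
            finally show "{l i<..<r i} \<subseteq> U" .
          qed
        qed (use U in auto)
        also have "\<dots> < \<delta>" by (rule U)
        finally have "(\<Sum>i<n. dist (f (l i)) (f (r i))) < \<epsilon>"
          using AC\<delta>[THEN spec, THEN spec, THEN spec, of n l r] lr disj by blast
        moreover have "(\<Sum>(x,k)\<in>pN. norm (Del k)) = (\<Sum>i<n. norm (Del (snd (\<phi> i))))"
          using sum.reindex_bij_betw[OF \<phi>, of "\<lambda>q. norm (Del (snd q))"] by (simp add: n_def case_prod_beta)
        ultimately show ?thesis by (simp add: Del_def l_def r_def dist_norm norm_minus_commute)
      qed
      have "(\<Sum>(x, k)\<in>p. measure lborel k *\<^sub>R g x) - (f b - f a) = (\<Sum>(x, k)\<in>p. measure lborel k *\<^sub>R g x - Del k)"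
        using additive_tagged_division_1[OF ab p, of f]
        by (simp add: Del_def sum_subtractf case_prod_beta)
      also have "norm \<dots> \<le> (\<Sum>(x, k)\<in>p. norm (measure lborel k *\<^sub>R g x - Del k))"
        by (rule order_trans[OF norm_sum]) (simp add: case_prod_beta)
      also have "\<dots> = (\<Sum>(x, k)\<in>p - pN. norm (measure lborel k *\<^sub>R g x - Del k)) + (\<Sum>(x, k)\<in>pN. norm (measure lborel k *\<^sub>R g x - Del k))"
        by (rule sum.subset_diff) (auto simp: pN_def fp)
      also have "(\<Sum>(x, k)\<in>pN. norm (measure lborel k *\<^sub>R g x - Del k)) = (\<Sum>(x,k)\<in>pN. norm (Del k))"
        by (rule sum.cong) (auto simp: pN_def g_def)
      also have "(\<Sum>(x, k)\<in>p - pN. norm (measure lborel k *\<^sub>R g x - Del k)) \<le> (\<Sum>(x, k)\<in>p - pN. e/2 * measure lborel k)"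
        by (rule sum_mono) (use good in \<open>force simp: pN_def\<close>)
      also have "\<dots> \<le> (\<Sum>(x, k)\<in>p. e/2 * measure lborel k)"
        using e by (intro sum_mono2) (auto simp: fp)
      also have "\<dots> = e/2 * (b - a)"
        using additive_content_tagged_division[of p a b] p ab
        by (simp add: sum_distrib_left[symmetric] case_prod_beta del: times_divide_eq_left)
      finally have "norm ((\<Sum>(x, k)\<in>p. measure lborel k *\<^sub>R g x) - (f b - f a)) \<le> e/2 * (b - a) + \<epsilon>"
        using bad by simp
      then show "norm ((\<Sum>(x, k)\<in>p. measure lborel k *\<^sub>R g x) - (f b - f a)) \<le> e * measure lborel {a..b}"
        using ab by (simp add: \<epsilon>_def field_simps)
    qed
  qed
  then show ?thesis
    by (rule has_integral_spike[OF N, rotated]) (simp add: g_def)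
qed


lemma lebesgue_differentiation_right:
  fixes f :: "real \<Rightarrow> real"
  assumes "\<And>a b. f integrable_on {a..b}"
  obtains N where "negligible N"
    "\<And>x e. x \<notin> N \<Longrightarrow> 0 < e \<Longrightarrow>
       \<exists>d>0. \<forall>h. 0 \<le> h \<and> h < d \<longrightarrow> \<bar>integral {x..x + h} f - h * f x\<bar> \<le> e * h"
proof -
  obtain N where N: "negligible N" and *: "\<And>x e. x \<notin> N \<Longrightarrow> 0 < e \<Longrightarrow>
      \<exists>d>0. \<forall>h. 0 < h \<and> h < d \<longrightarrow> norm (integral (cbox x (x + h *\<^sub>R One)) f /\<^sub>R h ^ DIM(real) - f x) < e"
    using integrable_ccontinuous_explicit[of f] assms by (metis box_real(2))
  show ?thesis
  proof (rule that[OF N])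
    fix x e :: real assume "x \<notin> N" "0 < e"
    then obtain d where d: "d > 0" "\<And>h. 0 < h \<Longrightarrow> h < d \<Longrightarrow> \<bar>integral {x..x + h} f / h - f x\<bar> < e"
      using *[of x e] by (auto simp: divide_inverse mult.commute)
    have "\<bar>integral {x..x + h} f - h * f x\<bar> \<le> e * h" if "0 \<le> h" "h < d" for h
    proof (cases "h = 0")
      case False
      then have h: "h > 0" using that by simp
      have "\<bar>integral {x..x + h} f - h * f x\<bar> = \<bar>integral {x..x + h} f / h - f x\<bar> * h"
      proof -
        have eq: "integral {x..x + h} f - h * f x = (integral {x..x + h} f / h - f x) * h"
          using h by (simp add: field_simps)
        show ?thesis unfolding eq using h by (simp add: abs_mult)
      qed
      also have "\<dots> \<le> e * h" using d(2)[OF h] that h by (intro mult_right_mono) auto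
      finally show ?thesis .
    qed simp
    then show "\<exists>d>0. \<forall>h. 0 \<le> h \<and> h < d \<longrightarrow> \<bar>integral {x..x + h} f - h * f x\<bar> \<le> e * h"
      using d(1) by blast
  qed
qed

text \<open>The one-sided result is applied to \<open>f\<close>, cut off outside
  \<open>{c..d}\<close> so as to be integrable on every interval, and to its reflection. Adding the
  two halves yields intervals that contain \<open>x\<close> anywhere, not only as an
  endpoint.\<close>

lemma lebesgue_differentiation_real:
  fixes f :: "real \<Rightarrow> real"
  assumes f: "f integrable_on {c..d}"
  obtains N where "negligible N"
    "\<And>x e. x \<in> {c<..<d} - N \<Longrightarrow> 0 < e \<Longrightarrow>
       \<exists>\<delta>>0. \<forall>s t. s \<le> x \<and> x \<le> t \<and> t - s < \<delta> \<and> c \<le> s \<and> t \<le> d \<longrightarrow>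
         \<bar>integral {s..t} f - (t - s) * f x\<bar> \<le> e * (t - s)"
proof -
  define g where "g x = (if x \<in> {c..d} then f x else 0)" for x
  have "g integrable_on UNIV" using f unfolding g_def[abs_def] integrable_restrict_UNIV .
  then have g: "g integrable_on {a..b}" for a b by (metis integrable_on_subinterval subset_UNIV)
  have gm: "(\<lambda>x. g (- x)) integrable_on {a..b}" for a b
    using g[of "-b" "-a"] Henstock_Kurzweil_Integration.integrable_reflect_real[where f = g and a = "-b" and b = "-a"] by simp
  obtain N1 where N1: "negligible N1" and 1: "\<And>x e. x \<notin> N1 \<Longrightarrow> 0 < e \<Longrightarrow>
       \<exists>d>0. \<forall>h. 0 \<le> h \<and> h < d \<longrightarrow> \<bar>integral {x..x + h} g - h * g x\<bar> \<le> e * h"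
    using lebesgue_differentiation_right[of g] g by blast
  obtain N2 where N2: "negligible N2" and 2: "\<And>x e. x \<notin> N2 \<Longrightarrow> 0 < e \<Longrightarrow>
       \<exists>d>0. \<forall>h. 0 \<le> h \<and> h < d \<longrightarrow> \<bar>integral {x..x + h} (\<lambda>x. g (- x)) - h * g (- x)\<bar> \<le> e * h"
    using lebesgue_differentiation_right[of "\<lambda>x. g (- x)"] gm by blast
  have "negligible (uminus ` N2)"
    by (rule negligible_differentiable_image_negligible[OF _ N2]) (auto intro!: derivative_intros)
  with N1 have N: "negligible (N1 \<union> uminus ` N2)" by (rule negligible_Un)
  show ?thesis
  proof (rule that[OF N])
    fix x e :: real assume x: "x \<in> {c<..<d} - (N1 \<union> uminus ` N2)" and e: "0 < e"
    have xN2: "-x \<notin> N2" using x by (auto simp: image_iff)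
    obtain d1 where d1: "d1 > 0" "\<And>h. 0 \<le> h \<Longrightarrow> h < d1 \<Longrightarrow> \<bar>integral {x..x + h} g - h * g x\<bar> \<le> e * h"
      using 1[of x e] x e by auto
    obtain d2 where d2: "d2 > 0" "\<And>h. 0 \<le> h \<Longrightarrow> h < d2 \<Longrightarrow>
        \<bar>integral {-x..-x + h} (\<lambda>x. g (- x)) - h * g x\<bar> \<le> e * h"
      using 2[OF xN2 e] by auto
    have "\<bar>integral {s..t} f - (t - s) * f x\<bar> \<le> e * (t - s)"
      if st: "s \<le> x" "x \<le> t" "t - s < min d1 d2" "c \<le> s" "t \<le> d" for s t
    proof -
      have "integral {s..t} f = integral {s..t} g"
        using st by (intro integral_cong) (simp add: g_def)
      also have "\<dots> = integral {s..x} g + integral {x..t} g"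
        using Henstock_Kurzweil_Integration.integral_combine[OF st(1,2) g] by simp
      also have "integral {s..x} g = integral {-x..-x + (x - s)} (\<lambda>x. g (- x))"
        using integral_reflect_real[where f = g and a = s and b = x] by simp
      finally have eq: "integral {s..t} f = integral {-x..-x + (x - s)} (\<lambda>x. g (- x)) + integral {x..t} g" .
      have "f x = g x" using x by (simp add: g_def)
      moreover have "\<bar>integral {x..t} g - (t - x) * g x\<bar> \<le> e * (t - x)"
        using d1(2)[of "t - x"] st by auto
      moreover have "\<bar>integral {-x..-x + (x - s)} (\<lambda>x. g (- x)) - (x - s) * g x\<bar> \<le> e * (x - s)"
        using d2(2)[of "x - s"] st by auto
      moreover have "(t - s) * g x = (t - x) * g x + (x - s) * g x" "e * (t - s) = e * (t - x) + e * (x - s)"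
        by (auto simp: algebra_simps)
      ultimately show ?thesis unfolding eq abs_le_iff by (auto simp: algebra_simps)
    qed
    then show "\<exists>\<delta>>0. \<forall>s t. s \<le> x \<and> x \<le> t \<and> t - s < \<delta> \<and> c \<le> s \<and> t \<le> d \<longrightarrow>
         \<bar>integral {s..t} f - (t - s) * f x\<bar> \<le> e * (t - s)"
      using d1(1) d2(1) by (intro exI[of _ "min d1 d2"]) auto
  qed
qed

text \<open>The vector-valued case reduces to the real functions \<open>norm (h r - q)\<close> with
  \<open>q\<close> in a countable dense set: outside a countable union of null sets,
  \<open>x\<close> is a Lebesgue point of all of them. Choosing \<open>q\<close> close to
  \<open>h x\<close> then bounds the averaged distance of \<open>h\<close> from
  \<open>h x\<close>.\<close>

lemma lebesgue_differentiation_banach: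
  fixes h :: "real \<Rightarrow> 'a::{banach, second_countable_topology}"
  assumes h: "set_integrable lebesgue {c..d} h"
    and V: "\<And>s t. c \<le> s \<Longrightarrow> s \<le> t \<Longrightarrow> t \<le> d \<Longrightarrow> V t - V s = (LINT r:{s..t}|lebesgue. h r)"
  obtains N where "negligible N" "\<And>x. x \<in> {c<..<d} - N \<Longrightarrow> (V has_vector_derivative h x) (at x)"
proof -
  obtain D :: "'a set" where D: "countable D" "\<And>X. open X \<Longrightarrow> X \<noteq> {} \<Longrightarrow> \<exists>d\<in>D. d \<in> X"
    using countable_dense_exists by metis
  have hq: "set_integrable lebesgue {c..d} (\<lambda>r. h r - q)" for q
    using h by (intro set_integral_diff(1)) (auto simp: set_integrable_def emeasure_lborel_Icc_eq
      intro!: Bochner_Integration.integrable_scaleR_left)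
  have \<phi>: "set_integrable lebesgue {c..d} (\<lambda>r. norm (h r - q))" for q
    using hq by (rule set_integrable_norm)
  have sub: "set_integrable lebesgue {s..t} k" if "set_integrable lebesgue {c..d} k" "c \<le> s" "t \<le> d"
    for s t and k :: "real \<Rightarrow> 'b::{banach, second_countable_topology}"
    using that by (intro set_integrable_subset[OF that(1)]) auto
  have "\<exists>N. negligible N \<and> (\<forall>x e. x \<in> {c<..<d} - N \<and> 0 < e \<longrightarrow>
       (\<exists>\<delta>>0. \<forall>s t. s \<le> x \<and> x \<le> t \<and> t - s < \<delta> \<and> c \<le> s \<and> t \<le> d \<longrightarrow>
         \<bar>integral {s..t} (\<lambda>r. norm (h r - q)) - (t - s) * norm (h x - q)\<bar> \<le> e * (t - s)))" for q
    using lebesgue_differentiation_real[OF absolutely_integrable_on_def[THEN iffD1, THEN conjunct1, OF \<phi>[of q]]]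
    by metis
  then obtain N where N: "\<And>q. negligible (N q)" and LD: "\<And>q x e. x \<in> {c<..<d} - N q \<Longrightarrow> 0 < e \<Longrightarrow>
       (\<exists>\<delta>>0. \<forall>s t. s \<le> x \<and> x \<le> t \<and> t - s < \<delta> \<and> c \<le> s \<and> t \<le> d \<longrightarrow>
         \<bar>integral {s..t} (\<lambda>r. norm (h r - q)) - (t - s) * norm (h x - q)\<bar> \<le> e * (t - s))"
    by metis
  have NN: "negligible (\<Union>q\<in>D. N q)"
    using D(1) N by (simp add: negligible_iff_null_sets null_sets_UN')
  show ?thesis
  proof (rule that[OF NN])
    fix x assume x: "x \<in> {c<..<d} - (\<Union>q\<in>D. N q)"
    have key: "\<exists>\<delta>>0. \<forall>s t. s \<le> x \<and> x \<le> t \<and> t - s < \<delta> \<and> c \<le> s \<and> t \<le> d \<longrightarrow>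
        norm (V t - V s - (t - s) *\<^sub>R h x) \<le> e * (t - s)" if e: "e > 0" for e
    proof -
      obtain q where q: "q \<in> D" "q \<in> ball (h x) (e/3)"
        using D(2)[of "ball (h x) (e/3)"] e by auto
      then have qx: "norm (h x - q) < e/3" by (simp add: dist_norm)
      obtain \<delta> where \<delta>: "\<delta> > 0" "\<And>s t. s \<le> x \<Longrightarrow> x \<le> t \<Longrightarrow> t - s < \<delta> \<Longrightarrow> c \<le> s \<Longrightarrow> t \<le> d \<Longrightarrow>
         \<bar>integral {s..t} (\<lambda>r. norm (h r - q)) - (t - s) * norm (h x - q)\<bar> \<le> e/3 * (t - s)"
        using LD[of x q "e/3"] x q e by auto
      have "norm (V t - V s - (t - s) *\<^sub>R h x) \<le> e * (t - s)"
        if st: "s \<le> x" "x \<le> t" "t - s < \<delta>" "c \<le> s" "t \<le> d" for s t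
      proof -
        have "(LINT r:{s..t}|lebesgue. h r - q) = (LINT r:{s..t}|lebesgue. h r) - (LINT r:{s..t}|lebesgue. q)"
          by (rule set_integral_diff) (use sub[OF h] st in \<open>auto simp: set_integrable_def\<close>)
        also have "(LINT r:{s..t}|lebesgue. q) = (t - s) *\<^sub>R q"
          using st by (subst set_integral_const) auto
        finally have 1: "V t - V s - (t - s) *\<^sub>R q = (LINT r:{s..t}|lebesgue. h r - q)"
          using V[of s t] st by simp
        have "norm (LINT r:{s..t}|lebesgue. h r - q) \<le> (LINT r:{s..t}|lebesgue. norm (h r - q))"
          using set_integral_norm_bound[OF sub[OF hq]] st by simp
        also have "\<dots> = integral {s..t} (\<lambda>r. norm (h r - q))"
          using sub[OF \<phi>] st by (intro set_lebesgue_integral_eq_integral) auto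
        also have "\<dots> \<le> (t - s) * norm (h x - q) + e/3 * (t - s)"
          using \<delta>(2)[OF st] by linarith
        finally have 2: "norm (V t - V s - (t - s) *\<^sub>R q) \<le> (t - s) * norm (h x - q) + e/3 * (t - s)"
          using 1 by simp
        have "norm (V t - V s - (t - s) *\<^sub>R h x) \<le> norm (V t - V s - (t - s) *\<^sub>R q) + norm ((t - s) *\<^sub>R (h x - q))"
          by (rule order_trans[OF _ norm_triangle_ineq4]) (simp add: algebra_simps)
        also have "norm ((t - s) *\<^sub>R (h x - q)) = (t - s) * norm (h x - q)" using st by simp
        also have "norm (V t - V s - (t - s) *\<^sub>R q) + (t - s) * norm (h x - q) \<le>
            (t - s) * norm (h x - q) + e/3 * (t - s) + (t - s) * norm (h x - q)" using 2 by simp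
        also have "\<dots> \<le> (t - s) * (e/3) + e/3 * (t - s) + (t - s) * (e/3)"
          using qx st e by (intro add_mono mult_left_mono) auto
        also have "\<dots> = e * (t - s)" by (simp add: field_simps)
        finally show ?thesis .
      qed
      with \<delta>(1) show ?thesis by blast
    qed
    show "(V has_vector_derivative h x) (at x)"
      unfolding has_vector_derivative_def has_derivative_at_alt
    proof (intro conjI allI impI bounded_linear_scaleR_left)
      fix e :: real assume "e > 0"
      then obtain \<delta> where \<delta>: "\<delta> > 0" and all: "\<forall>s t. s \<le> x \<and> x \<le> t \<and> t - s < \<delta> \<and> c \<le> s \<and> t \<le> d \<longrightarrow>
        norm (V t - V s - (t - s) *\<^sub>R h x) \<le> e * (t - s)"
        using key[OF \<open>e > 0\<close>] by (elim exE conjE) (rule that)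
      have "norm (V y - V x - (y - x) *\<^sub>R h x) \<le> e * norm (y - x)" if y: "norm (y - x) < min \<delta> (min (x - c) (d - x))" for y
      proof (cases "x \<le> y")
        case True then show ?thesis using all[THEN spec, of x, THEN spec, of y] y x by auto
      next
        case False
        then have "norm (V x - V y - (x - y) *\<^sub>R h x) \<le> e * (x - y)" using all[THEN spec, of y, THEN spec, of x] y x by auto
        moreover have "V y - V x - (y - x) *\<^sub>R h x = - (V x - V y - (x - y) *\<^sub>R h x)"
          by (simp add: algebra_simps)
        ultimately show ?thesis using False by (metis abs_minus_commute abs_of_pos diff_gt_0_iff_gt norm_minus_cancel not_le real_norm_def)
      qed
      then show "\<exists>da>0. \<forall>y. norm (y - x) < da \<longrightarrow> norm (V y - V x - (y - x) *\<^sub>R h x) \<le> e * norm (y - x)"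
        using \<delta> x by (intro exI[of _ "min \<delta> (min (x - c) (d - x))"]) auto
    qed
  qed
qed

section \<open>Lipschitz functions and the scalar energy identity\<close>

lemma lipschitz_imp_abs_continuous:
  fixes f :: "real \<Rightarrow> 'a::metric_space"
  assumes "L-lipschitz_on {a..b} f"
  shows "abs_continuous_on_interval a b f"
  unfolding abs_continuous_on_interval_def
proof (intro allI impI)
  fix \<epsilon> :: real assume \<epsilon>: "\<epsilon> > 0"
  have L: "L \<ge> 0" using assms by (rule lipschitz_on_nonneg)
  have "(\<Sum>i<n. dist (f (l i)) (f (r i))) < \<epsilon>"
    if lr: "\<forall>i<n. a \<le> l i \<and> l i \<le> r i \<and> r i \<le> b" and sm: "(\<Sum>i<n. r i - l i) < \<epsilon> / (L + 1)" for n :: nat and l r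
  proof -
    have "(\<Sum>i<n. dist (f (l i)) (f (r i))) \<le> (\<Sum>i<n. L * (r i - l i))"
    proof (rule sum_mono)
      fix i assume "i \<in> {..<n}"
      then have i: "a \<le> l i" "l i \<le> r i" "r i \<le> b" using lr by auto
      then show "dist (f (l i)) (f (r i)) \<le> L * (r i - l i)"
        using lipschitz_onD[OF assms, of "l i" "r i"] by (auto simp: dist_real_def)
    qed
    also have "\<dots> = L * (\<Sum>i<n. r i - l i)" by (simp add: sum_distrib_left)
    also have "\<dots> \<le> L * (\<epsilon> / (L + 1))" using sm L by (intro mult_left_mono) auto
    also have "\<dots> < \<epsilon>" using L \<epsilon> by (simp add: field_simps)
    finally show ?thesis .
  qed
  then show "\<exists>\<delta>>0. \<forall>(n::nat) l r. (\<forall>i<n. a \<le> l i \<and> l i \<le> r i \<and> r i \<le> b) \<and>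
        (\<forall>i<n. \<forall>j<n. i \<noteq> j \<longrightarrow> {l i<..<r i} \<inter> {l j<..<r j} = {}) \<and> (\<Sum>i<n. r i - l i) < \<delta> \<longrightarrow>
        (\<Sum>i<n. dist (f (l i)) (f (r i))) < \<epsilon>"
    using \<epsilon> L by (intro exI[of _ "\<epsilon> / (L + 1)"]) auto
qed

lemma lipschitz_on_mult_real:
  fixes f g :: "real \<Rightarrow> real"
  assumes f: "L-lipschitz_on {a..b} f" and g: "M-lipschitz_on {a..b} g"
  obtains K where "K-lipschitz_on {a..b} (\<lambda>x. f x * g x)"
proof -
  have "bounded (f ` {a..b})" "bounded (g ` {a..b})"
    using f g by (auto intro!: compact_imp_bounded compact_continuous_image lipschitz_on_continuous_on)
  then obtain A B where A: "\<And>x. x \<in> {a..b} \<Longrightarrow> \<bar>f x\<bar> \<le> A" and B: "\<And>x. x \<in> {a..b} \<Longrightarrow> \<bar>g x\<bar> \<le> B"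
    unfolding bounded_iff by (metis imageI real_norm_def)
  have LM: "L \<ge> 0" "M \<ge> 0" using f g by (auto intro: lipschitz_on_nonneg)
  have "(L * \<bar>B\<bar> + \<bar>A\<bar> * M)-lipschitz_on {a..b} (\<lambda>x. f x * g x)"
  proof (rule lipschitz_onI)
    fix x y assume xy: "x \<in> {a..b}" "y \<in> {a..b}"
    have "f x * g x - f y * g y = (f x - f y) * g x + f y * (g x - g y)" by (simp add: algebra_simps)
    then have "\<bar>f x * g x - f y * g y\<bar> \<le> \<bar>f x - f y\<bar> * \<bar>g x\<bar> + \<bar>f y\<bar> * \<bar>g x - g y\<bar>"
      by (metis abs_mult abs_triangle_ineq)
    also have "\<dots> \<le> (L * \<bar>x - y\<bar>) * \<bar>B\<bar> + \<bar>A\<bar> * (M * \<bar>x - y\<bar>)"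
      using lipschitz_onD[OF f xy] lipschitz_onD[OF g xy] A[of y] B[of x] xy LM
      by (intro add_mono mult_mono) (auto simp: dist_real_def)
    finally show "dist (f x * g x) (f y * g y) \<le> (L * \<bar>B\<bar> + \<bar>A\<bar> * M) * dist x y"
      by (simp add: dist_real_def algebra_simps)
  qed (use LM in auto)
  then show ?thesis using that by blast
qed

lemma integral_lipschitz:
  fixes y h :: "real \<Rightarrow> real"
  assumes I: "\<And>s t. a \<le> s \<Longrightarrow> s \<le> t \<Longrightarrow> t \<le> b \<Longrightarrow> (h has_integral y t - y s) {s..t}"
    and C: "\<And>r. r \<in> {a..b} \<Longrightarrow> \<bar>h r\<bar> \<le> C" and C0: "C \<ge> 0"
  shows "C-lipschitz_on {a..b} y"
proof (rule lipschitz_onI)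
  have *: "\<bar>y t - y s\<bar> \<le> C * (t - s)" if "a \<le> s" "s \<le> t" "t \<le> b" for s t
    using has_integral_bound[of C h "y t - y s" s t] I[OF that] C C0 that by auto
  fix s t assume "s \<in> {a..b}" "t \<in> {a..b}"
  then show "dist (y s) (y t) \<le> C * dist s t"
    using *[of s t] *[of t s] by (cases "s \<le> t") (auto simp: dist_real_def abs_minus_commute)
qed (rule C0)

lemma integral_bounded_derivative:
  fixes y h :: "real \<Rightarrow> real"
  assumes I: "\<And>s t. a \<le> s \<Longrightarrow> s \<le> t \<Longrightarrow> t \<le> b \<Longrightarrow> (h has_integral y t - y s) {s..t}"
    and C: "\<And>r. r \<in> {a..b} \<Longrightarrow> \<bar>h r\<bar> \<le> C" and ab: "a \<le> b"
  obtains N where "negligible N" "\<And>x. x \<in> {a..b} - N \<Longrightarrow> (y has_real_derivative h x) (at x)"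
proof -
  have "h integrable_on {a..b}" using I[of a b] ab by auto
  then have abs: "h absolutely_integrable_on {a..b}"
    by (rule absolutely_integrable_integrable_bound[rotated, where g = "\<lambda>_. C"]) (use C in auto)
  have V: "y t - y s = (LINT r:{s..t}|lebesgue. h r)" if "a \<le> s" "s \<le> t" "t \<le> b" for s t
  proof -
    have "h absolutely_integrable_on {s..t}" using that by (intro set_integrable_subset[OF abs]) auto
    then show ?thesis using I[OF that] by (simp add: set_lebesgue_integral_eq_integral integral_unique)
  qed
  obtain N where N: "negligible N" "\<And>x. x \<in> {a<..<b} - N \<Longrightarrow> (y has_vector_derivative h x) (at x)"
    using lebesgue_differentiation_banach[OF abs V] by blast
  have neg: "negligible (N \<union> {a, b})" using N(1) by (simp add: negligible_Un)
  show ?thesis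
    by (rule that[OF neg]) (use N(2) in \<open>auto simp: has_real_derivative_iff_has_vector_derivative\<close>)
qed

text \<open>As \<open>y\<close> is merely an indefinite integral of a bounded \<open>h\<close>, the
  product rule holds only almost everywhere. The products are Lipschitz, hence absolutely
  continuous, so the fundamental theorem turns it into an identity. The weight \<open>p\<close>
  stays free because smoothing estimates need an exponential in one place and an affine function in
  another.\<close>

lemma energy_identity:
  fixes y h p p' :: "real \<Rightarrow> real"
  assumes ab: "a \<le> b" and I: "\<And>s t. a \<le> s \<Longrightarrow> s \<le> t \<Longrightarrow> t \<le> b \<Longrightarrow> (h has_integral y t - y s) {s..t}"
    and C: "\<And>r. r \<in> {a..b} \<Longrightarrow> \<bar>h r\<bar> \<le> C"
    and p: "\<And>r. (p has_real_derivative p' r) (at r)" and p': "continuous_on UNIV p'"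
  shows "((\<lambda>r. p' r * (y r)\<^sup>2 + 2 * p r * y r * h r) has_integral p b * (y b)\<^sup>2 - p a * (y a)\<^sup>2) {a..b}"
proof -
  have "C \<ge> 0" using C[of a] ab by auto
  have ly: "C-lipschitz_on {a..b} y" by (rule integral_lipschitz[OF I C \<open>C \<ge> 0\<close>])
  have "bounded (p' ` {a..b})"
    using p' by (intro compact_imp_bounded compact_continuous_image) (auto intro: continuous_on_subset)
  then obtain P where P: "\<And>r. r \<in> {a..b} \<Longrightarrow> norm (p' r) \<le> P" unfolding bounded_iff by (metis imageI)
  have P0: "P \<ge> 0" using P[of a] ab by auto
  have "(p has_vector_derivative p' r) (at r within S)" for r S
    using p[of r] by (simp add: has_real_derivative_iff_has_vector_derivative has_vector_derivative_at_within)
  then have "(p' has_integral p t - p s) {s..t}" if "s \<le> t" for s t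
    using that by (intro fundamental_theorem_of_calculus) auto
  then have lp: "P-lipschitz_on {a..b} p"
    using P P0 by (intro integral_lipschitz[where h = p']) simp_all
  obtain K1 where K1: "K1-lipschitz_on {a..b} (\<lambda>x. y x * y x)" using lipschitz_on_mult_real[OF ly ly] .
  obtain K2 where K2: "K2-lipschitz_on {a..b} (\<lambda>x. p x * (y x * y x))" using lipschitz_on_mult_real[OF lp K1] .
  obtain N where N: "negligible N" "\<And>x. x \<in> {a..b} - N \<Longrightarrow> (y has_real_derivative h x) (at x)"
    using integral_bounded_derivative[OF I C ab] by blast
  have "((\<lambda>r. p' r * (y r * y r) + p r * (h r * y r + y r * h r)) has_integral p b * (y b * y b) - p a * (y a * y a)) {a..b}"
  proof (rule abs_continuous_FTC[OF ab lipschitz_imp_abs_continuous[OF K2] N(1)])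
    fix x assume "x \<in> {a..b} - N"
    then have "((\<lambda>x. p x * (y x * y x)) has_real_derivative p' x * (y x * y x) + p x * (h x * y x + y x * h x)) (at x)"
      using p N(2) by (auto intro!: derivative_eq_intros)
    then show "((\<lambda>x. p x * (y x * y x)) has_vector_derivative p' x * (y x * y x) + p x * (h x * y x + y x * h x)) (at x within {a..b})"
      by (simp add: has_real_derivative_iff_has_vector_derivative has_vector_derivative_at_within)
  qed
  then show ?thesis by (simp add: power2_eq_square algebra_simps)
qed

section \<open>The Hilbert space \<open>L\<^sup>2(0,1)\<close>\<close>

lemma AE_unit_iff: "(AE x in unit_measure. P x) \<longleftrightarrow> (AE x in lborel. 0 < x \<and> x < 1 \<longrightarrow> P x)"
  by (subst AE_restrict_space_iff) (auto simp: AE_completion_iff)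

lemma finite_unit_measure: "finite_measure unit_measure"
  by (rule finite_measure_lebesgue_on) auto

lemma borel_imp_unit_measurable: "f \<in> borel_measurable borel \<Longrightarrow> f \<in> borel_measurable unit_measure"
  for f :: "real \<Rightarrow> 'a::topological_space"
  by (intro measurable_restrict_space1 measurable_completion) simp

lemma integrable_bounded_unit:
  fixes f :: "real \<Rightarrow> real"
  assumes "f \<in> borel_measurable unit_measure" "\<And>x. 0 < x \<Longrightarrow> x < 1 \<Longrightarrow> \<bar>f x\<bar> \<le> B"
  shows "integrable unit_measure f"
  by (rule finite_measure.integrable_const_bound[OF finite_unit_measure, of _ B])
    (use assms in \<open>auto intro!: AE_I2\<close>)

lemma square_integrable_bounded:
  assumes f: "f \<in> borel_measurable unit_measure" and B: "\<And>x. 0 < x \<Longrightarrow> x < 1 \<Longrightarrow> \<bar>f x\<bar> \<le> B"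
  shows "square_integrable f"
  unfolding square_integrable_def
proof
  have "\<bar>(f x)\<^sup>2\<bar> \<le> B\<^sup>2" if "0 < x" "x < 1" for x
    using B[OF that] abs_le_square_iff[of "f x" B] by (simp add: abs_le_square_iff)
  then show "integrable unit_measure (\<lambda>x. (f x)\<^sup>2)"
    using f by (intro integrable_bounded_unit[where B = "B\<^sup>2"]) auto
qed (rule f)

lemma square_integrable_continuous:
  assumes f: "continuous_on {0..1} f"
  shows "square_integrable f"
proof -
  have "compact (f ` {0..1})" using f by (intro compact_continuous_image) auto
  then obtain B where B: "\<And>x. x \<in> {0..1} \<Longrightarrow> \<bar>f x\<bar> \<le> B"
    using compact_imp_bounded bounded_iff by (metis imageI real_norm_def)
  have "continuous_on {0<..<1} f" using f by (rule continuous_on_subset) auto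
  then have "f \<in> borel_measurable unit_measure"
    by (intro continuous_imp_measurable_on_sets_lebesgue) auto
  then show ?thesis using B by (intro square_integrable_bounded[where B = B]) auto
qed

lemma square_integrable_rep: "square_integrable (rep_l2 u)"
  using Quotient3_rep_reflp[OF Quotient3_l2, of u] by (simp add: l2_eq_def)

lemma abs_rep_l2: "abs_l2 (rep_l2 u) = u"
  by (rule Quotient3_abs_rep[OF Quotient3_l2])

lemma abs_l2_eq_iff:
  assumes "square_integrable f" "square_integrable g"
  shows "abs_l2 f = abs_l2 g \<longleftrightarrow> (AE x in unit_measure. f x = g x)"
  using Quotient3_rel[OF Quotient3_l2, of f g] assms by (auto simp: l2_eq_def)

lemma inner_abs:
  assumes "square_integrable f" "square_integrable g"
  shows "inner (abs_l2 f) (abs_l2 g) = (LINT x|unit_measure. f x * g x)"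
  using assms by (intro inner_l2.abs_eq) (auto simp: l2_eq_def)

lemma inner_rep_abs:
  assumes "square_integrable g"
  shows "inner u (abs_l2 g) = (LINT x|unit_measure. rep_l2 u x * g x)"
  using inner_abs[OF square_integrable_rep assms, of u] by (simp add: abs_rep_l2)

lemma add_abs:
  assumes "square_integrable f" "square_integrable g"
  shows "abs_l2 f + abs_l2 g = abs_l2 (\<lambda>x. f x + g x)"
  using assms by (intro plus_l2.abs_eq) (auto simp: l2_eq_def)

lemma scale_abs:
  assumes "square_integrable f"
  shows "c *\<^sub>R abs_l2 f = abs_l2 (\<lambda>x. c * f x)"
  using assms by (intro scaleR_l2.abs_eq) (auto simp: l2_eq_def)

lemma square_integrable_diff:
  assumes "square_integrable f" "square_integrable g"
  shows "square_integrable (\<lambda>x. f x - g x)"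
  using square_integrable_add[OF assms(1) square_integrable_scale[OF assms(2), of "-1"]] by simp

lemma diff_abs:
  assumes "square_integrable f" "square_integrable g"
  shows "abs_l2 f - abs_l2 g = abs_l2 (\<lambda>x. f x - g x)"
  using add_abs[OF assms(1) square_integrable_scale[OF assms(2), of "-1"]] scale_abs[OF assms(2), of "-1"]
  by (simp add: minus_l2_def)

lemma zero_l2_abs: "0 = abs_l2 (\<lambda>_. 0)"
  by (simp add: zero_l2_def)

lemma norm_abs_l2:
  assumes "square_integrable f"
  shows "(norm (abs_l2 f))\<^sup>2 = (LINT x|unit_measure. (f x)\<^sup>2)"
  using inner_abs[OF assms assms] by (simp add: power2_norm_eq_inner power2_eq_square[where a = "f x" for x])

lemma norm_diff_abs_l2:
  assumes "square_integrable f" "square_integrable g"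
  shows "(norm (abs_l2 f - abs_l2 g))\<^sup>2 = (LINT x|unit_measure. (f x - g x)\<^sup>2)"
  using assms by (simp add: diff_abs norm_abs_l2 square_integrable_diff)

text \<open>Fatou's lemma for squared distances to a fixed \<open>h\<close>. Integrability of the
  difference is obtained without knowing anything about \<open>g\<close> beyond measurability, which
  suits both the identification of pointwise limits and the completeness proof.\<close>

lemma L2_Fatou:
  fixes F :: "nat \<Rightarrow> 'a \<Rightarrow> real"
  assumes F: "\<And>m. F m \<in> borel_measurable M" and g: "g \<in> borel_measurable M" and h: "h \<in> borel_measurable M"
    and lim: "AE x in M. (\<lambda>m. F m x) \<longlonglongrightarrow> g x"
    and int: "\<forall>\<^sub>F m in sequentially. integrable M (\<lambda>x. (F m x - h x)\<^sup>2) \<and> (LINT x|M. (F m x - h x)\<^sup>2) \<le> C"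
  shows "integrable M (\<lambda>x. (g x - h x)\<^sup>2)" "(LINT x|M. (g x - h x)\<^sup>2) \<le> C"
proof -
  have "\<forall>\<^sub>F m in sequentially. 0 \<le> C"
    using int by eventually_elim (metis (no_types, lifting) Bochner_Integration.integral_nonneg order_trans zero_le_power2)
  then have C: "0 \<le> C" by simp
  have "(\<integral>\<^sup>+x. ennreal ((g x - h x)\<^sup>2) \<partial>M) = (\<integral>\<^sup>+x. liminf (\<lambda>m. ennreal ((F m x - h x)\<^sup>2)) \<partial>M)"
  proof (rule nn_integral_cong_AE)
    show "AE x in M. ennreal ((g x - h x)\<^sup>2) = liminf (\<lambda>m. ennreal ((F m x - h x)\<^sup>2))"
      using lim
    proof eventually_elim
      case (elim x)
      have "(\<lambda>m. ennreal ((F m x - h x)\<^sup>2)) \<longlonglongrightarrow> ennreal ((g x - h x)\<^sup>2)"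
        by (intro tendsto_ennrealI tendsto_intros elim)
      then show ?case by (rule lim_imp_Liminf[OF sequentially_bot, symmetric])
    qed
  qed
  also have "\<dots> \<le> liminf (\<lambda>m. \<integral>\<^sup>+x. ennreal ((F m x - h x)\<^sup>2) \<partial>M)"
    by (rule nn_integral_liminf) (use F h in measurable)
  also have "\<dots> \<le> ennreal C"
  proof (rule Liminf_le)
    show "\<forall>\<^sub>F m in sequentially. (\<integral>\<^sup>+x. ennreal ((F m x - h x)\<^sup>2) \<partial>M) \<le> ennreal C"
      using int by eventually_elim (simp add: nn_integral_eq_integral ennreal_leI)
  qed simp
  finally have le: "(\<integral>\<^sup>+x. ennreal ((g x - h x)\<^sup>2) \<partial>M) \<le> ennreal C" .
  show i: "integrable M (\<lambda>x. (g x - h x)\<^sup>2)"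
    using le g h by (intro integrableI_bounded) (auto simp: order_le_less_trans)
  show "(LINT x|M. (g x - h x)\<^sup>2) \<le> C"
    using le C by (simp add: nn_integral_eq_integral[OF i])
qed

text \<open>Fatou bounds the squared distance between \<open>g\<close> and a representative of
  \<open>w\<close> by every positive number. This later identifies the sections of an almost
  everywhere limit in space-time with the limits taken in \<open>l2\<close> at fixed times.\<close>

lemma abs_l2_limit_unique:
  assumes G: "\<And>m. square_integrable (G m)" and lim: "(\<lambda>m. abs_l2 (G m)) \<longlonglongrightarrow> w"
    and g: "g \<in> borel_measurable unit_measure" and ae: "AE x in unit_measure. (\<lambda>m. G m x) \<longlonglongrightarrow> g x"
  shows "square_integrable g" "abs_l2 g = w"
proof -
  note sw = square_integrable_rep[of w]
  have G': "G m \<in> borel_measurable unit_measure" for m using G by (simp add: square_integrable_def)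
  have w': "rep_l2 w \<in> borel_measurable unit_measure" using sw by (simp add: square_integrable_def)
  have I: "integrable unit_measure (\<lambda>x. (g x - rep_l2 w x)\<^sup>2)"
    and le: "(LINT x|unit_measure. (g x - rep_l2 w x)\<^sup>2) \<le> e" if "e > 0" for e
  proof -
    have "(\<lambda>m. (norm (abs_l2 (G m) - w))\<^sup>2) \<longlonglongrightarrow> (norm (w - w))\<^sup>2"
      by (intro tendsto_intros lim)
    then have "\<forall>\<^sub>F m in sequentially. (norm (abs_l2 (G m) - w))\<^sup>2 < e"
      using \<open>e > 0\<close> by (intro order_tendstoD(2)) auto
    then have "\<forall>\<^sub>F m in sequentially. integrable unit_measure (\<lambda>x. (G m x - rep_l2 w x)\<^sup>2) \<and>
        (LINT x|unit_measure. (G m x - rep_l2 w x)\<^sup>2) \<le> e"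
    proof eventually_elim
      case (elim m)
      then show ?case
        using norm_diff_abs_l2[OF G[of m] sw] square_integrable_diff[OF G[of m] sw]
        by (simp add: abs_rep_l2 square_integrable_def)
    qed
    from L2_Fatou[OF G' g w' ae this]
    show "integrable unit_measure (\<lambda>x. (g x - rep_l2 w x)\<^sup>2)"
      "(LINT x|unit_measure. (g x - rep_l2 w x)\<^sup>2) \<le> e" by auto
  qed
  have sd: "square_integrable (\<lambda>x. g x - rep_l2 w x)"
    using I[of 1] g w' by (simp add: square_integrable_def)
  from square_integrable_add[OF sd sw] show sg: "square_integrable g" by simp
  have "(LINT x|unit_measure. (g x - rep_l2 w x)\<^sup>2) \<le> 0"
    using le by (rule field_le_epsilon) auto
  then have "(norm (abs_l2 g - abs_l2 (rep_l2 w)))\<^sup>2 \<le> 0"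
    using norm_diff_abs_l2[OF sg sw] by simp
  then show "abs_l2 g = w" by (simp add: abs_rep_l2)
qed

text \<open>On a set of finite measure a Cauchy sequence in L^2 is Cauchy in L^1, so a subsequence
  of representatives converges almost everywhere. Fatou's lemma, applied against each fixed
  \<open>F n\<close>, gives the L^2 estimate back for the whole sequence.\<close>

instance l2 :: complete_space
proof
  fix X :: "nat \<Rightarrow> l2" assume X: "Cauchy X"
  define F where "F n = rep_l2 (X n)" for n
  have F: "square_integrable (F n)" for n by (simp add: F_def square_integrable_rep)
  have one: "square_integrable (\<lambda>_. 1)" by (rule square_integrable_continuous) auto
  have F1: "integrable unit_measure (F n)" for n using square_integrable_mult[OF F one] by simp
  have L1: "(LINT x|unit_measure. norm (F i x - F j x)) \<le> dist (X i) (X j) * norm (abs_l2 (\<lambda>_. 1))" for i j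
  proof -
    let ?A = "\<lambda>x. norm (F i x - F j x)"
    have sA: "square_integrable ?A"
      using square_integrable_diff[OF F F, of i j] by (auto simp: square_integrable_def)
    have "(norm (abs_l2 ?A))\<^sup>2 = (norm (abs_l2 (F i) - abs_l2 (F j)))\<^sup>2"
      unfolding norm_abs_l2[OF sA] norm_diff_abs_l2[OF F F] by simp
    then have n: "norm (abs_l2 ?A) = dist (X i) (X j)"
      by (simp add: F_def abs_rep_l2 dist_norm)
    have "(LINT x|unit_measure. ?A x) = inner (abs_l2 ?A) (abs_l2 (\<lambda>_. 1))"
      unfolding inner_abs[OF sA one] by simp
    also have "\<dots> \<le> norm (abs_l2 ?A) * norm (abs_l2 (\<lambda>_. 1))" by (rule norm_cauchy_schwarz)
    finally show ?thesis unfolding n .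
  qed
  obtain r where r: "strict_mono r" and ae: "AE x in unit_measure. Cauchy (\<lambda>i. F (r i) x)"
  proof (rule cauchy_L1_AE_cauchy_subseq[of unit_measure F, OF F1])
    fix e :: real assume "e > 0"
    define K where "K = norm (abs_l2 (\<lambda>_. 1)) + 1"
    have K: "K > 0" unfolding K_def by (simp add: add_nonneg_pos)
    obtain N where N: "\<And>i j. i \<ge> N \<Longrightarrow> j \<ge> N \<Longrightarrow> dist (X i) (X j) < e / K"
      using X \<open>e > 0\<close> K unfolding Cauchy_def by (meson divide_pos_pos)
    have "(LINT x|unit_measure. norm (F i x - F j x)) < e" if "i \<ge> N" "j \<ge> N" for i j
    proof -
      have "(LINT x|unit_measure. norm (F i x - F j x)) \<le> dist (X i) (X j) * K"
        by (rule order_trans[OF L1]) (simp add: K_def mult_left_mono)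
      also have "\<dots> < e" using N[OF that] K by (simp add: field_simps)
      finally show ?thesis .
    qed
    then show "\<exists>N. \<forall>i\<ge>N. \<forall>j\<ge>N. (LINT x|unit_measure. norm (F i x - F j x)) < e" by blast
  qed
  define g where "g x = lim (\<lambda>i. F (r i) x)" for x
  have Fm: "F n \<in> borel_measurable unit_measure" for n using F by (simp add: square_integrable_def)
  then have gm: "g \<in> borel_measurable unit_measure" unfolding g_def by measurable
  have lim: "AE x in unit_measure. (\<lambda>i. F (r i) x) \<longlonglongrightarrow> g x"
    using ae by eventually_elim (simp add: g_def Cauchy_convergent_iff convergent_LIMSEQ_iff)
  have key: "integrable unit_measure (\<lambda>x. (g x - F n x)\<^sup>2) \<and> (LINT x|unit_measure. (g x - F n x)\<^sup>2) \<le> e\<^sup>2"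
    if N: "\<And>i j. i \<ge> N \<Longrightarrow> j \<ge> N \<Longrightarrow> dist (X i) (X j) < e" and n: "n \<ge> N" and e: "e > 0" for N n e
  proof -
    have "\<forall>\<^sub>F m in sequentially. integrable unit_measure (\<lambda>x. (F (r m) x - F n x)\<^sup>2) \<and>
        (LINT x|unit_measure. (F (r m) x - F n x)\<^sup>2) \<le> e\<^sup>2"
    proof (rule eventually_sequentiallyI[of N])
      fix m assume "N \<le> m"
      then have "N \<le> r m" using seq_suble[OF r, of m] by simp
      then have "norm (X (r m) - X n) \<le> e" using N[OF _ n] by (simp add: dist_norm less_imp_le)
      then have "(norm (abs_l2 (F (r m)) - abs_l2 (F n)))\<^sup>2 \<le> e\<^sup>2"
        using power_mono[OF _ norm_ge_zero] by (simp add: F_def abs_rep_l2)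
      then show "integrable unit_measure (\<lambda>x. (F (r m) x - F n x)\<^sup>2) \<and>
        (LINT x|unit_measure. (F (r m) x - F n x)\<^sup>2) \<le> e\<^sup>2"
        using square_integrable_diff[OF F F, of "r m" n]
        by (simp add: norm_diff_abs_l2[OF F F] square_integrable_def)
    qed
    from L2_Fatou[OF Fm gm Fm lim this] show ?thesis by auto
  qed
  have Ce: "\<exists>N. \<forall>i\<ge>N. \<forall>j\<ge>N. dist (X i) (X j) < e" if "e > 0" for e
    using X that unfolding Cauchy_def by blast
  obtain N1 where N1: "\<forall>i\<ge>N1. \<forall>j\<ge>N1. dist (X i) (X j) < 1" using Ce[of 1] by auto
  have "square_integrable (\<lambda>x. g x - F N1 x)"
    using key[of N1 1 N1] N1 gm Fm by (auto simp: square_integrable_def)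
  from square_integrable_add[OF this F[of N1]] have g: "square_integrable g" by simp
  have "X \<longlonglongrightarrow> abs_l2 g"
  proof (rule metric_LIMSEQ_I)
    fix e :: real assume "e > 0"
    then obtain N where N: "\<forall>i\<ge>N. \<forall>j\<ge>N. dist (X i) (X j) < e/2" using Ce[of "e/2"] by auto
    have "dist (X n) (abs_l2 g) < e" if "n \<ge> N" for n
    proof -
      have "(norm (abs_l2 g - abs_l2 (F n)))\<^sup>2 \<le> (e/2)\<^sup>2"
        using key[of N "e/2" n] N that \<open>e > 0\<close> unfolding norm_diff_abs_l2[OF g F] by auto
      then have "norm (abs_l2 g - X n) \<le> e/2"
        using \<open>e > 0\<close> power2_le_imp_le[of "norm (abs_l2 g - abs_l2 (F n))" "e/2"]
        by (simp add: F_def abs_rep_l2)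
      then show ?thesis using \<open>e > 0\<close> by (simp add: dist_norm norm_minus_commute)
    qed
    then show "\<exists>N. \<forall>n\<ge>N. dist (X n) (abs_l2 g) < e" by blast
  qed
  then show "convergent X" by (auto simp: convergent_def)
qed

instance l2 :: banach ..

subsection \<open>Orthonormal sequences\<close>

lemma inner_orthonormal_sum:
  fixes e :: "nat \<Rightarrow> 'a::real_inner"
  assumes on: "\<And>j k. inner (e j) (e k) = of_bool (j = k)" and "finite I"
  shows "inner (\<Sum>k\<in>I. a k *\<^sub>R e k) (e j) = (if j \<in> I then a j else 0)"
  using assms(2) by (simp add: inner_sum_left on of_bool_def if_distrib sum.delta cong: if_cong)

lemma norm_orthonormal_sum:
  fixes e :: "nat \<Rightarrow> 'a::real_inner"
  assumes on: "\<And>j k. inner (e j) (e k) = of_bool (j = k)" and "finite I"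
  shows "(norm (\<Sum>k\<in>I. a k *\<^sub>R e k))\<^sup>2 = (\<Sum>k\<in>I. (a k)\<^sup>2)"
proof -
  have "(norm (\<Sum>k\<in>I. a k *\<^sub>R e k))\<^sup>2 = (\<Sum>j\<in>I. a j * inner (\<Sum>k\<in>I. a k *\<^sub>R e k) (e j))"
    unfolding power2_norm_eq_inner by (subst inner_sum_right) simp
  also have "\<dots> = (\<Sum>j\<in>I. (a j)\<^sup>2)"
    using assms(2) by (intro sum.cong) (auto simp: inner_orthonormal_sum[OF on] power2_eq_square)
  finally show ?thesis .
qed

lemma bessel_sum:
  fixes e :: "nat \<Rightarrow> 'a::real_inner"
  assumes on: "\<And>j k. inner (e j) (e k) = of_bool (j = k)" and I: "finite I"
  shows "(\<Sum>k\<in>I. (inner u (e k))\<^sup>2) \<le> (norm u)\<^sup>2"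
proof -
  let ?S = "\<Sum>k\<in>I. inner u (e k) *\<^sub>R e k"
  have "inner u ?S = (\<Sum>k\<in>I. (inner u (e k))\<^sup>2)"
    by (simp add: inner_sum_right power2_eq_square)
  moreover have "inner ?S ?S = (\<Sum>k\<in>I. (inner u (e k))\<^sup>2)"
    using norm_orthonormal_sum[OF on I] by (simp add: power2_norm_eq_inner)
  moreover have "0 \<le> inner (u - ?S) (u - ?S)" by simp
  ultimately show ?thesis
    by (simp add: inner_diff_left inner_diff_right inner_commute[of ?S u] power2_norm_eq_inner)
qed

lemma summable_coefficients:
  fixes e :: "nat \<Rightarrow> 'a::real_inner"
  assumes on: "\<And>j k. inner (e j) (e k) = of_bool (j = k)"
  shows "summable (\<lambda>k. (inner u (e k))\<^sup>2)"
  using bessel_sum[OF on, of "{..<n}" u for n] by (intro summableI_nonneg_bounded[where x = "(norm u)\<^sup>2"]) auto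

lemma Riesz_Fischer:
  fixes e :: "nat \<Rightarrow> 'a::{real_inner, complete_space}"
  assumes on: "\<And>j k. inner (e j) (e k) = of_bool (j = k)" and a: "summable (\<lambda>k. (a k)\<^sup>2)"
  obtains u where "(\<lambda>n. \<Sum>k<n. a k *\<^sub>R e k) \<longlonglongrightarrow> u" "\<And>k. inner u (e k) = a k"
proof -
  let ?S = "\<lambda>n. \<Sum>k<n. a k *\<^sub>R e k"
  have "Cauchy ?S"
  proof (rule CauchyI')
    fix \<epsilon> :: real assume "\<epsilon> > 0"
    then obtain N where N: "\<And>m n. m \<ge> N \<Longrightarrow> norm (\<Sum>k\<in>{m..<n}. (a k)\<^sup>2) < \<epsilon>\<^sup>2"
      using a[unfolded summable_Cauchy, rule_format, of "\<epsilon>\<^sup>2"] by auto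
    have "dist (?S m) (?S n) < \<epsilon>" if "m \<ge> N" "n > m" for m n
    proof -
      have "?S n - ?S m = (\<Sum>k\<in>{m..<n}. a k *\<^sub>R e k)"
        using sum_diff_nat_ivl[of 0 m n "\<lambda>k. a k *\<^sub>R e k"] that by (simp add: atLeast0LessThan)
      then have "(norm (?S n - ?S m))\<^sup>2 = (\<Sum>k\<in>{m..<n}. (a k)\<^sup>2)"
        using norm_orthonormal_sum[OF on] by simp
      also have "\<dots> < \<epsilon>\<^sup>2" using N[OF that(1), of n] by simp
      finally have "norm (?S n - ?S m) < \<epsilon>" using \<open>\<epsilon> > 0\<close> by (rule power2_less_imp_less[OF _ less_imp_le])
      then show ?thesis by (simp add: dist_norm norm_minus_commute)
    qed
    then show "\<exists>M. \<forall>m\<ge>M. \<forall>n>m. dist (?S m) (?S n) < \<epsilon>" by blast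
  qed
  then obtain u where u: "?S \<longlonglongrightarrow> u" by (auto simp: Cauchy_convergent_iff convergent_def)
  have "inner u (e k) = a k" for k
  proof (rule LIMSEQ_unique)
    show "(\<lambda>n. inner (?S n) (e k)) \<longlonglongrightarrow> inner u (e k)" by (intro tendsto_intros u)
    have "inner (?S n) (e k) = a k" if "n > k" for n
      using inner_orthonormal_sum[OF on, of "{..<n}" a k] that by simp
    then show "(\<lambda>n. inner (?S n) (e k)) \<longlonglongrightarrow> a k"
      by (intro tendsto_eventually eventually_sequentiallyI[of "Suc k"]) auto
  qed
  with u show ?thesis using that by blast
qed

text \<open>Completeness enters through Riesz-Fischer, which supplies an element with the
  coefficients of \<open>u\<close>; by totality it can only be \<open>u\<close>.\<close>

lemma orthonormal_expansion:
  fixes e :: "nat \<Rightarrow> 'a::{real_inner, complete_space}"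
  assumes on: "\<And>j k. inner (e j) (e k) = of_bool (j = k)" and tot: "\<And>v. (\<And>k. inner v (e k) = 0) \<Longrightarrow> v = 0"
  shows "(\<lambda>n. \<Sum>k<n. inner u (e k) *\<^sub>R e k) \<longlonglongrightarrow> u"
proof -
  obtain w where w: "(\<lambda>n. \<Sum>k<n. inner u (e k) *\<^sub>R e k) \<longlonglongrightarrow> w" "\<And>k. inner w (e k) = inner u (e k)"
    using Riesz_Fischer[OF on summable_coefficients[OF on]] by blast
  have "u - w = 0" by (rule tot) (simp add: inner_diff_left w(2))
  with w(1) show ?thesis by simp
qed

lemma parseval_inner:
  fixes e :: "nat \<Rightarrow> 'a::{real_inner, complete_space}"
  assumes on: "\<And>j k. inner (e j) (e k) = of_bool (j = k)" and tot: "\<And>v. (\<And>k. inner v (e k) = 0) \<Longrightarrow> v = 0"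
  shows "(\<lambda>k. inner u (e k) * inner v (e k)) sums inner u v"
proof -
  have "(\<lambda>n. inner (\<Sum>k<n. inner u (e k) *\<^sub>R e k) v) \<longlonglongrightarrow> inner u v"
    by (intro tendsto_intros orthonormal_expansion[OF on tot])
  then show ?thesis by (simp add: sums_def inner_sum_left inner_commute[of v])
qed

lemma second_countable_if_countable_dense:
  fixes D :: "'a::metric_space set"
  assumes D: "countable D" and dense: "\<And>x e. e > 0 \<Longrightarrow> \<exists>d\<in>D. dist d x < e"
  shows "\<exists>B::'a set set. countable B \<and> open = generate_topology B"
proof (intro exI conjI)
  let ?B = "(\<lambda>(d, n::nat). ball d (1 / real (Suc n))) ` (D \<times> UNIV)"
  show "countable ?B" using D by auto
  show "open = generate_topology ?B"
  proof (intro topological_basis_imp_subbasis topological_basisI)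
    fix S :: "'a set" and x assume "open S" "x \<in> S"
    then obtain e where e: "e > 0" "ball x e \<subseteq> S" by (meson openE)
    then obtain n where n: "1 / real (Suc n) < e/2" using nat_approx_posE[of "e/2"] by auto
    obtain d where d: "d \<in> D" "dist d x < 1 / real (Suc n)" using dense[of "1 / real (Suc n)" x] by auto
    have "ball d (1 / real (Suc n)) \<subseteq> ball x e"
    proof
      fix y assume "y \<in> ball d (1 / real (Suc n))"
      then have "dist d y < e/2" "dist d x < e/2" using n d by auto
      then show "y \<in> ball x e" using dist_triangle_half_l[of x d e y] by (simp add: dist_commute)
    qed
    then show "\<exists>B'\<in>?B. x \<in> B' \<and> B' \<subseteq> S" using d e by (intro bexI[of _ "ball d (1 / real (Suc n))"]) auto
  qed auto
qed

section \<open>The sine basis\<close>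

lemma unit_integral_FTC:
  assumes F: "\<And>x. (F has_real_derivative f x) (at x)" and f: "continuous_on UNIV f"
  shows "(LINT x|unit_measure. f x) = F 1 - F 0"
proof -
  have f01: "continuous_on {0..1} f" using f by (rule continuous_on_subset) simp
  have "f absolutely_integrable_on {0..1}" by (rule absolutely_integrable_continuous_real[OF f01])
  then have "set_integrable lebesgue {0<..<1} f" by (rule set_integrable_subset) auto
  then have i: "integrable unit_measure f" by (simp add: integrable_restrict_space set_integrable_def)
  have "(f has_integral F 1 - F 0) {0..1}"
    using F by (intro fundamental_theorem_of_calculus)
      (auto simp: has_real_derivative_iff_has_vector_derivative intro: has_vector_derivative_at_within)
  then have "integral {0<..<1} f = F 1 - F 0"
    by (simp add: has_integral_Icc_iff_Ioo integral_unique)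
  with lebesgue_integral_eq_integral[OF i] show ?thesis by simp
qed

lemma unit_integral_cos:
  assumes "n \<noteq> (0::int)"
  shows "(LINT x|unit_measure. cos (of_int n * pi * x)) = 0"
proof -
  have "(LINT x|unit_measure. cos (of_int n * pi * x)) =
      sin (of_int n * pi * 1) / (of_int n * pi) - sin (of_int n * pi * 0) / (of_int n * pi)"
    by (rule unit_integral_FTC[where F = "\<lambda>x. sin (of_int n * pi * x) / (of_int n * pi)"])
      (use assms in \<open>auto intro!: derivative_eq_intros continuous_intros\<close>)
  then show ?thesis by (simp add: sin_int_times_real mult.commute)
qed

text \<open>Shifted by one, so that the index 0 belongs to the first Dirichlet mode and
  \<open>eig 0\<close> is \<open>pi\<^sup>2\<close>, the smallest eigenvalue.\<close>

definition freq :: "nat \<Rightarrow> real" where "freq k = real (Suc k) * pi"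

definition eig :: "nat \<Rightarrow> real" where "eig k = (freq k)\<^sup>2"

text \<open>The factor \<open>sqrt 2\<close> normalises in L^2(0,1). The cosines lack the constant
  function and are not a basis; they serve only as derivatives of the sines.\<close>

definition sinf :: "nat \<Rightarrow> real \<Rightarrow> real" where "sinf k x = sqrt 2 * sin (freq k * x)"

definition cosf :: "nat \<Rightarrow> real \<Rightarrow> real" where "cosf k x = sqrt 2 * cos (freq k * x)"

definition sinb :: "nat \<Rightarrow> l2" where "sinb k = abs_l2 (sinf k)"

definition cosb :: "nat \<Rightarrow> l2" where "cosb k = abs_l2 (cosf k)"

lemma freq_pos: "freq k > 0"
  by (simp add: freq_def)

lemma eig_pos: "eig k > 0"
  using freq_pos[of k] by (simp add: eig_def)

lemma eig_mono: "j \<le> k \<Longrightarrow> eig j \<le> eig k"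
  unfolding eig_def freq_def by (intro power_mono mult_right_mono) auto

lemma eig_ge: "eig k \<ge> pi\<^sup>2"
  using eig_mono[of 0 k] by (simp add: eig_def freq_def)

text \<open>A crude linear bound: growth to infinity at an explicit rate is all that the choice of a
  cut-off index requires.\<close>

lemma eig_ge_Suc: "eig k \<ge> real (Suc k)"
proof -
  have "real (Suc k) * 1 \<le> (real (Suc k))\<^sup>2 * pi\<^sup>2"
    using pi_ge_two power_mono[of 1 pi 2] power_increasing[of 1 2 "real (Suc k)"] by (intro mult_mono) auto
  then show ?thesis by (simp add: eig_def freq_def power_mult_distrib)
qed

lemma continuous_sinf: "continuous_on S (sinf k)"
  unfolding sinf_def[abs_def] by (intro continuous_intros)

lemma continuous_cosf: "continuous_on S (cosf k)"
  unfolding cosf_def[abs_def] by (intro continuous_intros)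

lemma square_integrable_sinf: "square_integrable (sinf k)"
  by (intro square_integrable_continuous continuous_sinf)

lemma square_integrable_cosf: "square_integrable (cosf k)"
  by (intro square_integrable_continuous continuous_cosf)

lemma unit_integrable_cos: "integrable unit_measure (\<lambda>x. cos (c * x))"
  by (rule integrable_bounded_unit[where B = 1]) (auto intro: borel_imp_unit_measurable)

text \<open>Product-to-sum formulas. Because of the shift in \<open>freq\<close>, the sum of two
  frequencies is \<open>j + k + 2\<close> times \<open>pi\<close> and never vanishes; the difference
  may be negative, hence the integer coefficients.\<close>

lemma inner_trig:
  fixes j k :: nat
  defines "A \<equiv> (LINT x|unit_measure. cos (of_int (int j - int k) * pi * x))"
    and "B \<equiv> (LINT x|unit_measure. cos (of_int (int j + int k + 2) * pi * x))"
  shows "inner (sinb j) (sinb k) = A - B" "inner (cosb j) (cosb k) = A + B"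
proof -
  have 1: "sinf j x * sinf k x = cos (of_int (int j - int k) * pi * x) - cos (of_int (int j + int k + 2) * pi * x)"
    and 2: "cosf j x * cosf k x = cos (of_int (int j - int k) * pi * x) + cos (of_int (int j + int k + 2) * pi * x)" for x
  proof -
    have *: "of_int (int j - int k) * pi * x = freq j * x - freq k * x"
      "of_int (int j + int k + 2) * pi * x = freq j * x + freq k * x"
      by (auto simp: freq_def algebra_simps)
    have s2: "sqrt 2 * a * (sqrt 2 * b) = 2 * (a * b)" for a b :: real
      using real_sqrt_mult_self[of 2] by (simp add: mult.left_commute mult.assoc[symmetric])
    show "sinf j x * sinf k x = cos (of_int (int j - int k) * pi * x) - cos (of_int (int j + int k + 2) * pi * x)"
      unfolding sinf_def s2 * cos_diff cos_add by simp
    show "cosf j x * cosf k x = cos (of_int (int j - int k) * pi * x) + cos (of_int (int j + int k + 2) * pi * x)"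
      unfolding cosf_def s2 * cos_diff cos_add by simp
  qed
  note i = unit_integrable_cos[of "of_int n * pi" for n]
  show "inner (sinb j) (sinb k) = A - B"
    unfolding sinb_def inner_abs[OF square_integrable_sinf square_integrable_sinf] 1 A_def B_def
    by (rule Bochner_Integration.integral_diff) (rule i)+
  show "inner (cosb j) (cosb k) = A + B"
    unfolding cosb_def inner_abs[OF square_integrable_cosf square_integrable_cosf] 2 A_def B_def
    by (rule Bochner_Integration.integral_add) (rule i)+
qed

lemma measure_unit: "measure unit_measure (space unit_measure) = 1"
  by (simp add: measure_restrict_space)

lemma
  shows sinb_orthonormal: "inner (sinb j) (sinb k) = of_bool (j = k)"
    and cosb_orthonormal: "inner (cosb j) (cosb k) = of_bool (j = k)"
proof -
  have B: "(LINT x|unit_measure. cos (of_int (int j + int k + 2) * pi * x)) = 0"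
    by (rule unit_integral_cos) linarith
  have A: "(LINT x|unit_measure. cos (of_int (int j - int k) * pi * x)) = of_bool (j = k)"
  proof (cases "j = k")
    case True then show ?thesis using measure_unit by simp
  next
    case False then show ?thesis using unit_integral_cos[of "int j - int k"] by simp
  qed
  show "inner (sinb j) (sinb k) = of_bool (j = k)" "inner (cosb j) (cosb k) = of_bool (j = k)"
    unfolding inner_trig A B by simp_all
qed

lemma abs_integrable_continuous_mult:
  fixes U f :: "real \<Rightarrow> real"
  assumes U: "integrable unit_measure U" and f: "continuous_on {0..1} f"
  shows "integrable unit_measure (\<lambda>x. U x * f x)"
proof -
  have "compact (f ` {0..1})" using f by (intro compact_continuous_image) auto
  then obtain B where B: "\<And>x. x \<in> {0..1} \<Longrightarrow> \<bar>f x\<bar> \<le> B"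
    using compact_imp_bounded bounded_iff by (metis imageI real_norm_def)
  have "f \<in> borel_measurable unit_measure"
    using square_integrable_continuous[OF f] by (simp add: square_integrable_def)
  moreover have "AE x in unit_measure. norm (U x * f x) \<le> norm (B * U x)"
  proof (rule AE_I2)
    fix x assume "x \<in> space unit_measure"
    then have "\<bar>f x\<bar> \<le> \<bar>B\<bar>" using B[of x] by auto
    then show "norm (U x * f x) \<le> norm (B * U x)"
      by (simp add: abs_mult mult.commute[of "\<bar>B\<bar>"] mult_left_mono)
  qed
  moreover have "integrable unit_measure (\<lambda>x. B * U x)" using U by simp
  ultimately show ?thesis
    using Bochner_Integration.integrable_bound[of unit_measure "\<lambda>x. B * U x" "\<lambda>x. U x * f x"] U by auto
qed

text \<open>The ideal test function is \<open>W\<close> clipped to [-1, 1]: its product with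
  \<open>W\<close> is nonnegative and vanishes exactly where \<open>W\<close> does. It is an almost
  everywhere limit of continuous functions, and clipping these as well keeps the products dominated
  by the absolute value of \<open>W\<close>.\<close>

lemma integral_orthogonal_continuous_zero:
  fixes W :: "real \<Rightarrow> real"
  assumes W: "integrable unit_measure W"
    and orth: "\<And>f :: real \<Rightarrow> real. continuous_on {0..1} f \<Longrightarrow> (LINT x|unit_measure. W x * f x) = 0"
  shows "AE x in unit_measure. W x = 0"
proof -
  define c where "c x = max (-1) (min 1 (W x))" for x
  have Wm: "W \<in> borel_measurable unit_measure" using W by auto
  then have cm: "c \<in> borel_measurable unit_measure" unfolding c_def by measurable
  then have "(\<lambda>x. if x \<in> {0<..<1} then c x else 0) \<in> borel_measurable lebesgue"
    by (subst borel_measurable_if) auto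
  then have "(\<lambda>x. if x \<in> {0<..<1} then c x else 0) measurable_on UNIV"
    by (rule lebesgue_measurable_imp_measurable_on_real) auto
  then obtain N g where N: "negligible N" and g: "\<And>n. continuous_on UNIV (g n)"
    and lim: "\<And>x. x \<notin> N \<Longrightarrow> (\<lambda>n. g n x) \<longlonglongrightarrow> (if x \<in> {0<..<1} then c x else 0)"
    unfolding measurable_on_def by auto
  define h where "h n x = max (-1) (min 1 (g n x))" for n :: nat and x :: real
  have h: "continuous_on {0..1} (h n)" for n
    unfolding h_def by (intro continuous_intros continuous_on_subset[OF g]) auto
  have hm: "h n \<in> borel_measurable unit_measure" for n
    using square_integrable_continuous[OF h] by (simp add: square_integrable_def)
  have "AE x in lebesgue. x \<notin> N" using N by (simp add: negligible_iff_null_sets AE_not_in)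
  then have "AE x in unit_measure. x \<notin> N" by (subst AE_restrict_space_iff) auto
  then have hl: "AE x in unit_measure. (\<lambda>n. W x * h n x) \<longlonglongrightarrow> W x * c x"
  proof (rule AE_mp[OF _ AE_I2], intro impI)
    fix x assume "x \<in> space unit_measure" "x \<notin> N"
    then have "(\<lambda>n. g n x) \<longlonglongrightarrow> c x" using lim[of x] by simp
    then have "(\<lambda>n. W x * h n x) \<longlonglongrightarrow> W x * max (-1) (min 1 (c x))"
      unfolding h_def by (intro tendsto_intros)
    then show "(\<lambda>n. W x * h n x) \<longlonglongrightarrow> W x * c x" by (simp add: c_def)
  qed
  have "(\<lambda>n. LINT x|unit_measure. W x * h n x) \<longlonglongrightarrow> (LINT x|unit_measure. W x * c x)"
  proof (rule integral_dominated_convergence[where w = "\<lambda>x. \<bar>W x\<bar>"])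
    show "AE x in unit_measure. norm (W x * h n x) \<le> \<bar>W x\<bar>" for n
    proof (rule AE_I2)
      fix x
      have "\<bar>h n x\<bar> \<le> 1" by (auto simp: h_def)
      then show "norm (W x * h n x) \<le> \<bar>W x\<bar>" by (simp add: abs_mult mult_left_le)
    qed
  qed (use hl W Wm cm hm in auto)
  then have z: "(LINT x|unit_measure. W x * c x) = 0" using orth[OF h] by (simp add: LIMSEQ_const_iff)
  have nn: "0 \<le> W x * c x" and iff: "W x * c x = 0 \<longleftrightarrow> W x = 0" for x
    by (auto simp: c_def max_def min_def zero_le_mult_iff)
  have "integrable unit_measure (\<lambda>x. W x * c x)"
    by (rule Bochner_Integration.integrable_bound[OF W]) (use Wm cm in \<open>auto simp: abs_mult mult_left_le c_def intro!: mult_left_le\<close>)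
  then show ?thesis
    using z integral_nonneg_eq_0_iff_AE[of unit_measure "\<lambda>x. W x * c x"] nn iff by auto
qed

text \<open>If \<open>u\<close> is orthogonal to all \<open>sin (k \<pi> x)\<close>, then \<open>u sin (\<pi> x)\<close> is orthogonal to all polynomials in
  \<open>cos (\<pi> x)\<close>, which are dense in the continuous functions on \<open>[0,1]\<close>.\<close>

lemma sin_total:
  assumes u: "\<And>k. inner u (sinb k) = 0"
  shows "u = 0"
proof -
  define U where "U = rep_l2 u"
  have sU: "square_integrable U" by (simp add: U_def square_integrable_rep)
  have one: "square_integrable (\<lambda>_. 1)" by (rule square_integrable_continuous) auto
  have iU: "integrable unit_measure U" using square_integrable_mult[OF sU one] by simp
  have base_nat: "(LINT x|unit_measure. U x * sin (real (Suc n) * pi * x)) = 0" for n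
  proof -
    have "sqrt 2 * (LINT x|unit_measure. U x * sin (real (Suc n) * pi * x)) = (LINT x|unit_measure. U x * sinf n x)"
      unfolding sinf_def freq_def by (subst integral_mult_right_zero[symmetric]) (simp add: mult_ac)
    also have "\<dots> = 0" using u[of n] unfolding sinb_def inner_rep_abs[OF square_integrable_sinf] U_def .
    finally show ?thesis by simp
  qed
  have base: "(LINT x|unit_measure. U x * sin (of_int k * pi * x)) = 0" for k :: int
  proof -
    have nat: "(LINT x|unit_measure. U x * sin (real m * pi * x)) = 0" for m
      using base_nat[of "m - 1"] by (cases m) auto
    show ?thesis
    proof (cases k rule: int_cases2)
      case (nonneg m) then show ?thesis using nat[of m] by simp
    next
      case (nonpos m) then show ?thesis using nat[of m] by simp
    qed
  qed
  \<comment> \<open>Multiplication by \<open>cos (pi * x)\<close> replaces a sine by the mean of its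
    two neighbours in frequency. The lower neighbour may have frequency zero or less, so
    \<open>k\<close> ranges over all integers and is arbitrary in the induction.\<close>
  have pow: "(LINT x|unit_measure. U x * (sin (of_int k * pi * x) * cos (pi * x) ^ n)) = 0" for k :: int and n
  proof (induction n arbitrary: k)
    case 0 then show ?case using base by simp
  next
    case (Suc n)
    have prod: "sin (of_int k * pi * x) * cos (pi * x) =
        (sin (of_int (k + 1) * pi * x) + sin (of_int (k - 1) * pi * x)) / 2" for x
    proof -
      have "of_int (k + 1) * pi * x = of_int k * pi * x + pi * x" "of_int (k - 1) * pi * x = of_int k * pi * x - pi * x"
        by (auto simp: algebra_simps)
      then show ?thesis by (simp only: sin_add sin_diff) simp
    qed
    define G where "G m x = U x * (sin (of_int m * pi * x) * cos (pi * x) ^ n)" for m :: int and x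
    have "U x * (sin (of_int k * pi * x) * cos (pi * x) ^ Suc n) = G (k + 1) x / 2 + G (k - 1) x / 2" for x
    proof -
      have "U x * (sin (of_int k * pi * x) * cos (pi * x) ^ Suc n) =
        U x * ((sin (of_int k * pi * x) * cos (pi * x)) * cos (pi * x) ^ n)" by (simp add: mult_ac)
      then show ?thesis unfolding prod G_def by (simp add: field_simps)
    qed
    moreover have "integrable unit_measure (G m)" for m
      unfolding G_def by (rule abs_integrable_continuous_mult[OF iU]) (intro continuous_intros)
    moreover have "(LINT x|unit_measure. G m x) = 0" for m using Suc.IH[of m] by (simp add: G_def)
    ultimately show ?case by simp
  qed
  define W where "W x = U x * sin (pi * x)" for x
  have iW: "integrable unit_measure W"
    unfolding W_def by (rule abs_integrable_continuous_mult[OF iU]) (intro continuous_intros)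
  have powW: "(LINT x|unit_measure. W x * cos (pi * x) ^ n) = 0" for n
    using pow[of 1 n] by (simp add: W_def mult.assoc)
  have iWc: "integrable unit_measure (\<lambda>x. W x * f x)" if "continuous_on {0..1} f" for f
    by (rule abs_integrable_continuous_mult[OF iW that])
  have orth: "(LINT x|unit_measure. W x * f x) = 0" if f: "continuous_on {0..1} f" for f
  proof -
    \<comment> \<open>The substitution \<open>y = cos (pi * x)\<close> makes polynomials in the
      cosine ordinary polynomials on [-1, 1], to which the Weierstrass theorem applies.\<close>
    define \<psi> where "\<psi> y = f (arccos y / pi)" for y
    have \<psi>: "continuous_on {-1..1} \<psi>"
      unfolding \<psi>_def
    proof (rule continuous_on_compose2[OF f])
      show "continuous_on {-1..1} (\<lambda>y. arccos y / pi)"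
        by (intro continuous_intros) auto
      show "(\<lambda>y. arccos y / pi) ` {-1..1} \<subseteq> {0..1}"
        using arccos_lbound arccos_ubound by (auto simp: divide_simps)
    qed
    define C where "C = (LINT x|unit_measure. \<bar>W x\<bar>)"
    have "\<bar>LINT x|unit_measure. W x * f x\<bar> \<le> e" if e: "e > 0" for e
    proof -
      define d where "d = e / (\<bar>C\<bar> + 1)"
      have d: "d > 0" unfolding d_def using e by (intro divide_pos_pos) auto
      obtain p where p: "real_polynomial_function p" and pd: "\<And>y. y \<in> {-1..1} \<Longrightarrow> \<bar>\<psi> y - p y\<bar> < d"
        using Stone_Weierstrass_real_polynomial_function[OF _ \<psi> d] by auto
      obtain a n where a: "p = (\<lambda>y. \<Sum>i\<le>n. a i * y ^ i)" using p real_polynomial_function_iff_sum by auto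
      have pc: "continuous_on {0..1} (\<lambda>x. p (cos (pi * x)))" unfolding a by (intro continuous_intros)
      have "(LINT x|unit_measure. W x * p (cos (pi * x))) = (LINT x|unit_measure. (\<Sum>i\<le>n. a i * (W x * cos (pi * x) ^ i)))"
        by (simp add: a sum_distrib_left mult_ac)
      also have "\<dots> = (\<Sum>i\<le>n. a i * (LINT x|unit_measure. W x * cos (pi * x) ^ i))"
        by (subst Bochner_Integration.integral_sum) (auto intro!: integrable_mult_right iWc continuous_intros)
      also have "\<dots> = 0" using powW by simp
      finally have p0: "(LINT x|unit_measure. W x * p (cos (pi * x))) = 0" .
      have "(LINT x|unit_measure. W x * f x) = (LINT x|unit_measure. W x * f x - W x * p (cos (pi * x)))"
        using p0 by (simp add: iWc[OF f] iWc[OF pc])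
      also have "\<bar>\<dots>\<bar> \<le> (LINT x|unit_measure. d * \<bar>W x\<bar>)"
      proof (rule integral_abs_bound[THEN order_trans], rule integral_mono)
        fix x assume "x \<in> space unit_measure"
        then have x: "0 < x" "x < 1" by auto
        then have "\<psi> (cos (pi * x)) = f x" unfolding \<psi>_def by (subst arccos_cos) auto
        then have "\<bar>f x - p (cos (pi * x))\<bar> \<le> d" using pd[of "cos (pi * x)"] by (auto simp: less_imp_le)
        then have "\<bar>W x\<bar> * \<bar>f x - p (cos (pi * x))\<bar> \<le> \<bar>W x\<bar> * d" by (intro mult_left_mono) auto
        then show "\<bar>W x * f x - W x * p (cos (pi * x))\<bar> \<le> d * \<bar>W x\<bar>"
          by (simp add: abs_mult[symmetric] right_diff_distrib mult.commute)
      qed (use iW iWc[OF f] iWc[OF pc] in auto)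
      also have "\<dots> = d * C" by (simp add: C_def)
      also have "\<dots> \<le> d * (\<bar>C\<bar> + 1)" using d by (intro mult_left_mono) auto
      also have "\<dots> = e" by (simp add: d_def add_nonneg_pos)
      finally show ?thesis .
    qed
    then have "\<bar>LINT x|unit_measure. W x * f x\<bar> \<le> 0 + e" if "e > 0" for e using that by simp
    then have "\<bar>LINT x|unit_measure. W x * f x\<bar> \<le> 0" by (rule field_le_epsilon)
    then show ?thesis by simp
  qed
  have "AE x in unit_measure. W x = 0" by (rule integral_orthogonal_continuous_zero[OF iW orth])
  then have "AE x in unit_measure. U x = 0"
  proof (rule AE_mp[OF _ AE_I2], intro impI)
    fix x assume "x \<in> space unit_measure" "W x = 0"
    moreover from this have "sin (pi * x) > 0" by (intro sin_gt_zero) auto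
    ultimately show "U x = 0" by (simp add: W_def)
  qed
  then have "abs_l2 U = abs_l2 (\<lambda>_. 0)"
    by (simp add: abs_l2_eq_iff[OF sU square_integrable_zero])
  then show ?thesis by (simp add: U_def abs_rep_l2 zero_l2_abs)
qed

lemmas sin_expansion = orthonormal_expansion[OF sinb_orthonormal sin_total]
lemmas sin_parseval_inner = parseval_inner[OF sinb_orthonormal sin_total]
lemmas sin_bessel = bessel_sum[OF sinb_orthonormal]

lemma sin_parseval: "(\<lambda>k. (inner u (sinb k))\<^sup>2) sums (norm u)\<^sup>2"
  using sin_parseval_inner[of u u] by (simp add: power2_eq_square[of "inner _ _"] power2_norm_eq_inner)

lemma l2_eqI:
  assumes "\<And>k. inner u (sinb k) = inner v (sinb k)"
  shows "u = v"
  using sin_total[of "u - v"] assms by (simp add: inner_diff_left)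

text \<open>Finite rational combinations of the sines are dense. Bochner integration in time and
  \<open>lebesgue_differentiation_banach\<close> ask for this class.\<close>

instance l2 :: second_countable_topology
proof (standard, rule second_countable_if_countable_dense)
  define S where "S xs = (\<Sum>k<length xs. of_rat (xs ! k) *\<^sub>R sinb k)" for xs :: "rat list"
  show "countable (range S)" by simp
  fix u :: l2 and e :: real assume e: "e > 0"
  have "\<forall>\<^sub>F n in sequentially. dist (\<Sum>k<n. inner u (sinb k) *\<^sub>R sinb k) u < e/2"
    by (rule tendstoD[OF sin_expansion half_gt_zero[OF e]])
  then obtain n where n: "dist (\<Sum>k<n. inner u (sinb k) *\<^sub>R sinb k) u < e/2"
    by (auto simp: eventually_sequentially)
  have "\<exists>q. \<bar>of_rat q - inner u (sinb k)\<bar> < e / (2 * real n + 2)" for k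
  proof -
    have "0 < e / (2 * real n + 2)" using e by simp
    then obtain q where "inner u (sinb k) < of_rat q" "of_rat q < inner u (sinb k) + e / (2 * real n + 2)"
      using of_rat_dense[of "inner u (sinb k)" "inner u (sinb k) + e / (2 * real n + 2)"] by auto
    then show ?thesis by (intro exI[of _ q]) auto
  qed
  then obtain q where q: "\<And>k. \<bar>of_rat (q k) - inner u (sinb k)\<bar> < e / (2 * real n + 2)" by metis
  have nb: "norm (sinb k) = 1" for k using sinb_orthonormal[of k k] by (simp add: norm_eq_sqrt_inner)
  have "dist (S (map q [0..<n])) (\<Sum>k<n. inner u (sinb k) *\<^sub>R sinb k) =
      norm (\<Sum>k<n. (of_rat (q k) - inner u (sinb k)) *\<^sub>R sinb k)"
    by (simp add: S_def dist_norm sum_subtractf[symmetric] scaleR_left_diff_distrib)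
  also have "\<dots> \<le> (\<Sum>k<n. norm ((of_rat (q k) - inner u (sinb k)) *\<^sub>R sinb k))" by (rule norm_sum)
  also have "\<dots> \<le> (\<Sum>k<n. e / (2 * real n + 2))"
    using q by (intro sum_mono) (simp add: nb less_imp_le)
  also have "\<dots> < e/2" using e by (simp add: field_simps)
  finally have "dist (S (map q [0..<n])) u < e"
    using n dist_triangle[of "S (map q [0..<n])" u "\<Sum>k<n. inner u (sinb k) *\<^sub>R sinb k"] by linarith
  then show "\<exists>d\<in>range S. dist d u < e" by blast
qed

section \<open>Test functions and the Dirichlet Laplacian\<close>

definition smooth :: "(real \<Rightarrow> real) \<Rightarrow> bool" where
  "smooth f \<longleftrightarrow> (\<forall>n x. (deriv ^^ n) f field_differentiable at x)"

lemma smooth_coinduct: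
  assumes "f \<in> C" and C: "\<And>g. g \<in> C \<Longrightarrow> \<exists>g'\<in>C. \<forall>x. (g has_real_derivative g' x) (at x)"
  shows "smooth f"
proof -
  have deriv: "deriv g \<in> C" "g field_differentiable at x" if gC: "g \<in> C" for g x
  proof -
    obtain g' where g': "g' \<in> C" "\<And>x. (g has_real_derivative g' x) (at x)" using C[OF gC] by blast
    then have "deriv g = g'" by (auto intro: DERIV_imp_deriv)
    with g' show "deriv g \<in> C" "g field_differentiable at x" by (auto simp: field_differentiable_def)
  qed
  have "(deriv ^^ n) f \<in> C" for n by (induction n) (use assms(1) deriv in auto)
  then show ?thesis using deriv by (auto simp: smooth_def)
qed

lemma smooth_DERIV:
  assumes "smooth f"
  shows "((deriv ^^ n) f has_real_derivative (deriv ^^ Suc n) f x) (at x)"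
  using assms by (simp add: smooth_def DERIV_deriv_iff_field_differentiable)

lemma smooth_DERIV0:
  assumes "smooth f"
  shows "(f has_real_derivative deriv f x) (at x)"
  using smooth_DERIV[OF assms, of 0] by simp

lemma smooth_lincomb:
  assumes f: "smooth f" and g: "smooth g"
  shows "smooth (\<lambda>x. a * f x + b * g x)"
proof (rule smooth_coinduct[where C = "range (\<lambda>n x. a * (deriv ^^ n) f x + b * (deriv ^^ n) g x)"])
  show "(\<lambda>x. a * f x + b * g x) \<in> range (\<lambda>n x. a * (deriv ^^ n) f x + b * (deriv ^^ n) g x)"
    by (intro range_eqI[of _ _ 0]) simp
  fix h assume "h \<in> range (\<lambda>n x. a * (deriv ^^ n) f x + b * (deriv ^^ n) g x)"
  then obtain n where h: "h = (\<lambda>x. a * (deriv ^^ n) f x + b * (deriv ^^ n) g x)" by auto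
  have d: "(h has_real_derivative a * (deriv ^^ Suc n) f x + b * (deriv ^^ Suc n) g x) (at x)" for x
    unfolding h by (intro DERIV_add DERIV_cmult smooth_DERIV f g)
  have m: "(\<lambda>x. a * (deriv ^^ Suc n) f x + b * (deriv ^^ Suc n) g x) \<in> range (\<lambda>n x. a * (deriv ^^ n) f x + b * (deriv ^^ n) g x)"
    by (rule range_eqI[of _ _ "Suc n"]) (rule refl)
  show "\<exists>h'\<in>range (\<lambda>n x. a * (deriv ^^ n) f x + b * (deriv ^^ n) g x). \<forall>x. (h has_real_derivative h' x) (at x)"
    by (intro bexI[OF _ m] allI d)
qed

text \<open>The smallest family that contains the product and admits the Leibniz rule; the binomial
  coefficients never have to be written down.\<close>

inductive_set deriv_products :: "(real \<Rightarrow> real) \<Rightarrow> (real \<Rightarrow> real) \<Rightarrow> (real \<Rightarrow> real) set"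
  for f g where
    product: "(\<lambda>x. (deriv ^^ m) f x * (deriv ^^ n) g x) \<in> deriv_products f g"
  | add: "u \<in> deriv_products f g \<Longrightarrow> v \<in> deriv_products f g \<Longrightarrow> (\<lambda>x. u x + v x) \<in> deriv_products f g"

lemma smooth_mult:
  assumes f: "smooth f" and g: "smooth g"
  shows "smooth (\<lambda>x. f x * g x)"
proof (rule smooth_coinduct)
  show "(\<lambda>x. f x * g x) \<in> deriv_products f g"
    using deriv_products.product[of 0 f 0 g] by simp
  show "\<exists>h'\<in>deriv_products f g. \<forall>x. (h has_real_derivative h' x) (at x)" if "h \<in> deriv_products f g" for h
    using that
  proof induction
    case (product m n)
    have d: "((\<lambda>x. (deriv ^^ m) f x * (deriv ^^ n) g x) has_real_derivative
        (deriv ^^ Suc m) f x * (deriv ^^ n) g x + (deriv ^^ m) f x * (deriv ^^ Suc n) g x) (at x)" for x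
      using DERIV_mult[OF smooth_DERIV[OF f, of m x] smooth_DERIV[OF g, of n x]]
      by (simp add: mult.commute add.commute)
    show ?case
      by (intro bexI[OF _ deriv_products.add[OF deriv_products.product[where m = "Suc m" and n = n]
        deriv_products.product[where m = m and n = "Suc n"]]] allI d)
  next
    case (add u v)
    then obtain u' v' where "u' \<in> deriv_products f g" "v' \<in> deriv_products f g"
      "\<And>x. (u has_real_derivative u' x) (at x)" "\<And>x. (v has_real_derivative v' x) (at x)" by metis
    then show ?case
      by (intro bexI[of _ "\<lambda>x. u' x + v' x"] allI DERIV_add deriv_products.add) auto
  qed
qed

lemma smooth_affine:
  assumes f: "smooth f"
  shows "smooth (\<lambda>x. f (m * x + c))"
proof (rule smooth_coinduct[where C = "range (\<lambda>(a, n) x. a * (deriv ^^ n) f (m * x + c))"])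
  show "(\<lambda>x. f (m * x + c)) \<in> range (\<lambda>(a, n) x. a * (deriv ^^ n) f (m * x + c))"
    by (intro range_eqI[of _ _ "(1, 0)"]) simp
  fix h assume "h \<in> range (\<lambda>(a, n) x. a * (deriv ^^ n) f (m * x + c))"
  then obtain a n where h: "h = (\<lambda>x. a * (deriv ^^ n) f (m * x + c))" by auto
  have d: "(h has_real_derivative (a * m) * (deriv ^^ Suc n) f (m * x + c)) (at x)" for x
  proof -
    have "((\<lambda>x. m * x + c) has_real_derivative m) (at x)" by (auto intro!: derivative_eq_intros)
    from DERIV_cmult[OF DERIV_chain2[OF smooth_DERIV[OF f] this], of a n]
    show ?thesis unfolding h by (simp add: mult_ac)
  qed
  have m: "(\<lambda>x. (a * m) * (deriv ^^ Suc n) f (m * x + c)) \<in> range (\<lambda>(a, n) x. a * (deriv ^^ n) f (m * x + c))"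
    by (intro range_eqI[of _ _ "(a * m, Suc n)"]) simp
  show "\<exists>h'\<in>range (\<lambda>(a, n) x. a * (deriv ^^ n) f (m * x + c)). \<forall>x. (h has_real_derivative h' x) (at x)"
    by (intro bexI[OF _ m] allI d)
qed

lemma smooth_trig: "smooth (\<lambda>x. a * sin (w * x) + b * cos (w * x))"
proof (rule smooth_coinduct[where C = "range (\<lambda>(a, b) x. a * sin (w * x) + b * cos (w * x))"])
  fix h assume "h \<in> range (\<lambda>(a, b) x. a * sin (w * x) + b * cos (w * x))"
  then obtain a b where h: "h = (\<lambda>x. a * sin (w * x) + b * cos (w * x))" by auto
  have d: "(h has_real_derivative (- b * w) * sin (w * x) + (a * w) * cos (w * x)) (at x)" for x
    unfolding h by (auto intro!: derivative_eq_intros simp: algebra_simps)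
  have m: "(\<lambda>x. (- b * w) * sin (w * x) + (a * w) * cos (w * x)) \<in> range (\<lambda>(a, b) x. a * sin (w * x) + b * cos (w * x))"
    by (intro range_eqI[of _ _ "(- b * w, a * w)"]) simp
  show "\<exists>h'\<in>range (\<lambda>(a, b) x. a * sin (w * x) + b * cos (w * x)). \<forall>x. (h has_real_derivative h' x) (at x)"
    by (intro bexI[OF _ m] allI d)
qed auto

section \<open>A smooth cutoff\<close>

lemma poly_mult_exp_tendsto_0:
  fixes p :: "real poly"
  assumes c: "c > 0"
  shows "((\<lambda>y. poly p y * exp (- c * y)) \<longlongrightarrow> 0) at_top"
proof -
  have mono: "((\<lambda>y. y ^ i * exp (- c * y)) \<longlongrightarrow> 0) at_top" for i
  proof -
    have cy: "filterlim (\<lambda>y. c * y) at_top at_top"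
      using c by (intro filterlim_tendsto_pos_mult_at_top[OF tendsto_const _ filterlim_ident]) auto
    have "((\<lambda>y. (1 / c ^ i) * ((c * y) ^ i / exp (c * y))) \<longlongrightarrow> (1 / c ^ i) * 0) at_top"
      by (intro tendsto_mult tendsto_const filterlim_compose[OF tendsto_power_div_exp_0 cy])
    moreover have "(1 / c ^ i) * ((c * y) ^ i / exp (c * y)) = y ^ i * exp (- c * y)" for y
      using c by (simp add: power_mult_distrib exp_minus field_simps)
    ultimately show ?thesis by simp
  qed
  have "((\<lambda>y. \<Sum>i\<le>degree p. coeff p i * (y ^ i * exp (- c * y))) \<longlongrightarrow> (\<Sum>i\<le>degree p. coeff p i * 0)) at_top"
    by (intro tendsto_sum tendsto_mult tendsto_const mono)
  then show ?thesis by (simp add: poly_altdef sum_distrib_right mult.assoc)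
qed

text \<open>The classical function that vanishes to infinite order at 0. As \<open>c\<close>
  decreases to 0 it tends to the indicator of the positive half-line.\<close>

definition flat :: "real \<Rightarrow> real \<Rightarrow> real" where
  "flat c x = (if x > 0 then exp (- c / x) else 0)"

lemma smooth_flat:
  assumes c: "c > 0"
  shows "smooth (flat c)"
proof -
  define P where "P p x = (if x > 0 then poly p (1 / x) * exp (- c / x) else 0)" for p :: "real poly" and x
  \<comment> \<open>In the variable \<open>y = 1 / x\<close> differentiation is
    \<open>- y\<^sup>2\<close> times the derivative in \<open>y\<close>; applied to
    \<open>poly p y * exp (- c * y)\<close> it multiplies the exponential by exactly this
    polynomial. The family \<open>range P\<close> is thus closed under derivatives.\<close>
  define D where "D p = [:0, 0, 1:] * (smult c p - pderiv p)" for p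
  have deriv: "(P p has_real_derivative P (D p) x) (at x)" for p x
  proof -
    consider "x > 0" | "x < 0" | "x = 0" by linarith
    then show ?thesis
    proof cases
      case 1
      have "((\<lambda>x. poly p (1 / x) * exp (- c / x)) has_real_derivative
          (- 1 / x\<^sup>2 * poly (pderiv p) (1 / x)) * exp (- c / x) + exp (- c / x) * (c / x\<^sup>2) * poly p (1 / x)) (at x)"
      proof (rule DERIV_mult)
        have "((\<lambda>x. 1 / x) has_real_derivative - 1 / x\<^sup>2) (at x)"
          using 1 by (auto intro!: derivative_eq_intros simp: power2_eq_square)
        from DERIV_chain2[OF poly_DERIV this]
        show "((\<lambda>x. poly p (1 / x)) has_real_derivative - 1 / x\<^sup>2 * poly (pderiv p) (1 / x)) (at x)"
          by (simp add: mult.commute)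
        show "((\<lambda>x. exp (- c / x)) has_real_derivative exp (- c / x) * (c / x\<^sup>2)) (at x)"
          using 1 by (auto intro!: derivative_eq_intros simp: power2_eq_square)
      qed
      moreover have "(- 1 / x\<^sup>2 * poly (pderiv p) (1 / x)) * exp (- c / x) + exp (- c / x) * (c / x\<^sup>2) * poly p (1 / x) = P (D p) x"
        using 1 by (simp add: P_def D_def power2_eq_square field_simps)
      ultimately have "((\<lambda>x. poly p (1 / x) * exp (- c / x)) has_real_derivative P (D p) x) (at x)" by simp
      then show ?thesis
        by (rule has_field_derivative_transform_within_open[of _ _ _ "{0<..}"]) (use 1 in \<open>auto simp: P_def\<close>)
    next
      case 2
      have "((\<lambda>x. 0) has_real_derivative P (D p) x) (at x)" using 2 by (simp add: P_def)
      then show ?thesis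
        by (rule has_field_derivative_transform_within_open[of _ _ _ "{..<0}"]) (use 2 in \<open>auto simp: P_def\<close>)
    next
      case 3
      \<comment> \<open>The extra factor \<open>[:0, 1:]\<close>, evaluated at \<open>1 / h\<close>,
        is the division by \<open>h\<close> in the difference quotient at 0.\<close>
      have "((\<lambda>y. poly ([:0, 1:] * p) y * exp (- c * y)) \<longlongrightarrow> 0) at_top" by (rule poly_mult_exp_tendsto_0[OF c])
      then have "((\<lambda>h. poly ([:0, 1:] * p) (inverse h) * exp (- c * inverse h)) \<longlongrightarrow> 0) (at_right 0)"
        by (rule filterlim_compose[OF _ filterlim_inverse_at_top_right])
      then have "((\<lambda>h. (P p (0 + h) - P p 0) / h) \<longlongrightarrow> 0) (at_right 0)"
        by (rule Lim_transform_eventually)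
          (auto simp: eventually_at_filter P_def divide_inverse mult_ac intro!: always_eventually)
      moreover have "((\<lambda>h. (P p (0 + h) - P p 0) / h) \<longlongrightarrow> 0) (at_left 0)"
        by (rule Lim_transform_eventually[OF tendsto_const])
          (auto simp: eventually_at_filter P_def intro!: always_eventually)
      ultimately have "((\<lambda>h. (P p (0 + h) - P p 0) / h) \<longlongrightarrow> 0) (at 0)"
        by (simp add: filterlim_split_at)
      then show ?thesis using 3 by (simp add: DERIV_def P_def)
    qed
  qed
  have "flat c = P 1" by (auto simp: flat_def P_def)
  show ?thesis
    by (rule smooth_coinduct[where C = "range P"]) (use deriv \<open>flat c = P 1\<close> in auto)
qed

lemma DERIV_flat:
  assumes "x > 0"
  shows "(flat c has_real_derivative c / x\<^sup>2 * flat c x) (at x)"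
proof -
  have "((\<lambda>x. exp (- c / x)) has_real_derivative c / x\<^sup>2 * exp (- c / x)) (at x)"
    using assms by (auto intro!: derivative_eq_intros simp: power2_eq_square)
  then have "(flat c has_real_derivative c / x\<^sup>2 * exp (- c / x)) (at x)"
    by (rule has_field_derivative_transform_within_open[of _ _ _ "{0<..}"]) (use assms in \<open>auto simp: flat_def\<close>)
  then show ?thesis using assms by (simp add: flat_def)
qed

lemma flat_bounds: "c > 0 \<Longrightarrow> 0 \<le> flat c x" "c > 0 \<Longrightarrow> flat c x \<le> 1"
  by (auto simp: flat_def)

text \<open>Near the boundary layer, where the cutoff is steep, the function multiplied by it is \<open>O(x)\<close>.\<close>

lemma flat_deriv_bound:
  assumes c: "c > 0" and x: "x > c"
  shows "x * (c / (x - c)\<^sup>2 * flat c (x - c)) \<le> 2"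
proof -
  define s where "s = c / (x - c)"
  have s: "s > 0" using assms by (simp add: s_def)
  have 1: "x * (c / (x - c)\<^sup>2) = s * (1 + s)"
    using x c by (simp add: s_def power2_eq_square field_simps)
  have 2: "flat c (x - c) = inverse (exp s)" using x by (simp add: flat_def s_def exp_minus)
  have "s * (1 + s) \<le> 2 * exp s"
    using exp_lower_Taylor_quadratic[of s] s by (simp add: power2_eq_square algebra_simps)
  then have "s * (1 + s) * inverse (exp s) \<le> 2" by (simp add: field_simps)
  then show ?thesis unfolding mult.assoc[symmetric] 1 2 .
qed

text \<open>The left factor vanishes for \<open>x \<le> c\<close> and the right one for
  \<open>x \<ge> 1 - c\<close>, whence compact support in (0,1). At every point of (0,1) the values
  tend to 1 as \<open>c\<close> tends to 0.\<close>

definition cutoff :: "real \<Rightarrow> real \<Rightarrow> real" where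
  "cutoff c x = flat c (x - c) * flat c (1 - c - x)"

lemma smooth_cutoff: "c > 0 \<Longrightarrow> smooth (cutoff c)"
  unfolding cutoff_def[abs_def]
  using smooth_mult[OF smooth_affine[OF smooth_flat, of c 1 "-c"] smooth_affine[OF smooth_flat, of c "-1" "1 - c"]]
  by (simp add: algebra_simps)

lemma test_function_smooth: "test_function \<phi> \<Longrightarrow> smooth \<phi>"
  by (simp add: test_function_def smooth_def)

lemma test_function_cutoff_mult:
  assumes c: "c > 0" and f: "smooth f"
  shows "test_function (\<lambda>x. cutoff c x * f x)"
  unfolding test_function_def
proof
  show "\<forall>n x. (deriv ^^ n) (\<lambda>x. cutoff c x * f x) field_differentiable at x"
    using smooth_mult[OF smooth_cutoff[OF c] f] by (simp add: smooth_def)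
  show "\<exists>K. compact K \<and> K \<subseteq> {0<..<1} \<and> (\<forall>x. x \<notin> K \<longrightarrow> cutoff c x * f x = 0)"
    using c by (intro exI[of _ "{c..1 - c}"]) (auto simp: cutoff_def flat_def)
qed

lemma continuous_on_smooth: "smooth f \<Longrightarrow> continuous_on S f"
  by (meson DERIV_isCont continuous_at_imp_continuous_on smooth_DERIV0)

lemma continuous_on_deriv_smooth: "smooth f \<Longrightarrow> continuous_on S (deriv f)"
  using smooth_DERIV[of f 1] by (auto intro!: continuous_at_imp_continuous_on DERIV_isCont)

lemma square_integrable_test:
  assumes "test_function \<phi>"
  shows "square_integrable \<phi>" "square_integrable (deriv \<phi>)"
  using assms by (auto intro!: square_integrable_continuous continuous_on_smooth continuous_on_deriv_smooth test_function_smooth)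

section \<open>Weak derivatives and the closure of the graph of differentiation\<close>

lemma has_weak_deriv_iff:
  "has_weak_deriv u g \<longleftrightarrow>
    (\<forall>\<phi>. test_function \<phi> \<longrightarrow> inner u (abs_l2 (deriv \<phi>)) = - inner g (abs_l2 \<phi>))"
  unfolding has_weak_deriv_def using inner_rep_abs square_integrable_test by auto

lemma has_weak_deriv_DERIV:
  assumes F: "\<And>x. (F has_real_derivative f x) (at x)" and f: "continuous_on UNIV f"
  shows "has_weak_deriv (abs_l2 F) (abs_l2 f)"
  unfolding has_weak_deriv_iff
proof (intro allI impI)
  fix \<phi> assume \<phi>: "test_function \<phi>"
  have cF: "continuous_on S F" for S using F by (meson DERIV_isCont continuous_at_imp_continuous_on)
  have sF: "square_integrable F" "square_integrable f"
    by (auto intro!: square_integrable_continuous cF continuous_on_subset[OF f])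
  obtain K where "K \<subseteq> {0<..<1}" "\<And>x. x \<notin> K \<Longrightarrow> \<phi> x = 0" using \<phi> by (auto simp: test_function_def)
  then have "\<phi> 0 = 0" "\<phi> 1 = 0" by (metis greaterThanLessThan_iff less_irrefl subsetD)+
  note s\<phi> = square_integrable_test[OF \<phi>] and sm = test_function_smooth[OF \<phi>]
  have "(LINT x|unit_measure. f x * \<phi> x + F x * deriv \<phi> x) = F 1 * \<phi> 1 - F 0 * \<phi> 0"
  proof (rule unit_integral_FTC)
    show "((\<lambda>x. F x * \<phi> x) has_real_derivative f x * \<phi> x + F x * deriv \<phi> x) (at x)" for x
      using DERIV_mult[OF F smooth_DERIV0[OF sm]] by (simp add: mult.commute)
    show "continuous_on UNIV (\<lambda>x. f x * \<phi> x + F x * deriv \<phi> x)"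
      by (intro continuous_intros f cF continuous_on_smooth continuous_on_deriv_smooth sm)
  qed
  also have "(LINT x|unit_measure. f x * \<phi> x + F x * deriv \<phi> x) = inner (abs_l2 f) (abs_l2 \<phi>) + inner (abs_l2 F) (abs_l2 (deriv \<phi>))"
    by (simp add: inner_abs sF s\<phi> square_integrable_mult)
  finally show "inner (abs_l2 F) (abs_l2 (deriv \<phi>)) = - inner (abs_l2 f) (abs_l2 \<phi>)"
    using \<open>\<phi> 0 = 0\<close> \<open>\<phi> 1 = 0\<close> by simp
qed

lemma has_weak_deriv_closed:
  assumes "\<And>n. has_weak_deriv (u n) (g n)" "u \<longlonglongrightarrow> u'" "g \<longlonglongrightarrow> g'"
  shows "has_weak_deriv u' g'"
  unfolding has_weak_deriv_iff
proof (intro allI impI)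
  fix \<phi> assume \<phi>: "test_function \<phi>"
  have "(\<lambda>n. inner (u n) (abs_l2 (deriv \<phi>))) \<longlonglongrightarrow> inner u' (abs_l2 (deriv \<phi>))"
    "(\<lambda>n. - inner (g n) (abs_l2 \<phi>)) \<longlonglongrightarrow> - inner g' (abs_l2 \<phi>)"
    by (intro tendsto_intros assms(2,3))+
  then show "inner u' (abs_l2 (deriv \<phi>)) = - inner g' (abs_l2 \<phi>)"
    using assms(1) \<phi> by (simp add: has_weak_deriv_iff LIMSEQ_unique)
qed

lemma has_weak_deriv_lincomb:
  assumes "\<And>k. k \<in> I \<Longrightarrow> has_weak_deriv (u k) (g k)"
  shows "has_weak_deriv (\<Sum>k\<in>I. a k *\<^sub>R u k) (\<Sum>k\<in>I. a k *\<^sub>R g k)"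
  using assms by (simp add: has_weak_deriv_iff inner_sum_left sum_negf)

text \<open>Working with pairs in the product space makes convergence in H^1 an ordinary
  convergence: the closure of this set is the graph of the weak derivative on
  \<open>H10\<close>.\<close>

definition test_graph :: "(l2 \<times> l2) set" where
  "test_graph = {(abs_l2 \<phi>, abs_l2 (deriv \<phi>)) |\<phi>. test_function \<phi>}"

text \<open>Integration by parts between \<open>H10\<close> and \<open>H1\<close>. There is no
  boundary term for test functions, and both sides are continuous in the pair, so the identity
  survives the closure.\<close>

lemma test_graph_inner:
  assumes "(u, g) \<in> closure test_graph" and vw: "has_weak_deriv v w"
  shows "inner g v = - inner u w"
proof -
  obtain x where x: "\<And>n. x n \<in> test_graph" "x \<longlonglongrightarrow> (u, g)" using assms(1) closure_sequential by blast
  have "inner (snd (x n)) v = - inner (fst (x n)) w" for n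
    using x(1)[of n] vw by (auto simp: test_graph_def has_weak_deriv_iff inner_commute)
  moreover have "(\<lambda>n. inner (snd (x n)) v) \<longlonglongrightarrow> inner g v" "(\<lambda>n. - inner (fst (x n)) w) \<longlonglongrightarrow> - inner u w"
    using tendsto_fst[OF x(2)] tendsto_snd[OF x(2)] by (auto intro!: tendsto_intros)
  ultimately show ?thesis by (simp add: LIMSEQ_unique)
qed

lemma test_graph_weak_deriv:
  assumes "(u, g) \<in> closure test_graph"
  shows "has_weak_deriv u g"
  unfolding has_weak_deriv_iff
proof (intro allI impI)
  fix \<phi> assume \<phi>: "test_function \<phi>"
  then have "has_weak_deriv (abs_l2 \<phi>) (abs_l2 (deriv \<phi>))"
    by (intro has_weak_deriv_DERIV smooth_DERIV0 continuous_on_deriv_smooth test_function_smooth)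
  from test_graph_inner[OF assms this] show "inner u (abs_l2 (deriv \<phi>)) = - inner g (abs_l2 \<phi>)"
    by simp
qed

lemma test_graph_lincomb:
  assumes "p \<in> test_graph" "q \<in> test_graph"
  shows "a *\<^sub>R p + b *\<^sub>R q \<in> test_graph"
proof -
  obtain \<phi> \<psi> where \<phi>: "test_function \<phi>" "p = (abs_l2 \<phi>, abs_l2 (deriv \<phi>))"
    and \<psi>: "test_function \<psi>" "q = (abs_l2 \<psi>, abs_l2 (deriv \<psi>))"
    using assms by (auto simp: test_graph_def)
  define \<eta> where "\<eta> x = a * \<phi> x + b * \<psi> x" for x
  note sm = test_function_smooth[OF \<phi>(1)] test_function_smooth[OF \<psi>(1)]
  obtain K where K: "compact K" "K \<subseteq> {0<..<1}" "\<And>x. x \<notin> K \<Longrightarrow> \<phi> x = 0"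
    using \<phi>(1) by (auto simp: test_function_def)
  obtain L where L: "compact L" "L \<subseteq> {0<..<1}" "\<And>x. x \<notin> L \<Longrightarrow> \<psi> x = 0"
    using \<psi>(1) by (auto simp: test_function_def)
  have "test_function \<eta>"
    unfolding test_function_def
  proof
    show "\<forall>n x. (deriv ^^ n) \<eta> field_differentiable at x"
      using smooth_lincomb[OF sm, of a b] unfolding \<eta>_def[abs_def] smooth_def .
    show "\<exists>K. compact K \<and> K \<subseteq> {0<..<1} \<and> (\<forall>x. x \<notin> K \<longrightarrow> \<eta> x = 0)"
      using K L by (intro exI[of _ "K \<union> L"]) (auto simp: \<eta>_def)
  qed
  moreover have "deriv \<eta> = (\<lambda>x. a * deriv \<phi> x + b * deriv \<psi> x)"
  proof
    fix x
    show "deriv \<eta> x = a * deriv \<phi> x + b * deriv \<psi> x"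
      unfolding \<eta>_def by (rule DERIV_imp_deriv) (intro DERIV_add DERIV_cmult smooth_DERIV0 sm)
  qed
  moreover note square_integrable_test[OF \<phi>(1)] square_integrable_test[OF \<psi>(1)]
  ultimately have "a *\<^sub>R p + b *\<^sub>R q = (abs_l2 \<eta>, abs_l2 (deriv \<eta>))"
    unfolding \<phi>(2) \<psi>(2) by (simp add: scale_abs add_abs square_integrable_scale \<eta>_def[abs_def])
  then show ?thesis using \<open>test_function \<eta>\<close> by (auto simp: test_graph_def)
qed

lemma closure_test_graph_lincomb:
  assumes "p \<in> closure test_graph" "q \<in> closure test_graph"
  shows "a *\<^sub>R p + b *\<^sub>R q \<in> closure test_graph"
proof -
  obtain x y where x: "\<And>n. x n \<in> test_graph" "x \<longlonglongrightarrow> p" and y: "\<And>n. y n \<in> test_graph" "y \<longlonglongrightarrow> q"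
    using assms closure_sequential by metis
  have "(\<lambda>n. a *\<^sub>R x n + b *\<^sub>R y n) \<longlonglongrightarrow> a *\<^sub>R p + b *\<^sub>R q" by (intro tendsto_intros x y)
  then show ?thesis unfolding closure_sequential
    by (intro exI[of _ "\<lambda>n. a *\<^sub>R x n + b *\<^sub>R y n"] conjI allI test_graph_lincomb x y)
qed

lemma L2_dominated_convergence:
  assumes G: "\<And>n. square_integrable (G n)" and g: "square_integrable g"
    and B: "\<And>n x. 0 < x \<Longrightarrow> x < 1 \<Longrightarrow> \<bar>G n x\<bar> \<le> B"
    and lim: "\<And>x. 0 < x \<Longrightarrow> x < 1 \<Longrightarrow> (\<lambda>n. G n x) \<longlonglongrightarrow> g x"
  shows "(\<lambda>n. abs_l2 (G n)) \<longlonglongrightarrow> abs_l2 g"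
proof -
  interpret finite_measure unit_measure by (rule finite_unit_measure)
  have Bg: "\<bar>g x\<bar> \<le> B" if "0 < x" "x < 1" for x
    using LIMSEQ_le_const2[OF tendsto_rabs[OF lim[OF that]]] B[OF that] by blast
  have "(\<lambda>n. LINT x|unit_measure. (G n x - g x)\<^sup>2) \<longlonglongrightarrow> (LINT x|unit_measure. 0)"
  proof (rule integral_dominated_convergence[where w = "\<lambda>_. (2 * B)\<^sup>2"])
    show "AE x in unit_measure. (\<lambda>n. (G n x - g x)\<^sup>2) \<longlonglongrightarrow> 0"
    proof (rule AE_I2)
      fix x assume "x \<in> space unit_measure"
      then have "(\<lambda>n. (G n x - g x)\<^sup>2) \<longlonglongrightarrow> (g x - g x)\<^sup>2" by (intro tendsto_intros lim) auto
      then show "(\<lambda>n. (G n x - g x)\<^sup>2) \<longlonglongrightarrow> 0" by simp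
    qed
    show "AE x in unit_measure. norm ((G n x - g x)\<^sup>2) \<le> (2 * B)\<^sup>2" for n
    proof (rule AE_I2)
      fix x assume "x \<in> space unit_measure"
      then have "\<bar>G n x\<bar> \<le> B" "\<bar>g x\<bar> \<le> B" using B[of x n] Bg[of x] by auto
      then have "\<bar>G n x - g x\<bar> \<le> 2 * B" by linarith
      then have "\<bar>G n x - g x\<bar>\<^sup>2 \<le> (2 * B)\<^sup>2" by (rule power_mono) simp
      then show "norm ((G n x - g x)\<^sup>2) \<le> (2 * B)\<^sup>2" by simp
    qed
  qed (use G g in \<open>auto simp: square_integrable_def intro!: borel_measurable_power borel_measurable_diff\<close>)
  then have "(\<lambda>n. (norm (abs_l2 (G n) - abs_l2 g))\<^sup>2) \<longlonglongrightarrow> 0"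
    by (simp add: norm_diff_abs_l2[OF G g])
  then have "(\<lambda>n. sqrt ((norm (abs_l2 (G n) - abs_l2 g))\<^sup>2)) \<longlonglongrightarrow> sqrt 0" by (rule tendsto_real_sqrt)
  then show ?thesis by (simp add: LIM_zero_iff tendsto_norm_zero_iff)
qed

text \<open>The sine is multiplied by cutoffs with a parameter tending to 0. Only the derivative is
  delicate: the slope of the cutoff is unbounded near the ends, but the sine vanishes linearly
  there, so the product stays bounded and tends to 0 pointwise. Dominated convergence does the
  rest.\<close>

lemma sinb_in_closure_test_graph: "(sinb k, freq k *\<^sub>R cosb k) \<in> closure test_graph"
proof -
  define c where "c n = 1 / (real n + 3)" for n
  have c: "c n > 0" for n by (simp add: c_def)
  have c0: "c \<longlonglongrightarrow> 0"
    using LIMSEQ_ignore_initial_segment[OF lim_1_over_n[where 'a = real], of 3] by (simp add: c_def[abs_def])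
  define \<phi> where "\<phi> n x = cutoff (c n) x * sinf k x" for n x
  have sf: "smooth (sinf k)" using smooth_trig[of "sqrt 2" "freq k" 0] by (simp add: sinf_def[abs_def])
  have t\<phi>: "test_function (\<phi> n)" for n
    unfolding \<phi>_def by (rule test_function_cutoff_mult[OF c sf])
  have fr: "freq k > 0" by (rule freq_pos)
  have flat_lim: "(\<lambda>n. flat (c n) (y n)) \<longlonglongrightarrow> 1" if "y \<longlonglongrightarrow> y0" "y0 > 0" for y y0
  proof -
    have "(\<lambda>n. exp (- c n / y n)) \<longlonglongrightarrow> exp (- 0 / y0)" using that by (intro tendsto_intros c0) auto
    then have "(\<lambda>n. exp (- c n / y n)) \<longlonglongrightarrow> 1" by simp
    moreover have "\<forall>\<^sub>F n in sequentially. exp (- c n / y n) = flat (c n) (y n)"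
      using order_tendstoD(1)[OF that] by eventually_elim (simp add: flat_def)
    ultimately show ?thesis by (rule Lim_transform_eventually)
  qed
  have xc: "(\<lambda>n. x - c n) \<longlonglongrightarrow> x" "(\<lambda>n. 1 - c n - x) \<longlonglongrightarrow> 1 - x" for x
    using tendsto_diff[OF tendsto_const c0, of x] tendsto_diff[OF tendsto_diff[OF tendsto_const c0] tendsto_const, of 1 x] by auto
  have cut_lim: "(\<lambda>n. cutoff (c n) x) \<longlonglongrightarrow> 1" if "0 < x" "x < 1" for x
    unfolding cutoff_def using tendsto_mult[OF flat_lim[OF xc(1)] flat_lim[OF xc(2)]] that by simp
  have cut_b: "0 \<le> cutoff (c n) x" "cutoff (c n) x \<le> 1" for n x
    unfolding cutoff_def using flat_bounds[OF c] by (auto intro!: mult_le_one mult_nonneg_nonneg)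
  have sin_b: "\<bar>sinf k x\<bar> \<le> sqrt 2" "\<bar>cosf k x\<bar> \<le> sqrt 2" for x
    by (auto simp: sinf_def cosf_def abs_mult mult_left_le)
  have conv1: "(\<lambda>n. abs_l2 (\<phi> n)) \<longlonglongrightarrow> sinb k"
    unfolding sinb_def
  proof (rule L2_dominated_convergence[where B = "1 * sqrt 2"])
    show "\<bar>\<phi> n x\<bar> \<le> 1 * sqrt 2" for n x
      unfolding \<phi>_def abs_mult using cut_b sin_b by (intro mult_mono) auto
    show "(\<lambda>n. \<phi> n x) \<longlonglongrightarrow> sinf k x" if "0 < x" "x < 1" for x
      unfolding \<phi>_def using tendsto_mult[OF cut_lim[OF that] tendsto_const[of "sinf k x"]] by simp
  qed (use square_integrable_test[OF t\<phi>] square_integrable_sinf in auto)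
  \<comment> \<open>The slope of the left flat factor of the cutoff; by symmetry the right factor
    contributes \<open>- E n (1 - x)\<close>.\<close>
  define E where "E n x = (if x > c n then c n / (x - c n)\<^sup>2 * flat (c n) (x - c n) else 0)" for n x
  have E0: "E n x \<ge> 0" for n x using c[of n] flat_bounds[OF c] by (auto simp: E_def intro!: mult_nonneg_nonneg divide_nonneg_nonneg)
  have Eb: "x * E n x \<le> 2" for n x using flat_deriv_bound[OF c, of n x] by (auto simp: E_def)
  have Elim: "(\<lambda>n. E n x) \<longlonglongrightarrow> 0" if "x > 0" for x
  proof -
    have "(\<lambda>n. c n / (x - c n)\<^sup>2 * flat (c n) (x - c n)) \<longlonglongrightarrow> 0 / x\<^sup>2 * 1"
      using that by (intro tendsto_intros c0 xc flat_lim[OF xc(1)]) auto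
    then have "(\<lambda>n. c n / (x - c n)\<^sup>2 * flat (c n) (x - c n)) \<longlonglongrightarrow> 0" by simp
    moreover have "\<forall>\<^sub>F n in sequentially. c n / (x - c n)\<^sup>2 * flat (c n) (x - c n) = E n x"
      using order_tendstoD(2)[OF c0 that] by eventually_elim (simp add: E_def)
    ultimately show ?thesis by (rule Lim_transform_eventually)
  qed
  have flatD: "(flat (c n) has_real_derivative E n (y + c n)) (at y)" if "y \<noteq> 0" for n y
  proof (cases "y > 0")
    case True then show ?thesis using DERIV_flat[OF True, of "c n"] by (simp add: E_def)
  next
    case False
    then have "y < 0" using that by simp
    have "((\<lambda>x. 0) has_real_derivative E n (y + c n)) (at y)" using \<open>y < 0\<close> by (simp add: E_def)
    then show ?thesis
      by (rule has_field_derivative_transform_within_open[of _ _ _ "{..<0}"]) (use \<open>y < 0\<close> in \<open>auto simp: flat_def\<close>)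
  qed
  define D where "D n x = (E n x * flat (c n) (1 - c n - x) - flat (c n) (x - c n) * E n (1 - x)) * sinf k x
      + cutoff (c n) x * (freq k * cosf k x)" for n x
  have sinD: "(sinf k has_real_derivative freq k * cosf k x) (at x)" for x
    unfolding sinf_def[abs_def] cosf_def by (auto intro!: derivative_eq_intros)
  \<comment> \<open>The two points where the formula for \<open>flat\<close> changes are left out.
    They form a null set, which the class in L^2 does not see.\<close>
  have D: "deriv (\<phi> n) x = D n x" if "x \<noteq> c n" "x \<noteq> 1 - c n" for n x
  proof (rule DERIV_imp_deriv)
    have "((\<lambda>x. x - c n) has_real_derivative 1) (at x)" by (auto intro!: derivative_eq_intros)
    from DERIV_chain2[where g = "\<lambda>x. x - c n" and f = "flat (c n)", OF flatD[of "x - c n" n] this]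
    have 1: "((\<lambda>x. flat (c n) (x - c n)) has_real_derivative E n x) (at x)" using that by simp
    have "((\<lambda>x. 1 - c n - x) has_real_derivative -1) (at x)" by (auto intro!: derivative_eq_intros)
    from DERIV_chain2[where g = "\<lambda>x. 1 - c n - x" and f = "flat (c n)", OF flatD[of "1 - c n - x" n] this]
    have 2: "((\<lambda>x. flat (c n) (1 - c n - x)) has_real_derivative - E n (1 - x)) (at x)" using that by simp
    show "(\<phi> n has_real_derivative D n x) (at x)"
      unfolding \<phi>_def cutoff_def D_def
      using DERIV_mult[OF DERIV_mult[OF 1 2] sinD] by (simp add: algebra_simps)
  qed
  have sin_x: "\<bar>sinf k x\<bar> \<le> sqrt 2 * freq k * x" if "0 < x" for x
  proof -
    have "\<bar>sin (freq k * x)\<bar> \<le> freq k * x" using abs_sin_x_le_abs_x[of "freq k * x"] fr that by simp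
    then show ?thesis by (simp add: sinf_def abs_mult mult.assoc)
  qed
  \<comment> \<open>Reflection in the midpoint of the interval carries the bound near 0 over to the
    other end.\<close>
  have sin_1x: "\<bar>sinf k x\<bar> = \<bar>sinf k (1 - x)\<bar>" for x
  proof -
    have "sin (freq k * (1 - x)) = sin (freq k) * cos (freq k * x) - cos (freq k) * sin (freq k * x)"
      by (simp add: right_diff_distrib sin_diff)
    moreover have "sin (freq k) = 0" unfolding freq_def by (rule sin_npi)
    moreover have "\<bar>cos (freq k)\<bar> = 1" unfolding freq_def cos_npi by (simp add: power_abs)
    ultimately show ?thesis by (simp add: sinf_def abs_mult)
  qed
  have Db: "\<bar>D n x\<bar> \<le> 4 * sqrt 2 * freq k + sqrt 2 * freq k" if "0 < x" "x < 1" for n x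
  proof -
    have half: "E n y * \<bar>sinf k y\<bar> \<le> 2 * sqrt 2 * freq k" if "y > 0" for y
    proof -
      have "E n y * \<bar>sinf k y\<bar> \<le> E n y * (sqrt 2 * freq k * y)"
        using sin_x[OF that] E0 by (rule mult_left_mono)
      also have "\<dots> = sqrt 2 * freq k * (y * E n y)" by simp
      also have "\<dots> \<le> sqrt 2 * freq k * 2" using Eb fr by (intro mult_left_mono) auto
      finally show ?thesis by simp
    qed
    have "\<bar>E n x * flat (c n) (1 - c n - x) - flat (c n) (x - c n) * E n (1 - x)\<bar> \<le> E n x * 1 + 1 * E n (1 - x)"
      by (rule order_trans[OF abs_triangle_ineq4])
        (use E0 flat_bounds[OF c] in \<open>auto simp: abs_mult intro!: add_mono mult_left_le mult_left_le_one_le\<close>)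
    then have "\<bar>(E n x * flat (c n) (1 - c n - x) - flat (c n) (x - c n) * E n (1 - x)) * sinf k x\<bar>
        \<le> (E n x + E n (1 - x)) * \<bar>sinf k x\<bar>"
      unfolding abs_mult by (intro mult_right_mono) auto
    also have "\<dots> = E n x * \<bar>sinf k x\<bar> + E n (1 - x) * \<bar>sinf k (1 - x)\<bar>"
      by (simp add: distrib_right sin_1x[symmetric])
    also have "\<dots> \<le> 2 * sqrt 2 * freq k + 2 * sqrt 2 * freq k" using half that by (intro add_mono) auto
    finally have 1: "\<bar>(E n x * flat (c n) (1 - c n - x) - flat (c n) (x - c n) * E n (1 - x)) * sinf k x\<bar> \<le> 4 * sqrt 2 * freq k"
      by (simp add: algebra_simps)
    have 2: "\<bar>cutoff (c n) x * (freq k * cosf k x)\<bar> \<le> 1 * (freq k * sqrt 2)"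
      unfolding abs_mult using cut_b sin_b fr by (intro mult_mono) auto
    show ?thesis
      unfolding D_def by (rule order_trans[OF abs_triangle_ineq add_mono[OF 1 order_trans[OF 2]]]) simp
  qed
  have Dlim: "(\<lambda>n. D n x) \<longlonglongrightarrow> freq k * cosf k x" if "0 < x" "x < 1" for x
  proof -
    have "(\<lambda>n. D n x) \<longlonglongrightarrow> (0 * 1 - 1 * 0) * sinf k x + 1 * (freq k * cosf k x)"
      unfolding D_def using that by (intro tendsto_intros Elim cut_lim flat_lim[OF xc(1)] flat_lim[OF xc(2)]) auto
    then show ?thesis by simp
  qed
  have aeD: "AE x in unit_measure. deriv (\<phi> n) x = D n x" for n
  proof -
    have "AE x in lborel. x \<noteq> c n" "AE x in lborel. x \<noteq> 1 - c n" by (auto intro: AE_lborel_singleton)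
    then have "AE x in lborel. deriv (\<phi> n) x = D n x" by eventually_elim (use D in auto)
    then show ?thesis unfolding AE_unit_iff by eventually_elim auto
  qed
  have Dm: "D n \<in> borel_measurable unit_measure" for n
    unfolding D_def E_def cutoff_def flat_def sinf_def cosf_def
    by (intro borel_imp_unit_measurable) measurable
  have sD: "square_integrable (D n)" for n
    by (rule square_integrable_bounded[OF Dm Db])
  have "(\<lambda>n. abs_l2 (D n)) \<longlonglongrightarrow> abs_l2 (\<lambda>x. freq k * cosf k x)"
    by (rule L2_dominated_convergence[OF sD _ Db Dlim]) (auto intro: square_integrable_scale square_integrable_cosf)
  moreover have "abs_l2 (D n) = abs_l2 (deriv (\<phi> n))" for n
    using aeD[of n] abs_l2_eq_iff[OF square_integrable_test(2)[OF t\<phi>] sD, of n n] by simp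
  ultimately have conv2: "(\<lambda>n. abs_l2 (deriv (\<phi> n))) \<longlonglongrightarrow> freq k *\<^sub>R cosb k"
    by (simp add: cosb_def scale_abs square_integrable_cosf)
  have "(\<lambda>n. (abs_l2 (\<phi> n), abs_l2 (deriv (\<phi> n)))) \<longlonglongrightarrow> (sinb k, freq k *\<^sub>R cosb k)"
    by (intro tendsto_Pair conv1 conv2)
  moreover have "(abs_l2 (\<phi> n), abs_l2 (deriv (\<phi> n))) \<in> test_graph" for n
    using t\<phi> by (auto simp: test_graph_def)
  ultimately show ?thesis unfolding closure_sequential
    by (intro exI[of _ "\<lambda>n. (abs_l2 (\<phi> n), abs_l2 (deriv (\<phi> n)))"]) auto
qed

text \<open>Test functions are only used through their closure: since they approximate the sines,
  two weak derivatives of one function have the same Fourier coefficients.\<close>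

lemma has_weak_deriv_unique:
  assumes "has_weak_deriv u g" "has_weak_deriv u h"
  shows "g = h"
proof (rule l2_eqI)
  fix k
  obtain x where x: "\<And>n. x n \<in> test_graph" "x \<longlonglongrightarrow> (sinb k, freq k *\<^sub>R cosb k)"
    using sinb_in_closure_test_graph closure_sequential by blast
  have "inner g (fst (x n)) = inner h (fst (x n))" for n
    using x(1)[of n] assms by (auto simp: test_graph_def has_weak_deriv_iff)
  moreover have "(\<lambda>n. inner g (fst (x n))) \<longlonglongrightarrow> inner g (sinb k)" "(\<lambda>n. inner h (fst (x n))) \<longlonglongrightarrow> inner h (sinb k)"
    using tendsto_fst[OF x(2)] by (auto intro!: tendsto_intros)
  ultimately show "inner g (sinb k) = inner h (sinb k)" by (simp add: LIMSEQ_unique)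
qed

lemma weak_deriv_eqI: "has_weak_deriv u g \<Longrightarrow> weak_deriv u = g"
  unfolding weak_deriv_def by (rule the_equality) (auto intro: has_weak_deriv_unique)

lemma H1D: "u \<in> H1 \<Longrightarrow> has_weak_deriv u (weak_deriv u)"
  using weak_deriv_eqI by (auto simp: H1_def)

text \<open>The second component need not be named: a limit of points of the graph is a weak
  derivative, and by uniqueness it is the one that \<open>H10\<close> refers to.\<close>

lemma H10_iff: "u \<in> H10 \<longleftrightarrow> (\<exists>g. (u, g) \<in> closure test_graph)"
proof
  assume "u \<in> H10"
  then obtain \<phi> where \<phi>: "\<And>n. test_function (\<phi> n)" "(\<lambda>n. abs_l2 (\<phi> n)) \<longlonglongrightarrow> u"
    "(\<lambda>n. abs_l2 (deriv (\<phi> n))) \<longlonglongrightarrow> weak_deriv u"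
    by (auto simp: H10_def)
  have "(\<lambda>n. (abs_l2 (\<phi> n), abs_l2 (deriv (\<phi> n)))) \<longlonglongrightarrow> (u, weak_deriv u)"
    by (intro tendsto_Pair \<phi>)
  moreover have "(abs_l2 (\<phi> n), abs_l2 (deriv (\<phi> n))) \<in> test_graph" for n
    using \<phi>(1) by (auto simp: test_graph_def)
  ultimately show "\<exists>g. (u, g) \<in> closure test_graph" unfolding closure_sequential
    by (intro exI[of _ "weak_deriv u"] exI[of _ "\<lambda>n. (abs_l2 (\<phi> n), abs_l2 (deriv (\<phi> n)))"]) auto
next
  assume "\<exists>g. (u, g) \<in> closure test_graph"
  then obtain g where g: "(u, g) \<in> closure test_graph" by blast
  then obtain x where x: "\<And>n. x n \<in> test_graph" "x \<longlonglongrightarrow> (u, g)" using closure_sequential by blast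
  have "\<exists>\<phi>. test_function \<phi> \<and> x n = (abs_l2 \<phi>, abs_l2 (deriv \<phi>))" for n
    using x(1)[of n] by (auto simp: test_graph_def)
  then obtain \<phi> where \<phi>: "\<And>n. test_function (\<phi> n)" "\<And>n. x n = (abs_l2 (\<phi> n), abs_l2 (deriv (\<phi> n)))" by metis
  have "weak_deriv u = g" "u \<in> H1"
    using test_graph_weak_deriv[OF g] by (auto simp: weak_deriv_eqI H1_def)
  then show "u \<in> H10"
    using tendsto_fst[OF x(2)] tendsto_snd[OF x(2)] \<phi> by (auto simp: H10_def)
qed

section \<open>The Dirichlet Laplacian as multiplication by the eigenvalues\<close>

lemma has_weak_deriv_cosb: "has_weak_deriv (cosb k) (- freq k *\<^sub>R sinb k)"
proof -
  have "has_weak_deriv (abs_l2 (cosf k)) (abs_l2 (\<lambda>x. - freq k * sinf k x))"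
    by (rule has_weak_deriv_DERIV)
      (auto simp: cosf_def[abs_def] sinf_def intro!: derivative_eq_intros continuous_intros)
  then show ?thesis by (simp only: cosb_def sinb_def scale_abs[OF square_integrable_sinf])
qed

text \<open>Two integrations by parts. The first has no boundary term because the sine vanishes at
  the ends, the second because \<open>u\<close> does; the cosine in between does not vanish
  there.\<close>

lemma dom_A_coefficients:
  assumes "u \<in> dom_A"
  shows "inner (op_A u) (sinb k) = eig k * inner u (sinb k)"
proof -
  define g where "g = weak_deriv u"
  define h where "h = weak_deriv g"
  have ug: "(u, g) \<in> closure test_graph"
  proof -
    obtain g' where g': "(u, g') \<in> closure test_graph" using assms by (auto simp: dom_A_def H10_iff)
    then show ?thesis using weak_deriv_eqI[OF test_graph_weak_deriv[OF g']] by (simp add: g_def)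
  qed
  have gh: "has_weak_deriv g h" using assms by (auto simp: dom_A_def H2_def g_def h_def intro: H1D)
  have 1: "inner (freq k *\<^sub>R cosb k) g = - inner (sinb k) h"
    by (rule test_graph_inner[OF sinb_in_closure_test_graph gh])
  have 2: "inner g (cosb k) = - inner u (- freq k *\<^sub>R sinb k)"
    by (rule test_graph_inner[OF ug has_weak_deriv_cosb])
  have "inner h (sinb k) = - freq k * inner g (cosb k)" using 1 by (simp add: inner_commute)
  also have "\<dots> = - eig k * inner u (sinb k)" unfolding 2 by (simp add: eig_def power2_eq_square)
  finally show ?thesis by (simp add: op_A_def g_def h_def)
qed

text \<open>The sine series may be differentiated twice term by term: the hypothesis makes both
  derived series converge in L^2, the partial sums lie in the closure of the test graph, and weak
  differentiation is closed.\<close>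

lemma dom_A_I:
  assumes sm: "summable (\<lambda>k. (eig k * inner u (sinb k))\<^sup>2)"
  shows "u \<in> dom_A"
proof -
  define a where "a k = inner u (sinb k)" for k
  have "(freq k)\<^sup>2 \<le> (eig k)\<^sup>2" for k
  proof -
    have "eig k \<ge> 1" using eig_ge_Suc[of k] by simp
    then have "eig k * 1 \<le> eig k * eig k" by (intro mult_left_mono) auto
    then show ?thesis by (simp add: eig_def[symmetric] power2_eq_square[of "eig k"])
  qed
  then have le: "(freq k * a k)\<^sup>2 \<le> (eig k * a k)\<^sup>2" for k
    by (simp add: power_mult_distrib mult_right_mono)
  have sm1: "summable (\<lambda>k. (freq k * a k)\<^sup>2)"
    by (rule summable_comparison_test'[OF sm[folded a_def]]) (use le in auto)
  obtain p where p: "(\<lambda>n. \<Sum>k<n. (freq k * a k) *\<^sub>R cosb k) \<longlonglongrightarrow> p"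
    by (rule Riesz_Fischer[OF cosb_orthonormal sm1]) (rule that)
  have sm2: "summable (\<lambda>k. (- eig k * a k)\<^sup>2)" using sm by (simp add: a_def power_mult_distrib)
  obtain q where q: "(\<lambda>n. \<Sum>k<n. (- eig k * a k) *\<^sub>R sinb k) \<longlonglongrightarrow> q"
    by (rule Riesz_Fischer[OF sinb_orthonormal sm2]) (rule that)
  have u: "(\<lambda>n. \<Sum>k<n. a k *\<^sub>R sinb k) \<longlonglongrightarrow> u" unfolding a_def by (rule sin_expansion)
  have part: "(\<Sum>k<n. a k *\<^sub>R sinb k, \<Sum>k<n. (freq k * a k) *\<^sub>R cosb k) \<in> closure test_graph" for n
  proof (induction n)
    case 0
    have "test_function (\<lambda>_. 0)"
      using test_function_cutoff_mult[OF _ smooth_trig[of 0 0 0], of 1] by simp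
    then have "(abs_l2 (\<lambda>_. 0), abs_l2 (deriv (\<lambda>_. 0))) \<in> test_graph" by (auto simp: test_graph_def)
    then have "(0, 0) \<in> test_graph" by (simp add: zero_l2_abs)
    then show ?case using closure_subset by auto
  next
    case (Suc n)
    from closure_test_graph_lincomb[OF Suc sinb_in_closure_test_graph, of 1 "a n" n]
    show ?case by (simp add: mult.commute)
  qed
  have "closed (closure test_graph)" by simp
  then have up: "(u, p) \<in> closure test_graph"
    by (rule closed_sequentially[rule_format, OF _ _ tendsto_Pair[OF u p]]) (use part in auto)
  have "has_weak_deriv (\<Sum>k<n. (freq k * a k) *\<^sub>R cosb k) (\<Sum>k<n. (freq k * a k) *\<^sub>R (- freq k *\<^sub>R sinb k))" for n
    by (rule has_weak_deriv_lincomb) (rule has_weak_deriv_cosb)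
  moreover have "(\<Sum>k<n. (freq k * a k) *\<^sub>R (- freq k *\<^sub>R sinb k)) = (\<Sum>k<n. (- eig k * a k) *\<^sub>R sinb k)" for n
    by (rule sum.cong) (simp_all add: eig_def power2_eq_square)
  ultimately have "has_weak_deriv (\<Sum>k<n. (freq k * a k) *\<^sub>R cosb k) (\<Sum>k<n. (- eig k * a k) *\<^sub>R sinb k)" for n
    by metis
  then have pq: "has_weak_deriv p q" by (rule has_weak_deriv_closed[OF _ p q])
  have wu: "weak_deriv u = p" by (rule weak_deriv_eqI[OF test_graph_weak_deriv[OF up]])
  show ?thesis
    using up pq test_graph_weak_deriv[OF up] wu by (auto simp: dom_A_def H2_def H1_def H10_iff)
qed

text \<open>The Poincare inequality with its sharp constant, read off from Parseval because no
  eigenvalue is below \<open>pi\<^sup>2\<close>.\<close>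

lemma op_A_ge:
  assumes "u \<in> dom_A"
  shows "pi\<^sup>2 * (norm u)\<^sup>2 \<le> inner (op_A u) u"
proof (rule sums_le)
  show "(\<lambda>k. pi\<^sup>2 * (inner u (sinb k))\<^sup>2) sums (pi\<^sup>2 * (norm u)\<^sup>2)"
    by (intro sums_mult sin_parseval)
  show "(\<lambda>k. inner (op_A u) (sinb k) * inner u (sinb k)) sums inner (op_A u) u"
    by (rule sin_parseval_inner)
  show "pi\<^sup>2 * (inner u (sinb k))\<^sup>2 \<le> inner (op_A u) (sinb k) * inner u (sinb k)" for k
    using mult_right_mono[OF eig_ge[of k], of "(inner u (sinb k))\<^sup>2"]
    by (simp add: dom_A_coefficients[OF assms] power2_eq_square[of "inner _ _"] mult.assoc)
qed

section \<open>Strong solutions in Fourier modes\<close>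

abbreviation coef :: "l2 \<Rightarrow> nat \<Rightarrow> real" where "coef u k \<equiv> inner u (sinb k)"

lemma norm_sinb: "norm (sinb k) = 1"
  using sinb_orthonormal[of k k] by (simp add: norm_eq_sqrt_inner)

lemma abs_coef_le: "\<bar>coef u k\<bar> \<le> norm u"
  using Cauchy_Schwarz_ineq2[of u "sinb k"] by (simp add: norm_sinb)

text \<open>The equation in integrated form, one scalar identity per mode, with no mention of
  derivatives or of \<open>dom_A\<close>, so that it passes to limits. Only times after
  \<open>\<tau>\<close> occur, since a strong solution is absolutely continuous only away from its
  initial time. The bound on \<open>f\<close> is required at every time, which a change on a null
  set can always achieve.\<close>

definition mild_solution ::
  "(real \<Rightarrow> real) \<Rightarrow> (real \<Rightarrow> real) \<Rightarrow> real \<Rightarrow> (real \<Rightarrow> l2) \<Rightarrow> (real \<Rightarrow> l2) \<Rightarrow> bool" where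
  "mild_solution b \<omega> \<tau> u f \<longleftrightarrow>
     (\<forall>t. norm (f t) \<le> 1) \<and>
     (\<forall>k s t. \<tau> < s \<longrightarrow> s \<le> t \<longrightarrow>
        ((\<lambda>r. b r * coef (f r) k + \<omega> r * coef (u r) k - eig k * coef (u r) k)
           has_integral coef (u t) k - coef (u s) k) {s..t})"

text \<open>Borel representatives instead of Lebesgue measurable ones: their sections are measurable for every
  \<open>t\<close>, and they can be translated in time.\<close>

definition heaviside_pair ::
  "real \<Rightarrow> (real \<Rightarrow> l2) \<Rightarrow> (real \<Rightarrow> l2) \<Rightarrow> (real \<times> real \<Rightarrow> real) \<Rightarrow> (real \<times> real \<Rightarrow> real) \<Rightarrow> bool" where
  "heaviside_pair \<tau> u f F V \<longleftrightarrow>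
     F \<in> borel_measurable borel \<and> V \<in> borel_measurable borel \<and> (\<forall>p. \<bar>F p\<bar> \<le> 1) \<and>
     (AE t in lborel. \<tau> < t \<longrightarrow>
        (AE x in lborel. 0 < x \<and> x < 1 \<longrightarrow> F (t, x) \<in> heaviside (V (t, x))) \<and>
        abs_l2 (\<lambda>x. F (t, x)) = f t \<and>
        square_integrable (\<lambda>x. V (t, x)) \<and> abs_l2 (\<lambda>x. V (t, x)) = u t)"

section \<open>Null sets and Borel representatives on the space-time strip\<close>

lemma strip_sets: "{\<tau><..} \<times> {0<..<1::real} \<in> sets lebesgue" for \<tau> :: real
  by (intro sets_completionI_sets) (simp add: open_Times borel_open)

lemma AE_strip_iff:
  fixes P :: "real \<times> real \<Rightarrow> bool"
  shows "(AE p in lebesgue_on ({\<tau><..} \<times> {0<..<1}). P p) \<longleftrightarrow>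
    (AE p in lborel. p \<in> {\<tau><..} \<times> {0<..<1} \<longrightarrow> P p)"
  using strip_sets[of \<tau>] by (subst AE_restrict_space_iff) (auto simp: AE_completion_iff)

lemma AE_strip_sections:
  fixes P :: "real \<times> real \<Rightarrow> bool"
  assumes "AE p in lebesgue_on ({\<tau><..} \<times> {0<..<1}). P p"
  shows "AE t in lborel. \<tau> < t \<longrightarrow> (AE x in lborel. 0 < x \<and> x < 1 \<longrightarrow> P (t, x))"
proof -
  have "AE p in lborel \<Otimes>\<^sub>M lborel. p \<in> {\<tau><..} \<times> {0<..<1} \<longrightarrow> P p"
    using assms unfolding AE_strip_iff by (simp only: lborel_prod)
  then have "AE t in lborel. AE x in lborel. (t, x) \<in> {\<tau><..} \<times> {0<..<1} \<longrightarrow> P (t, x)"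
    by (rule lborel_pair.AE_pair)
  then show ?thesis by eventually_elim auto
qed

text \<open>This direction of Fubini for null sets requires a measurable predicate, which Borel
  representatives of the selection and of the solution provide.\<close>

lemma AE_sections_strip:
  fixes P :: "real \<times> real \<Rightarrow> bool"
  assumes ae: "AE t in lborel. \<tau> < t \<longrightarrow> (AE x in lborel. 0 < x \<and> x < 1 \<longrightarrow> P (t, x))"
    and P: "Measurable.pred borel P"
  shows "AE p in lebesgue_on ({\<tau><..} \<times> {0<..<1}). P p"
proof -
  have "AE p in lborel \<Otimes>\<^sub>M lborel. p \<in> {\<tau><..} \<times> {0<..<1} \<longrightarrow> P p"
  proof (rule lborel_pair.AE_pair_measure)
    have "Measurable.pred (lborel \<Otimes>\<^sub>M lborel) P" using P by (simp add: lborel_prod)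
    moreover have "Measurable.pred (lborel \<Otimes>\<^sub>M lborel) (\<lambda>p::real \<times> real. p \<in> {\<tau><..} \<times> {0<..<1})"
      unfolding mem_Times_iff by measurable
    ultimately show "{p \<in> space (lborel \<Otimes>\<^sub>M lborel). p \<in> {\<tau><..} \<times> {0<..<1} \<longrightarrow> P p} \<in> sets (lborel \<Otimes>\<^sub>M lborel)"
      by measurable
    show "AE t in lborel. AE x in lborel. (t, x) \<in> {\<tau><..} \<times> {0<..<1} \<longrightarrow> P (t, x)"
      using ae by eventually_elim auto
  qed
  then show ?thesis unfolding AE_strip_iff by (simp only: lborel_prod)
qed

lemma borel_section:
  fixes F :: "real \<times> real \<Rightarrow> real"
  assumes "F \<in> borel_measurable borel"
  shows "(\<lambda>x. F (t, x)) \<in> borel_measurable borel"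
  using assms by (intro measurable_compose[OF _ assms]) (simp flip: borel_prod)

lemma square_integrable_section:
  fixes F :: "real \<times> real \<Rightarrow> real"
  assumes "F \<in> borel_measurable borel" "\<And>p. \<bar>F p\<bar> \<le> B"
  shows "square_integrable (\<lambda>x. F (t, x))"
  by (rule square_integrable_bounded[OF borel_imp_unit_measurable[OF borel_section]]) (use assms in auto)

lemma norm_abs_l2_bounded:
  assumes f: "f \<in> borel_measurable unit_measure" and B: "\<And>x. \<bar>f x\<bar> \<le> B"
  shows "norm (abs_l2 f) \<le> B"
proof -
  interpret finite_measure unit_measure by (rule finite_unit_measure)
  have sf: "square_integrable f" by (rule square_integrable_bounded[OF f B])
  have B0: "B \<ge> 0" using B[of 0] by linarith
  have "(norm (abs_l2 f))\<^sup>2 \<le> (LINT x|unit_measure. B\<^sup>2)"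
    unfolding norm_abs_l2[OF sf]
  proof (rule integral_mono)
    show "(f x)\<^sup>2 \<le> B\<^sup>2" for x using B[of x] B0 by (metis abs_le_square_iff abs_of_nonneg)
  qed (use sf in \<open>auto simp: square_integrable_def\<close>)
  also have "\<dots> = B\<^sup>2" using measure_unit by simp
  finally show ?thesis using B0 by (rule power2_le_imp_le)
qed

lemma joint_rep_borel:
  assumes "joint_rep \<tau> g F"
  obtains F' where "F' \<in> borel_measurable borel" "AE p in lebesgue_on ({\<tau><..} \<times> {0<..<1}). F' p = F p"
proof -
  let ?Q = "{\<tau><..} \<times> {0<..<1::real}"
  have "F \<in> borel_measurable (lebesgue_on ?Q)" using assms by (simp add: joint_rep_def)
  then have "(\<lambda>p. if p \<in> ?Q then F p else 0) \<in> borel_measurable lebesgue"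
    by (subst borel_measurable_if[OF strip_sets])
  then obtain F' where F': "F' \<in> borel_measurable lborel" "AE p in lborel. (if p \<in> ?Q then F p else 0) = F' p"
    using completion_ex_borel_measurable_real by blast
  have "AE p in lborel. p \<in> ?Q \<longrightarrow> F' p = F p" using F'(2) by eventually_elim auto
  then show ?thesis using that F'(1) by (simp add: AE_strip_iff)
qed

lemma heaviside_abs_le: "y \<in> heaviside r \<Longrightarrow> \<bar>y\<bar> \<le> 1"
  by (auto simp: heaviside_def split: if_splits)

lemma AE_gt_iff: "(AE t in lebesgue_on {\<tau><..}. P t) \<longleftrightarrow> (AE t in lborel. \<tau> < t \<longrightarrow> P t)" for \<tau> :: real
  by (subst AE_restrict_space_iff) (auto simp: AE_completion_iff)

text \<open>Clipping the Borel version of \<open>F\<close> to [-1, 1] changes it only on a null set,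
  because values of the Heaviside graph lie in that interval. The function \<open>\<phi>\<close>
  leaves the caller free to normalise \<open>f\<close> at the exceptional times.\<close>

lemma heaviside_selection_pair:
  assumes sel: "heaviside_selection \<tau> u f" and \<phi>: "AE t in lborel. \<tau> < t \<longrightarrow> norm (f t) \<le> 1 \<longrightarrow> \<phi> t = f t"
  shows "\<exists>F V. heaviside_pair \<tau> u \<phi> F V"
proof -
  obtain F V where F: "joint_rep \<tau> f F" and V: "joint_rep \<tau> u V"
    and H: "AE p in lebesgue_on ({\<tau><..} \<times> {0<..<1}). F p \<in> heaviside (V p)"
    using sel by (auto simp: heaviside_selection_def)
  obtain F0 where F0: "F0 \<in> borel_measurable borel" "AE p in lebesgue_on ({\<tau><..} \<times> {0<..<1}). F0 p = F p"
    using joint_rep_borel[OF F] .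
  obtain V' where V': "V' \<in> borel_measurable borel" "AE p in lebesgue_on ({\<tau><..} \<times> {0<..<1}). V' p = V p"
    using joint_rep_borel[OF V] .
  define F' where "F' p = max (-1) (min 1 (F0 p))" for p
  have F'm: "F' \<in> borel_measurable borel" unfolding F'_def using F0(1) by measurable
  have F'b: "\<bar>F' p\<bar> \<le> 1" for p by (auto simp: F'_def)
  have "AE p in lebesgue_on ({\<tau><..} \<times> {0<..<1}). F' p = F p \<and> V' p = V p \<and> F p \<in> heaviside (V p)"
    using H F0(2) V'(2)
  proof eventually_elim
    case (elim p)
    then have "\<bar>F p\<bar> \<le> 1" by (intro heaviside_abs_le)
    with elim show ?case by (auto simp: F'_def)
  qed
  then have 1: "AE t in lborel. \<tau> < t \<longrightarrow> (AE x in lborel. 0 < x \<and> x < 1 \<longrightarrow>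
      F' (t, x) = F (t, x) \<and> V' (t, x) = V (t, x) \<and> F (t, x) \<in> heaviside (V (t, x)))"
    by (rule AE_strip_sections)
  have 2: "AE t in lborel. \<tau> < t \<longrightarrow> square_integrable (\<lambda>x. F (t, x)) \<and> abs_l2 (\<lambda>x. F (t, x)) = f t"
    using F unfolding joint_rep_def AE_gt_iff by (rule conjunct2)
  have 3: "AE t in lborel. \<tau> < t \<longrightarrow> square_integrable (\<lambda>x. V (t, x)) \<and> abs_l2 (\<lambda>x. V (t, x)) = u t"
    using V unfolding joint_rep_def AE_gt_iff by (rule conjunct2)
  have "AE t in lborel. \<tau> < t \<longrightarrow>
        (AE x in lborel. 0 < x \<and> x < 1 \<longrightarrow> F' (t, x) \<in> heaviside (V' (t, x))) \<and>
        abs_l2 (\<lambda>x. F' (t, x)) = \<phi> t \<and>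
        square_integrable (\<lambda>x. V' (t, x)) \<and> abs_l2 (\<lambda>x. V' (t, x)) = u t"
    using 1 2 3 \<phi>
  proof eventually_elim
    case (elim t)
    show ?case
    proof (intro impI)
      assume t: "\<tau> < t"
      note e = elim[rule_format, OF t]
      have aeF: "AE x in unit_measure. F' (t, x) = F (t, x)" and aeV: "AE x in unit_measure. V' (t, x) = V (t, x)"
        unfolding AE_unit_iff using e(1) by (eventually_elim, simp)+
      have sF': "square_integrable (\<lambda>x. F' (t, x))" by (rule square_integrable_section[OF F'm F'b])
      have absF: "abs_l2 (\<lambda>x. F' (t, x)) = f t"
        using abs_l2_eq_iff[OF sF'] aeF e(2) by metis
      have "norm (f t) \<le> 1"
        unfolding absF[symmetric] by (rule norm_abs_l2_bounded) (use F'b sF' in \<open>auto simp: square_integrable_def\<close>)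
      then have \<phi>t: "\<phi> t = f t" using elim(4) t by blast
      have V'm: "(\<lambda>x. V' (t, x)) \<in> borel_measurable unit_measure"
        by (rule borel_imp_unit_measurable[OF borel_section[OF V'(1)]])
      have sV: "square_integrable (\<lambda>x. V (t, x))" using e(3) by simp
      have sV': "square_integrable (\<lambda>x. V' (t, x))"
        unfolding square_integrable_def
      proof
        show "integrable unit_measure (\<lambda>x. (V' (t, x))\<^sup>2)"
          using sV V'm aeV by (subst integrable_cong_AE[of _ _ "\<lambda>x. (V (t, x))\<^sup>2"])
            (auto simp: square_integrable_def elim: eventually_mono)
      qed (rule V'm)
      have "abs_l2 (\<lambda>x. V' (t, x)) = u t"
        using abs_l2_eq_iff[OF sV' sV] aeV e(3) by simp
      moreover have "AE x in lborel. 0 < x \<and> x < 1 \<longrightarrow> F' (t, x) \<in> heaviside (V' (t, x))"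
        using e(1) by eventually_elim auto
      ultimately show "(AE x in lborel. 0 < x \<and> x < 1 \<longrightarrow> F' (t, x) \<in> heaviside (V' (t, x))) \<and>
        abs_l2 (\<lambda>x. F' (t, x)) = \<phi> t \<and>
        square_integrable (\<lambda>x. V' (t, x)) \<and> abs_l2 (\<lambda>x. V' (t, x)) = u t"
        using absF \<phi>t sV' by simp
    qed
  qed
  then show ?thesis unfolding heaviside_pair_def using F'm F'b V'(1) by blast
qed

lemma heaviside_pair_norm_le:
  assumes "heaviside_pair \<tau> u f F V"
  shows "AE t in lborel. \<tau> < t \<longrightarrow> norm (f t) \<le> 1"
proof -
  have F: "F \<in> borel_measurable borel" "\<And>p. \<bar>F p\<bar> \<le> 1"
    and ae: "AE t in lborel. \<tau> < t \<longrightarrow> abs_l2 (\<lambda>x. F (t, x)) = f t"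
    using assms by (auto simp: heaviside_pair_def elim: eventually_mono)
  have n: "norm (abs_l2 (\<lambda>x. F (t, x))) \<le> 1" for t
    by (rule norm_abs_l2_bounded[OF borel_imp_unit_measurable[OF borel_section[OF F(1)]] F(2)])
  show ?thesis using ae by eventually_elim (metis n)
qed

lemma abs_continuous_compose_lipschitz:
  fixes u :: "real \<Rightarrow> 'a::metric_space" and \<phi> :: "'a \<Rightarrow> 'b::metric_space"
  assumes u: "abs_continuous_on_interval a b u" and L: "L > 0"
    and \<phi>: "\<And>x y. x \<in> {a..b} \<Longrightarrow> y \<in> {a..b} \<Longrightarrow> dist (\<phi> (u x)) (\<phi> (u y)) \<le> L * dist (u x) (u y)"
  shows "abs_continuous_on_interval a b (\<lambda>x. \<phi> (u x))"
  unfolding abs_continuous_on_interval_def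
proof (intro allI impI)
  fix \<epsilon> :: real assume "\<epsilon> > 0"
  then have "\<epsilon> / L > 0" using L by simp
  then obtain \<delta> where \<delta>: "\<delta> > 0" and all: "\<forall>(n::nat) l r.
        (\<forall>i<n. a \<le> l i \<and> l i \<le> r i \<and> r i \<le> b) \<and>
        (\<forall>i<n. \<forall>j<n. i \<noteq> j \<longrightarrow> {l i<..<r i} \<inter> {l j<..<r j} = {}) \<and>
        (\<Sum>i<n. r i - l i) < \<delta> \<longrightarrow> (\<Sum>i<n. dist (u (l i)) (u (r i))) < \<epsilon> / L"
    using u[unfolded abs_continuous_on_interval_def] by blast
  have "(\<Sum>i<n. dist (\<phi> (u (l i))) (\<phi> (u (r i)))) < \<epsilon>"
    if *: "(\<forall>i<n. a \<le> l i \<and> l i \<le> r i \<and> r i \<le> b) \<and>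
        (\<forall>i<n. \<forall>j<n. i \<noteq> j \<longrightarrow> {l i<..<r i} \<inter> {l j<..<r j} = {}) \<and> (\<Sum>i<n. r i - l i) < \<delta>" for n :: nat and l r
  proof -
    have "(\<Sum>i<n. dist (\<phi> (u (l i))) (\<phi> (u (r i)))) \<le> (\<Sum>i<n. L * dist (u (l i)) (u (r i)))"
    proof (intro sum_mono \<phi>)
      fix i assume "i \<in> {..<n}"
      then have "a \<le> l i" "l i \<le> r i" "r i \<le> b" using * by auto
      then show "l i \<in> {a..b}" "r i \<in> {a..b}" by auto
    qed
    also have "\<dots> = L * (\<Sum>i<n. dist (u (l i)) (u (r i)))" by (simp add: sum_distrib_left)
    also have "\<dots> < L * (\<epsilon> / L)" using all[rule_format, OF *] L by (intro mult_strict_left_mono) auto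
    finally show ?thesis using L by simp
  qed
  then show "\<exists>\<delta>>0. \<forall>(n::nat) l r. (\<forall>i<n. a \<le> l i \<and> l i \<le> r i \<and> r i \<le> b) \<and>
        (\<forall>i<n. \<forall>j<n. i \<noteq> j \<longrightarrow> {l i<..<r i} \<inter> {l j<..<r j} = {}) \<and> (\<Sum>i<n. r i - l i) < \<delta> \<longrightarrow>
        (\<Sum>i<n. dist (\<phi> (u (l i))) (\<phi> (u (r i)))) < \<epsilon>"
    using \<delta> by blast
qed

lemma strong_solution_pointwise:
  assumes "strong_solution b \<omega> \<tau> x u"
  obtains f where "f \<in> L2_loc \<tau>" "heaviside_selection \<tau> u f"
    "\<And>s t. \<tau> < s \<Longrightarrow> s < t \<Longrightarrow> \<exists>N. negligible N \<and> (\<forall>r\<in>{s..t} - N. u r \<in> dom_A \<and> norm (f r) \<le> 1 \<and>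
       (u has_vector_derivative (b r *\<^sub>R f r + \<omega> r *\<^sub>R u r - op_A (u r))) (at r))"
proof -
  obtain f where f: "f \<in> L2_loc \<tau>" "heaviside_selection \<tau> u f"
    and eq: "AE t in lebesgue_on {\<tau><..}. \<exists>du. (u has_vector_derivative du) (at t) \<and> du + op_A (u t) = b t *\<^sub>R f t + \<omega> t *\<^sub>R u t"
    and dom: "\<And>T1 T2. \<tau> < T1 \<Longrightarrow> T1 < T2 \<Longrightarrow> AE t in lebesgue_on {T1<..<T2}. u t \<in> dom_A"
    using assms by (auto simp: strong_solution_def)
  \<comment> \<open>The bound on \<open>norm (f t)\<close> is not part of the definition of a strong
    solution; it follows from the pointwise bound on the selection, since (0,1) has length
    one.\<close>
  obtain F V where "heaviside_pair \<tau> u f F V"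
    using heaviside_selection_pair[OF f(2), of f] by auto
  from heaviside_pair_norm_le[OF this] have n1: "AE t in lborel. \<tau> < t \<longrightarrow> norm (f t) \<le> 1" .
  show ?thesis
  proof (rule that[OF f])
    fix s t assume st: "\<tau> < s" "s < t"
    have 1: "AE r in lebesgue. \<tau> < r \<longrightarrow> (\<exists>du. (u has_vector_derivative du) (at r) \<and> du + op_A (u r) = b r *\<^sub>R f r + \<omega> r *\<^sub>R u r)"
      using eq by (simp add: AE_gt_iff AE_completion_iff)
    have 2: "AE r in lebesgue. s < r \<and> r < t \<longrightarrow> u r \<in> dom_A"
      using dom[OF st] by (subst (asm) AE_restrict_space_iff) auto
    have 3: "AE r in lebesgue. \<tau> < r \<longrightarrow> norm (f r) \<le> 1" using n1 by (simp add: AE_completion_iff)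
    have "AE r in lebesgue. s < r \<and> r < t \<longrightarrow> u r \<in> dom_A \<and> norm (f r) \<le> 1 \<and>
       (u has_vector_derivative (b r *\<^sub>R f r + \<omega> r *\<^sub>R u r - op_A (u r))) (at r)"
      using 1 2 3
    proof eventually_elim
      case (elim r)
      show ?case
      proof (intro impI)
        assume r: "s < r \<and> r < t"
        then have "\<tau> < r" using st by simp
        with elim(1) obtain du where "(u has_vector_derivative du) (at r)" "du + op_A (u r) = b r *\<^sub>R f r + \<omega> r *\<^sub>R u r" by blast
        moreover from this(2) have "du = b r *\<^sub>R f r + \<omega> r *\<^sub>R u r - op_A (u r)" by (metis add_diff_cancel)
        ultimately show "u r \<in> dom_A \<and> norm (f r) \<le> 1 \<and>
          (u has_vector_derivative (b r *\<^sub>R f r + \<omega> r *\<^sub>R u r - op_A (u r))) (at r)"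
          using elim(2,3) r \<open>\<tau> < r\<close> by simp
      qed
    qed
    then obtain N where N: "N \<in> null_sets lebesgue" "\<And>r. r \<notin> N \<Longrightarrow> s < r \<and> r < t \<longrightarrow> u r \<in> dom_A \<and> norm (f r) \<le> 1 \<and>
       (u has_vector_derivative (b r *\<^sub>R f r + \<omega> r *\<^sub>R u r - op_A (u r))) (at r)"
      unfolding eventually_ae_filter by auto
    have "negligible (N \<union> {s, t})" using N(1) by (simp add: negligible_Un negligible_iff_null_sets[symmetric])
    then show "\<exists>N. negligible N \<and> (\<forall>r\<in>{s..t} - N. u r \<in> dom_A \<and> norm (f r) \<le> 1 \<and>
       (u has_vector_derivative (b r *\<^sub>R f r + \<omega> r *\<^sub>R u r - op_A (u r))) (at r))"
      using N(2) by (intro exI[of _ "N \<union> {s, t}"]) auto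
  qed
qed

lemma strong_solution_AC:
  assumes "strong_solution b \<omega> \<tau> x u" "\<tau> < s" "s < t"
  shows "abs_continuous_on_interval s t u"
  using assms by (simp add: strong_solution_def)

text \<open>Pairing with \<open>sinb k\<close> turns \<open>op_A\<close> into multiplication by
  \<open>eig k\<close>. A coefficient is a 1-Lipschitz image of \<open>u\<close>, hence absolutely
  continuous, and the almost everywhere equation can be integrated.\<close>

lemma strong_imp_mild:
  assumes sol: "strong_solution b \<omega> \<tau> x u"
  obtains f F V where "mild_solution b \<omega> \<tau> u f" "heaviside_pair \<tau> u f F V"
proof -
  obtain f0 where f0: "f0 \<in> L2_loc \<tau>" "heaviside_selection \<tau> u f0"
    and pw: "\<And>s t. \<tau> < s \<Longrightarrow> s < t \<Longrightarrow> \<exists>N. negligible N \<and> (\<forall>r\<in>{s..t} - N. u r \<in> dom_A \<and> norm (f0 r) \<le> 1 \<and>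
       (u has_vector_derivative (b r *\<^sub>R f0 r + \<omega> r *\<^sub>R u r - op_A (u r))) (at r))"
    using strong_solution_pointwise[OF sol] by metis
  \<comment> \<open>The value 0 is used only on a null set of times and makes the bound hold
    everywhere.\<close>
  define f where "f t = (if norm (f0 t) \<le> 1 then f0 t else 0)" for t
  obtain F V where FV: "heaviside_pair \<tau> u f F V"
    using heaviside_selection_pair[OF f0(2), of f] by (auto simp: f_def)
  have "((\<lambda>r. b r * coef (f r) k + \<omega> r * coef (u r) k - eig k * coef (u r) k) has_integral coef (u t) k - coef (u s) k) {s..t}"
    if st: "\<tau> < s" "s \<le> t" for k s t
  proof (cases "s = t")
    case True
    then show ?thesis using has_integral_refl(2) by simp
  next
    case False
    with st have st': "s < t" by simp
    obtain N where N: "negligible N" and d: "\<And>r. r \<in> {s..t} - N \<Longrightarrow> u r \<in> dom_A \<and> norm (f0 r) \<le> 1 \<and>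
       (u has_vector_derivative (b r *\<^sub>R f0 r + \<omega> r *\<^sub>R u r - op_A (u r))) (at r)"
      using pw[OF st(1) st'] by blast
    show ?thesis
    proof (rule abs_continuous_FTC[OF st(2) _ N])
      show "abs_continuous_on_interval s t (\<lambda>r. coef (u r) k)"
      proof (rule abs_continuous_compose_lipschitz[where L = 1 and \<phi> = "\<lambda>w. coef w k", OF strong_solution_AC[OF sol st(1) st']])
        show "dist (coef (u x) k) (coef (u y) k) \<le> 1 * dist (u x) (u y)" for x y
          using abs_coef_le[of "u x - u y" k] by (simp add: dist_real_def dist_norm inner_diff_left)
      qed simp
      fix r assume r: "r \<in> {s..t} - N"
      have "((\<lambda>r. coef (u r) k) has_vector_derivative coef (b r *\<^sub>R f0 r + \<omega> r *\<^sub>R u r - op_A (u r)) k) (at r)"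
        using d[OF r] by (intro bounded_linear.has_vector_derivative[OF bounded_linear_inner_left]) auto
      moreover have "coef (b r *\<^sub>R f0 r + \<omega> r *\<^sub>R u r - op_A (u r)) k = b r * coef (f r) k + \<omega> r * coef (u r) k - eig k * coef (u r) k"
        using d[OF r] by (simp add: f_def inner_diff_left inner_add_left dom_A_coefficients)
      ultimately show "((\<lambda>r. coef (u r) k) has_vector_derivative b r * coef (f r) k + \<omega> r * coef (u r) k - eig k * coef (u r) k) (at r within {s..t})"
        by (simp add: has_vector_derivative_at_within)
    qed
  qed
  then have "mild_solution b \<omega> \<tau> u f" unfolding mild_solution_def by (simp add: f_def)
  with FV show ?thesis using that by blast
qed

text \<open>An energy barrier: half the derivative of the squared norm is at most
  \<open>norm (u r) * (b1 - (pi\<^sup>2 - \<omega>1) * norm (u r))\<close>, which is not positive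
  once the norm has reached the threshold. Hence the norm cannot climb above both its initial value
  and the threshold. The bound does not depend on the elapsed time.\<close>

lemma strong_solution_bound:
  assumes sol: "strong_solution b \<omega> \<tau> x u"
    and b: "\<And>t. \<bar>b t\<bar> \<le> b1" and \<omega>: "\<And>t. \<omega> t \<le> \<omega>1" and \<omega>1: "\<omega>1 < pi\<^sup>2"
    and t: "\<tau> \<le> t"
  shows "norm (u t) \<le> max (norm x) (b1 / (pi\<^sup>2 - \<omega>1))"
proof (rule ccontr)
  define K where "K = max (norm x) (b1 / (pi\<^sup>2 - \<omega>1))"
  assume "\<not> ?thesis"
  then have ut: "norm (u t) > K" unfolding K_def by (simp only: not_le)
  have K0: "K \<ge> 0" by (simp add: K_def le_max_iff_disj)
  have cu: "continuous_on {\<tau>..} u" and u0: "u \<tau> = x" using sol by (auto simp: strong_solution_def)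
  have cn: "continuous_on {\<tau>..t} (\<lambda>r. norm (u r))"
    by (intro continuous_on_norm continuous_on_subset[OF cu]) auto
  \<comment> \<open>The maximum of \<open>S\<close> is the last time at which the norm is at most
    \<open>K\<close>; from there up to \<open>t\<close> the energy cannot increase.\<close>
  define S where "S = {r \<in> {\<tau>..t}. norm (u r) \<le> K}"
  have "closed S" unfolding S_def
    using continuous_closed_preimage[OF cn closed_atLeastAtMost closed_atMost[of K]] by (simp add: vimage_def Int_def)
  moreover have "bounded S" unfolding S_def by (rule bounded_subset[of "{\<tau>..t}"]) auto
  ultimately have "compact S" by (simp add: compact_eq_bounded_closed)
  moreover have "\<tau> \<in> S" using t u0 by (simp add: S_def K_def)
  ultimately obtain s where s: "s \<in> S" "\<And>r. r \<in> S \<Longrightarrow> r \<le> s" using compact_attains_sup[of S] by auto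
  have st: "\<tau> \<le> s" "s < t" using s(1) ut by (auto simp: S_def order_less_le)
  have gt: "norm (u r) > K" if "s < r" "r \<le> t" for r
    using s(2)[of r] that st by (force simp: S_def not_le)
  have us: "norm (u s) < norm (u t)" using s(1) ut by (simp add: S_def)
  have "continuous_on {s..t} (\<lambda>r. norm (u r))" using cn st by (auto intro: continuous_on_subset)
  then have "((\<lambda>r. norm (u r)) \<longlongrightarrow> norm (u s)) (at s within {s..t})"
    using st by (auto simp: continuous_on_def)
  then have "\<forall>\<^sub>F r in at s within {s..t}. norm (u r) < norm (u t)" using us by (rule order_tendstoD)
  then obtain d where d: "d > 0" "\<And>r. r \<in> {s..t} \<Longrightarrow> r \<noteq> s \<Longrightarrow> dist r s < d \<Longrightarrow> norm (u r) < norm (u t)"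
    by (auto simp: eventually_at)
  \<comment> \<open>The equation is available only after \<open>\<tau>\<close>, and \<open>s\<close>
    may be \<open>\<tau>\<close> itself. A point slightly to the right avoids this and by continuity
    still has a smaller norm than \<open>u t\<close>.\<close>
  define s' where "s' = min t (s + d / 2)"
  have s': "s < s'" "s' \<le> t" "norm (u s') < norm (u t)"
    using d(1) st d(2)[of s'] by (auto simp: s'_def dist_real_def min_def)
  then have s't: "s' < t" by (cases "s' = t") auto
  have \<tau>s': "\<tau> < s'" using st s' by simp
  obtain f where pw: "\<And>s t. \<tau> < s \<Longrightarrow> s < t \<Longrightarrow> \<exists>N. negligible N \<and> (\<forall>r\<in>{s..t} - N. u r \<in> dom_A \<and> norm (f r) \<le> 1 \<and>
       (u has_vector_derivative (b r *\<^sub>R f r + \<omega> r *\<^sub>R u r - op_A (u r))) (at r))"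
    using strong_solution_pointwise[OF sol] by metis
  obtain N where N: "negligible N" and D: "\<And>r. r \<in> {s'..t} - N \<Longrightarrow> u r \<in> dom_A \<and> norm (f r) \<le> 1 \<and>
       (u has_vector_derivative (b r *\<^sub>R f r + \<omega> r *\<^sub>R u r - op_A (u r))) (at r)"
    using pw[OF \<tau>s' s't] by blast
  define du where "du r = b r *\<^sub>R f r + \<omega> r *\<^sub>R u r - op_A (u r)" for r
  define n' where "n' r = (if r \<in> {s'..t} - N then 2 * inner (du r) (u r) else 0)" for r
  have "compact ((\<lambda>r. norm (u r)) ` {\<tau>..t})" by (rule compact_continuous_image[OF cn]) simp
  then obtain M where "\<forall>y\<in>(\<lambda>r. norm (u r)) ` {\<tau>..t}. norm y \<le> M"
    using compact_imp_bounded bounded_iff by blast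
  then have M: "norm (u r) \<le> M" if "r \<in> {\<tau>..t}" for r using that by auto
  have M0: "M > 0" using M[of t] ut t K0 by auto
  have I: "(n' has_integral inner (u t) (u t) - inner (u s') (u s')) {s'..t}"
  proof (rule abs_continuous_FTC[OF _ _ N])
    show "abs_continuous_on_interval s' t (\<lambda>r. inner (u r) (u r))"
    proof (rule abs_continuous_compose_lipschitz[where L = "2 * M" and \<phi> = "\<lambda>w. inner w w", OF strong_solution_AC[OF sol \<tau>s' s't]])
      fix p q assume pq: "p \<in> {s'..t}" "q \<in> {s'..t}"
      have "inner (u p) (u p) - inner (u q) (u q) = inner (u p - u q) (u p + u q)"
        by (simp add: inner_diff_left inner_add_right inner_commute[of "u q" "u p"])
      then have "dist (inner (u p) (u p)) (inner (u q) (u q)) \<le> norm (u p - u q) * norm (u p + u q)"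
        by (simp add: dist_real_def Cauchy_Schwarz_ineq2)
      also have "\<dots> \<le> norm (u p - u q) * (M + M)"
        using pq \<tau>s' by (intro mult_left_mono norm_triangle_le add_mono M) auto
      finally show "dist (inner (u p) (u p)) (inner (u q) (u q)) \<le> 2 * M * dist (u p) (u q)"
        by (simp add: dist_norm mult.commute)
    qed (use M0 in simp)
    fix r assume r: "r \<in> {s'..t} - N"
    then have "(u has_vector_derivative du r) (at r within {s'..t})"
      using D[OF r] by (simp add: du_def has_vector_derivative_at_within)
    from bounded_bilinear.has_vector_derivative[OF bounded_bilinear_inner this this]
    show "((\<lambda>r. inner (u r) (u r)) has_vector_derivative n' r) (at r within {s'..t})"
      using r by (simp add: n'_def inner_commute)
  qed (use s't in simp)
  have nonpos: "n' r \<le> 0" if "r \<in> {s'..t}" for r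
  proof (cases "r \<in> N")
    case False
    with that have r: "r \<in> {s'..t} - N" by simp
    have ur: "norm (u r) > K" using gt[of r] that s' by auto
    then have pos: "norm (u r) > 0" using K0 by linarith
    have e0: "inner (du r) (u r) = b r * inner (f r) (u r) + \<omega> r * (norm (u r))\<^sup>2 - inner (op_A (u r)) (u r)"
      by (simp add: du_def inner_diff_left inner_add_left power2_norm_eq_inner)
    have e1: "b r * inner (f r) (u r) \<le> b1 * norm (u r)"
    proof -
      have "\<bar>b r * inner (f r) (u r)\<bar> \<le> b1 * (1 * norm (u r))"
        unfolding abs_mult using b[of r] D[OF r]
        by (intro mult_mono order_trans[OF Cauchy_Schwarz_ineq2] mult_right_mono) auto
      then show ?thesis by simp
    qed
    have e2: "\<omega> r * (norm (u r))\<^sup>2 \<le> \<omega>1 * (norm (u r))\<^sup>2" by (intro mult_right_mono \<omega>) simp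
    have e3: "pi\<^sup>2 * (norm (u r))\<^sup>2 \<le> inner (op_A (u r)) (u r)"
      using op_A_ge[of "u r"] D[OF r] by simp
    have "inner (du r) (u r) \<le> b1 * norm (u r) + \<omega>1 * (norm (u r))\<^sup>2 - pi\<^sup>2 * (norm (u r))\<^sup>2"
      using e0 e1 e2 e3 by linarith
    then have "inner (du r) (u r) \<le> norm (u r) * (b1 - (pi\<^sup>2 - \<omega>1) * norm (u r))"
      by (simp add: algebra_simps power2_eq_square)
    moreover have "b1 - (pi\<^sup>2 - \<omega>1) * norm (u r) \<le> 0"
    proof -
      have "b1 / (pi\<^sup>2 - \<omega>1) \<le> norm (u r)" using ur by (simp add: K_def)
      then show ?thesis using \<omega>1 by (simp add: field_simps)
    qed
    ultimately have "inner (du r) (u r) \<le> 0" using pos by (smt (verit) mult_nonneg_nonpos)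
    then show ?thesis by (simp add: n'_def)
  qed (simp add: n'_def)
  have "inner (u t) (u t) - inner (u s') (u s') \<le> 0"
    by (rule has_integral_le[OF I has_integral_0 nonpos])
  then have "norm (u t) \<le> norm (u s')" by (simp add: norm_eq_sqrt_inner)
  with s'(3) show False by simp
qed

section \<open>Estimates mode by mode\<close>

lemma forcing_bound:
  assumes "\<bar>b\<bar> \<le> b1" "\<bar>w\<bar> \<le> w1" "norm f \<le> 1" "norm u \<le> R"
  shows "norm (b *\<^sub>R f + w *\<^sub>R u) \<le> b1 + w1 * R"
proof -
  have "norm (b *\<^sub>R f + w *\<^sub>R u) \<le> \<bar>b\<bar> * norm f + \<bar>w\<bar> * norm u"
    by (rule norm_triangle_le) simp
  also have "\<dots> \<le> b1 * 1 + w1 * R" using assms by (intro add_mono mult_mono) auto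
  finally show ?thesis by simp
qed

lemma mild_integrand_bound:
  assumes "\<bar>b\<bar> \<le> b1" "\<bar>w\<bar> \<le> w1" "norm f \<le> 1" "norm u \<le> R"
  shows "\<bar>b * coef f k + w * coef u k - eig k * coef u k\<bar> \<le> b1 + w1 * R + eig k * R"
proof -
  have "b * coef f k + w * coef u k = coef (b *\<^sub>R f + w *\<^sub>R u) k" by (simp add: inner_add_left)
  then have 1: "\<bar>b * coef f k + w * coef u k\<bar> \<le> b1 + w1 * R"
    using abs_coef_le[of "b *\<^sub>R f + w *\<^sub>R u" k] forcing_bound[OF assms] by simp
  have "\<bar>coef u k\<bar> \<le> R" using abs_coef_le[of u k] assms by linarith
  then have 2: "\<bar>eig k * coef u k\<bar> \<le> eig k * R"
    using eig_pos[of k] by (simp add: abs_mult mult_left_mono)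
  show ?thesis using 1 2 by linarith
qed

text \<open>The constant grows with the mode but does not depend on the solution beyond its bounds;
  this is the equicontinuity behind the extraction of subsequences.\<close>

lemma mild_lipschitz:
  assumes mild: "mild_solution b \<omega> \<tau> u f" and s: "\<tau> < s"
    and bd: "\<And>r. r \<in> {s..t} \<Longrightarrow> \<bar>b r\<bar> \<le> b1 \<and> \<bar>\<omega> r\<bar> \<le> w1 \<and> norm (u r) \<le> R" and st: "s \<le> t"
  shows "(b1 + w1 * R + eig k * R)-lipschitz_on {s..t} (\<lambda>r. coef (u r) k)"
proof (rule integral_lipschitz)
  fix p q assume "s \<le> p" "p \<le> q" "q \<le> t"
  then show "((\<lambda>r. b r * coef (f r) k + \<omega> r * coef (u r) k - eig k * coef (u r) k) has_integral coef (u q) k - coef (u p) k) {p..q}"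
    using mild s by (simp add: mild_solution_def)
next
  fix r assume "r \<in> {s..t}"
  then show "\<bar>b r * coef (f r) k + \<omega> r * coef (u r) k - eig k * coef (u r) k\<bar> \<le> b1 + w1 * R + eig k * R"
    using bd mild by (intro mild_integrand_bound) (auto simp: mild_solution_def)
next
  have "\<bar>b s\<bar> \<le> b1" "\<bar>\<omega> s\<bar> \<le> w1" "norm (u s) \<le> R" using bd[of s] st by auto
  then have "0 \<le> b1" "0 \<le> w1" "0 \<le> R" using norm_ge_zero[of "u s"] by linarith+
  then show "0 \<le> b1 + w1 * R + eig k * R" using eig_pos[of k] by simp
qed

lemma mild_energy:
  assumes mild: "mild_solution b \<omega> \<tau> u f" and s: "\<tau> < s" and st: "s \<le> t"
    and bd: "\<And>r. r \<in> {s..t} \<Longrightarrow> \<bar>b r\<bar> \<le> b1 \<and> \<bar>\<omega> r\<bar> \<le> w1 \<and> norm (u r) \<le> R"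
    and p: "\<And>r. (p has_real_derivative p' r) (at r)" and p': "continuous_on UNIV p'"
  shows "((\<lambda>r. p' r * (coef (u r) k)\<^sup>2 + 2 * p r * coef (u r) k *
      (coef (b r *\<^sub>R f r + \<omega> r *\<^sub>R u r) k - eig k * coef (u r) k)) has_integral
      p t * (coef (u t) k)\<^sup>2 - p s * (coef (u s) k)\<^sup>2) {s..t}"
proof -
  have "((\<lambda>r. p' r * (coef (u r) k)\<^sup>2 + 2 * p r * coef (u r) k *
      (b r * coef (f r) k + \<omega> r * coef (u r) k - eig k * coef (u r) k)) has_integral
      p t * (coef (u t) k)\<^sup>2 - p s * (coef (u s) k)\<^sup>2) {s..t}"
  proof (rule energy_identity[OF st _ _ p p', where C = "b1 + w1 * R + eig k * R"])
    fix p q assume "s \<le> p" "p \<le> q" "q \<le> t"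
    then show "((\<lambda>r. b r * coef (f r) k + \<omega> r * coef (u r) k - eig k * coef (u r) k) has_integral coef (u q) k - coef (u p) k) {p..q}"
      using mild s by (simp add: mild_solution_def)
  next
    fix r assume "r \<in> {s..t}"
    then show "\<bar>b r * coef (f r) k + \<omega> r * coef (u r) k - eig k * coef (u r) k\<bar> \<le> b1 + w1 * R + eig k * R"
      using bd mild by (intro mild_integrand_bound) (auto simp: mild_solution_def)
  qed
  then show ?thesis by (simp add: inner_add_left)
qed

text \<open>The weight \<open>exp (eig k * (r - s))\<close> is the integrating factor of the \<open>k\<close>-th mode.\<close>

lemma mild_tail_bound:
  assumes mild: "mild_solution b \<omega> \<tau> u f" and s: "\<tau> < s" and st: "s \<le> t"
    and bd: "\<And>r. r \<in> {s..t} \<Longrightarrow> \<bar>b r\<bar> \<le> b1 \<and> \<bar>\<omega> r\<bar> \<le> w1 \<and> norm (u r) \<le> R"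
  shows "(\<Sum>k\<in>{K..<L}. (coef (u t) k)\<^sup>2) \<le> exp (- eig K * (t - s)) * R\<^sup>2 + (b1 + w1 * R)\<^sup>2 / eig K * (t - s)"
proof -
  define p where "p k r = exp (eig k * (r - s))" for k r
  define g where "g r = b r *\<^sub>R f r + \<omega> r *\<^sub>R u r" for r
  define I where "I k r = eig k * p k r * (coef (u r) k)\<^sup>2 + 2 * p k r * coef (u r) k * (coef (g r) k - eig k * coef (u r) k)" for k r
  have ppos: "p k r > 0" for k r by (simp add: p_def)
  have I: "(I k has_integral p k t * (coef (u t) k)\<^sup>2 - p k s * (coef (u s) k)\<^sup>2) {s..t}" for k
    unfolding I_def g_def
    by (rule mild_energy[OF mild s st bd]) (auto simp: p_def intro!: derivative_eq_intros continuous_intros)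
  have "((\<lambda>r. \<Sum>k\<in>{K..<L}. I k r / p k t) has_integral (\<Sum>k\<in>{K..<L}. (p k t * (coef (u t) k)\<^sup>2 - p k s * (coef (u s) k)\<^sup>2) / p k t)) {s..t}"
    by (intro has_integral_sum has_integral_divide I) simp
  moreover have "((\<lambda>r. (b1 + w1 * R)\<^sup>2 / eig K) has_integral (b1 + w1 * R)\<^sup>2 / eig K * (t - s)) {s..t}"
    using has_integral_const_real[of "(b1 + w1 * R)\<^sup>2 / eig K" s t] st by (simp add: mult.commute)
  moreover have "(\<Sum>k\<in>{K..<L}. I k r / p k t) \<le> (b1 + w1 * R)\<^sup>2 / eig K" if r: "r \<in> {s..t}" for r
  proof -
    have "I k r / p k t \<le> (coef (g r) k)\<^sup>2 / eig K" if k: "k \<in> {K..<L}" for k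
    proof -
      let ?y = "coef (u r) k" and ?g = "coef (g r) k"
      have e: "eig k > 0" "eig K > 0" "eig K \<le> eig k" using eig_pos eig_mono k by auto
      \<comment> \<open>Completing the square bounds the production of energy by the forcing alone
        and gains the factor \<open>1 / eig k\<close>.\<close>
      have "0 \<le> (eig k * ?y - ?g)\<^sup>2 / eig k" using e by simp
      also have "\<dots> = ?g\<^sup>2 / eig k - (eig k * ?y\<^sup>2 + 2 * ?y * (?g - eig k * ?y))"
        using e by (simp add: power2_eq_square field_simps)
      finally have "eig k * ?y\<^sup>2 + 2 * ?y * (?g - eig k * ?y) \<le> ?g\<^sup>2 / eig k" by simp
      also have "\<dots> \<le> ?g\<^sup>2 / eig K" using e by (intro divide_left_mono) auto
      finally have 1: "eig k * ?y\<^sup>2 + 2 * ?y * (?g - eig k * ?y) \<le> ?g\<^sup>2 / eig K" .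
      have "p k r \<le> p k t" using r e by (simp add: p_def)
      then have q: "p k r / p k t \<le> 1" "0 \<le> p k r / p k t" using ppos[of k t] ppos[of k r] by auto
      have "I k r / p k t = p k r / p k t * (eig k * ?y\<^sup>2 + 2 * ?y * (?g - eig k * ?y))"
        by (simp add: I_def algebra_simps add_divide_distrib diff_divide_distrib)
      also have "\<dots> \<le> p k r / p k t * (?g\<^sup>2 / eig K)" using 1 q by (intro mult_left_mono) auto
      also have "\<dots> \<le> 1 * (?g\<^sup>2 / eig K)" using q e by (intro mult_right_mono) auto
      finally show ?thesis by simp
    qed
    then have "(\<Sum>k\<in>{K..<L}. I k r / p k t) \<le> (\<Sum>k\<in>{K..<L}. (coef (g r) k)\<^sup>2 / eig K)" by (rule sum_mono)
    also have "\<dots> = (\<Sum>k\<in>{K..<L}. (coef (g r) k)\<^sup>2) / eig K" by (simp add: sum_divide_distrib)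
    also have "\<dots> \<le> (b1 + w1 * R)\<^sup>2 / eig K"
    proof (intro divide_right_mono)
      have "norm (g r) \<le> b1 + w1 * R"
        unfolding g_def using bd[OF r] mild by (intro forcing_bound) (auto simp: mild_solution_def)
      then show "(\<Sum>k\<in>{K..<L}. (coef (g r) k)\<^sup>2) \<le> (b1 + w1 * R)\<^sup>2"
        using sin_bessel[of "{K..<L}" "g r"] by (meson finite_atLeastLessThan norm_ge_zero order_trans power_mono)
      show "0 \<le> eig K" using eig_pos[of K] by simp
    qed
    finally show ?thesis .
  qed
  ultimately have "(\<Sum>k\<in>{K..<L}. (p k t * (coef (u t) k)\<^sup>2 - p k s * (coef (u s) k)\<^sup>2) / p k t) \<le> (b1 + w1 * R)\<^sup>2 / eig K * (t - s)"
    by (rule has_integral_le)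
  moreover have "(p k t * (coef (u t) k)\<^sup>2 - p k s * (coef (u s) k)\<^sup>2) / p k t = (coef (u t) k)\<^sup>2 - exp (- eig k * (t - s)) * (coef (u s) k)\<^sup>2" for k
  proof -
    define E where "E = exp (eig k * (t - s))"
    have "E > 0" "exp (- eig k * (t - s)) = 1 / E" "p k t = E" "p k s = 1"
      by (simp_all add: E_def p_def exp_minus divide_inverse)
    then show ?thesis by (simp only:) (simp add: field_simps)
  qed
  moreover have "(\<Sum>k\<in>{K..<L}. exp (- eig k * (t - s)) * (coef (u s) k)\<^sup>2) \<le> exp (- eig K * (t - s)) * R\<^sup>2"
  proof -
    have "(\<Sum>k\<in>{K..<L}. exp (- eig k * (t - s)) * (coef (u s) k)\<^sup>2) \<le> (\<Sum>k\<in>{K..<L}. exp (- eig K * (t - s)) * (coef (u s) k)\<^sup>2)"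
      using eig_mono st by (intro sum_mono mult_right_mono) (auto intro!: mult_right_mono)
    also have "\<dots> = exp (- eig K * (t - s)) * (\<Sum>k\<in>{K..<L}. (coef (u s) k)\<^sup>2)" by (simp add: sum_distrib_left)
    also have "\<dots> \<le> exp (- eig K * (t - s)) * R\<^sup>2"
    proof (intro mult_left_mono)
      have "norm (u s) \<le> R" using bd[of s] st by simp
      then show "(\<Sum>k\<in>{K..<L}. (coef (u s) k)\<^sup>2) \<le> R\<^sup>2"
        using sin_bessel[of "{K..<L}" "u s"] by (meson finite_atLeastLessThan norm_ge_zero order_trans power_mono)
    qed simp
    finally show ?thesis .
  qed
  ultimately show ?thesis by (simp add: sum_subtractf)
qed

section \<open>Regularity of mild solutions\<close>

text \<open>The weight \<open>r - s\<close> removes the initial value of the \<open>H\<^sup>1\<close> norm, which need not be finite.\<close>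

lemma mild_H2_bound:
  assumes mild: "mild_solution b \<omega> \<tau> u f" and s: "\<tau> < s" and st: "s \<le> t"
    and bd: "\<And>r. r \<in> {s..t} \<Longrightarrow> \<bar>b r\<bar> \<le> b1 \<and> \<bar>\<omega> r\<bar> \<le> w1 \<and> norm (u r) \<le> R"
  shows "(\<lambda>r. (r - s) * (\<Sum>k<n. (eig k * coef (u r) k)\<^sup>2)) integrable_on {s..t}"
    and "integral {s..t} (\<lambda>r. (r - s) * (\<Sum>k<n. (eig k * coef (u r) k)\<^sup>2))
      \<le> R\<^sup>2 + ((t - s + 1) * (b1 + w1 * R)\<^sup>2 + R\<^sup>2) * (t - s)"
proof -
  define G where "G = b1 + w1 * R"
  define g where "g r = b r *\<^sub>R f r + \<omega> r *\<^sub>R u r" for r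
  \<comment> \<open>Differentiating \<open>eig k * (r - s)\<close> produces the unwanted term
    \<open>eig k * (coef (u r) k)\<^sup>2\<close>. The summand 1 adds the plain L^2 energy identity,
    whose dissipation is twice that term and absorbs it.\<close>
  define p where "p k r = eig k * (r - s) + 1" for k r
  define I where "I k r = eig k * (coef (u r) k)\<^sup>2 + 2 * p k r * coef (u r) k * (coef (g r) k - eig k * coef (u r) k)" for k r
  have I: "(I k has_integral p k t * (coef (u t) k)\<^sup>2 - p k s * (coef (u s) k)\<^sup>2) {s..t}" for k
    unfolding I_def g_def
    by (rule mild_energy[OF mild s st bd]) (auto simp: p_def intro!: derivative_eq_intros continuous_intros)
  have cont: "continuous_on {s..t} (\<lambda>r. coef (u r) k)" for k
    by (rule lipschitz_on_continuous_on[OF mild_lipschitz[OF mild s bd st]])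
  show int: "(\<lambda>r. (r - s) * (\<Sum>k<n. (eig k * coef (u r) k)\<^sup>2)) integrable_on {s..t}"
    by (intro integrable_continuous_real continuous_intros cont)
  let ?K = "(t - s + 1) * G\<^sup>2 + R\<^sup>2"
  have "((\<lambda>r. ?K - (\<Sum>k<n. I k r)) has_integral ?K * (t - s) - (\<Sum>k<n. p k t * (coef (u t) k)\<^sup>2 - p k s * (coef (u s) k)\<^sup>2)) {s..t}"
    using has_integral_const_real[of ?K s t] st
    by (intro has_integral_diff has_integral_sum I) (simp_all add: mult.commute)
  moreover have "(r - s) * (\<Sum>k<n. (eig k * coef (u r) k)\<^sup>2) \<le> ?K - (\<Sum>k<n. I k r)" if r: "r \<in> {s..t}" for r
  proof -
    have "(r - s) * (eig k * coef (u r) k)\<^sup>2 + I k r \<le> (t - s + 1) * (coef (g r) k)\<^sup>2 + (coef (u r) k)\<^sup>2" for k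
    proof -
      let ?y = "coef (u r) k" and ?g = "coef (g r) k" and ?q = "r - s"
      have "0 \<le> ?q * (eig k * ?y - ?g)\<^sup>2" "0 \<le> eig k * ?y\<^sup>2"
        using r eig_pos[of k] by auto
      moreover have "0 \<le> (?y - ?g)\<^sup>2" by (rule zero_le_power2)
      moreover have "?q * (eig k * ?y)\<^sup>2 + I k r =
          ?q * ?g\<^sup>2 - ?q * (eig k * ?y - ?g)\<^sup>2 + ?y\<^sup>2 + ?g\<^sup>2 - (?y - ?g)\<^sup>2 - eig k * ?y\<^sup>2"
        by (simp add: I_def p_def power2_eq_square algebra_simps)
      moreover have "?q * ?g\<^sup>2 \<le> (t - s) * ?g\<^sup>2" using r by (intro mult_right_mono) auto
      moreover have "(t - s + 1) * ?g\<^sup>2 = (t - s) * ?g\<^sup>2 + ?g\<^sup>2" by (simp add: distrib_right)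
      ultimately show ?thesis by linarith
    qed
    then have "(\<Sum>k<n. (r - s) * (eig k * coef (u r) k)\<^sup>2 + I k r) \<le> (\<Sum>k<n. (t - s + 1) * (coef (g r) k)\<^sup>2 + (coef (u r) k)\<^sup>2)"
      by (rule sum_mono)
    also have "\<dots> = (t - s + 1) * (\<Sum>k<n. (coef (g r) k)\<^sup>2) + (\<Sum>k<n. (coef (u r) k)\<^sup>2)"
      by (simp add: sum.distrib sum_distrib_left)
    also have "\<dots> \<le> ?K"
    proof (intro add_mono mult_left_mono)
      have "norm (g r) \<le> G"
        unfolding g_def G_def using bd[OF r] mild by (intro forcing_bound) (auto simp: mild_solution_def)
      then show "(\<Sum>k<n. (coef (g r) k)\<^sup>2) \<le> G\<^sup>2"
        using sin_bessel[of "{..<n}" "g r"] by (meson finite_lessThan norm_ge_zero order_trans power_mono)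
      have "norm (u r) \<le> R" using bd[OF r] by simp
      then show "(\<Sum>k<n. (coef (u r) k)\<^sup>2) \<le> R\<^sup>2"
        using sin_bessel[of "{..<n}" "u r"] by (meson finite_lessThan norm_ge_zero order_trans power_mono)
    qed (use st in simp)
    finally show ?thesis by (simp add: sum.distrib sum_distrib_left)
  qed
  ultimately have "integral {s..t} (\<lambda>r. (r - s) * (\<Sum>k<n. (eig k * coef (u r) k)\<^sup>2))
      \<le> ?K * (t - s) - (\<Sum>k<n. p k t * (coef (u t) k)\<^sup>2 - p k s * (coef (u s) k)\<^sup>2)"
    by (rule has_integral_le[OF integrable_integral[OF int]])
  moreover have "- (\<Sum>k<n. p k t * (coef (u t) k)\<^sup>2 - p k s * (coef (u s) k)\<^sup>2) \<le> R\<^sup>2"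
  proof -
    have "- (\<Sum>k<n. p k t * (coef (u t) k)\<^sup>2 - p k s * (coef (u s) k)\<^sup>2) \<le> (\<Sum>k<n. (coef (u s) k)\<^sup>2)"
      unfolding sum_negf[symmetric]
    proof (rule sum_mono)
      fix k
      have "0 \<le> p k t" using st eig_pos[of k] by (simp add: p_def)
      then show "- (p k t * (coef (u t) k)\<^sup>2 - p k s * (coef (u s) k)\<^sup>2) \<le> (coef (u s) k)\<^sup>2"
        by (simp add: p_def)
    qed
    also have "norm (u s) \<le> R" using bd[of s] st by simp
    then have "(\<Sum>k<n. (coef (u s) k)\<^sup>2) \<le> R\<^sup>2"
      using sin_bessel[of "{..<n}" "u s"] by (meson finite_lessThan norm_ge_zero order_trans power_mono)
    finally show ?thesis .
  qed
  ultimately show "integral {s..t} (\<lambda>r. (r - s) * (\<Sum>k<n. (eig k * coef (u r) k)\<^sup>2))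
      \<le> R\<^sup>2 + ((t - s + 1) * (b1 + w1 * R)\<^sup>2 + R\<^sup>2) * (t - s)"
    unfolding G_def by linarith
qed

text \<open>The weighted bound holds uniformly in the number of modes, so the limit is taken in the
  extended nonnegative reals, where the series needs no prior proof of summability.\<close>

lemma mild_H2_nn_bound:
  assumes mild: "mild_solution b \<omega> \<tau> u f" and c: "\<tau> < c" and cd: "c \<le> d"
    and bd: "\<And>r. \<tau> < r \<Longrightarrow> \<bar>b r\<bar> \<le> b1 \<and> \<bar>\<omega> r\<bar> \<le> w1 \<and> norm (u r) \<le> R"
  shows "(\<integral>\<^sup>+r\<in>{c..d}. (\<Sum>k. ennreal ((eig k * coef (u r) k)\<^sup>2)) \<partial>lebesgue) < \<infinity>"
proof -
  \<comment> \<open>Halfway between \<open>\<tau>\<close> and \<open>c\<close>: on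
    \<open>{c..d}\<close> the weight \<open>r - s\<close> is then at least \<open>c - s\<close>, and
    dividing by this constant removes it.\<close>
  define s where "s = (\<tau> + c) / 2"
  have s: "\<tau> < s" "s < c" "s \<le> d" using c cd by (auto simp: s_def)
  define C where "C = R\<^sup>2 + ((d - s + 1) * (b1 + w1 * R)\<^sup>2 + R\<^sup>2) * (d - s)"
  have bd': "\<And>r. r \<in> {s..d} \<Longrightarrow> \<bar>b r\<bar> \<le> b1 \<and> \<bar>\<omega> r\<bar> \<le> w1 \<and> norm (u r) \<le> R" using bd s by simp
  note H = mild_H2_bound[OF mild s(1) s(3) bd', folded C_def]
  have cont: "continuous_on {s..d} (\<lambda>r. coef (u r) k)" for k
    by (rule lipschitz_on_continuous_on[OF mild_lipschitz[OF mild s(1) bd' s(3)]])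
  define q where "q k r = ennreal (indicator {c..d} r * (eig k * coef (u r) k)\<^sup>2)" for k r
  have qm: "q k \<in> borel_measurable lebesgue" for k
  proof -
    have "continuous_on {c..d} (\<lambda>r. (eig k * coef (u r) k)\<^sup>2)"
      using s by (intro continuous_intros continuous_on_subset[OF cont]) auto
    then have "(\<lambda>r. indicator {c..d} r *\<^sub>R (eig k * coef (u r) k)\<^sup>2) \<in> borel_measurable borel"
      by (intro borel_measurable_continuous_on_indicator) auto
    then have "q k \<in> borel_measurable lborel" unfolding q_def by simp
    then show ?thesis by (rule measurable_completion)
  qed
  have part: "(\<Sum>k<n. \<integral>\<^sup>+r. q k r \<partial>lebesgue) \<le> ennreal (C / (c - s))" for n
  proof -
    let ?\<Phi> = "\<lambda>r. \<Sum>k<n. (eig k * coef (u r) k)\<^sup>2"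
    have i: "((\<lambda>r. (r - s) * ?\<Phi> r / (c - s)) has_integral integral {s..d} (\<lambda>r. (r - s) * ?\<Phi> r) / (c - s)) {s..d}"
      by (intro has_integral_divide integrable_integral H(1))
    have "(\<Sum>k<n. \<integral>\<^sup>+r. q k r \<partial>lebesgue) = (\<integral>\<^sup>+r. (\<Sum>k<n. q k r) \<partial>lebesgue)"
      by (rule nn_integral_sum[symmetric]) (use qm in auto)
    also have "\<dots> \<le> (\<integral>\<^sup>+r. ennreal (indicator {s..d} r * ((r - s) * ?\<Phi> r / (c - s))) \<partial>lebesgue)"
    proof (rule nn_integral_mono)
      fix r
      have "(\<Sum>k<n. q k r) = ennreal (indicator {c..d} r * ?\<Phi> r)"
        unfolding q_def by (subst sum_ennreal) (auto simp: sum_distrib_left)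
      also have "\<dots> \<le> ennreal (indicator {s..d} r * ((r - s) * ?\<Phi> r / (c - s)))"
      proof (rule ennreal_leI)
        have p: "0 \<le> ?\<Phi> r" by (intro sum_nonneg) auto
        show "indicator {c..d} r * ?\<Phi> r \<le> indicator {s..d} r * ((r - s) * ?\<Phi> r / (c - s))"
        proof (cases "r \<in> {c..d}")
          case True
          then have "(c - s) * ?\<Phi> r \<le> (r - s) * ?\<Phi> r" using p by (intro mult_right_mono) auto
          then have "?\<Phi> r \<le> (r - s) * ?\<Phi> r / (c - s)" using s by (simp add: pos_le_divide_eq mult.commute)
          then show ?thesis using True s by simp
        next
          case False
          have "0 \<le> (r - s) * ?\<Phi> r / (c - s)" if "r \<ge> s" using p s that by simp
          moreover have "indicator {c..d} r = (0::real)" using False by simp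
          ultimately show ?thesis by (cases "r \<in> {s..d}") simp_all
        qed
      qed
      finally show "(\<Sum>k<n. q k r) \<le> ennreal (indicator {s..d} r * ((r - s) * ?\<Phi> r / (c - s)))" .
    qed
    also have "\<dots> = ennreal (integral {s..d} (\<lambda>r. (r - s) * ?\<Phi> r) / (c - s))"
    proof -
      have nn: "0 \<le> (r - s) * ?\<Phi> r / (c - s)" if "r \<in> {s..d}" for r
        using s that by (auto intro!: divide_nonneg_pos mult_nonneg_nonneg sum_nonneg)
      show ?thesis unfolding nn_integral_completion
        by (rule nn_integral_has_integral_lebesgue[OF nn i])
    qed
    also have "\<dots> \<le> ennreal (C / (c - s))"
      using H(2) s by (intro ennreal_leI divide_right_mono) auto
    finally show ?thesis .
  qed
  have "(\<integral>\<^sup>+r\<in>{c..d}. (\<Sum>k. ennreal ((eig k * coef (u r) k)\<^sup>2)) \<partial>lebesgue) = (\<integral>\<^sup>+r. (\<Sum>k. q k r) \<partial>lebesgue)"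
  proof (rule nn_integral_cong)
    fix r
    show "(\<Sum>k. ennreal ((eig k * coef (u r) k)\<^sup>2)) * indicator {c..d} r = (\<Sum>k. q k r)"
      by (cases "r \<in> {c..d}") (simp_all add: q_def)
  qed
  also have "\<dots> = (\<Sum>k. \<integral>\<^sup>+r. q k r \<partial>lebesgue)"
    by (rule nn_integral_suminf[OF qm])
  also have "\<dots> \<le> ennreal (C / (c - s))"
    by (rule suminf_le_const[OF summableI part])
  finally show ?thesis by (simp add: order_le_less_trans)
qed

text \<open>\<open>op_A\<close> given by its sine series. Being a limit of finite sums it is
  measurable along \<open>u\<close>, which is not apparent from the definition by weak derivatives.
  Where the series diverges the value is arbitrary; along a mild solution this concerns a null set
  of times.\<close>

definition ser_A :: "l2 \<Rightarrow> l2" where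
  "ser_A u = lim (\<lambda>n. \<Sum>k<n. (eig k * coef u k) *\<^sub>R sinb k)"

lemma ser_A_finite:
  assumes fin: "(\<Sum>k. ennreal ((eig k * coef u k)\<^sup>2)) < \<infinity>"
  shows "u \<in> dom_A" "op_A u = ser_A u" "coef (ser_A u) k = eig k * coef u k"
    "ennreal ((norm (ser_A u))\<^sup>2) = (\<Sum>k. ennreal ((eig k * coef u k)\<^sup>2))"
proof -
  have sm: "summable (\<lambda>k. (eig k * coef u k)\<^sup>2)"
    by (rule summable_suminf_not_top) (use fin in auto)
  show dom: "u \<in> dom_A" by (rule dom_A_I[OF sm])
  obtain a where a: "(\<lambda>n. \<Sum>k<n. (eig k * coef u k) *\<^sub>R sinb k) \<longlonglongrightarrow> a" "\<And>k. coef a k = eig k * coef u k"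
    using Riesz_Fischer[OF sinb_orthonormal sm] by metis
  have sa: "ser_A u = a" unfolding ser_A_def by (rule limI[OF a(1)])
  show "coef (ser_A u) k = eig k * coef u k" unfolding sa by (rule a(2))
  show "op_A u = ser_A u" unfolding sa by (rule l2_eqI) (simp add: a(2) dom_A_coefficients[OF dom])
  have "(\<lambda>k. (eig k * coef u k)\<^sup>2) sums (norm a)\<^sup>2" using sin_parseval[of a] by (simp add: a(2))
  then show "ennreal ((norm (ser_A u))\<^sup>2) = (\<Sum>k. ennreal ((eig k * coef u k)\<^sup>2))"
    unfolding sa by (subst suminf_ennreal_eq) auto
qed

text \<open>The H^2 bound makes the right-hand side \<open>h\<close> square integrable in time with
  values in \<open>l2\<close>. The scalar equations then say that \<open>u\<close> is the indefinite
  integral of \<open>h\<close>, since both sides have the same coefficients. Lebesgue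
  differentiation in \<open>l2\<close> gives the derivative, and square integrability gives absolute
  continuity.\<close>

lemma mild_regularity:
  assumes mild: "mild_solution b \<omega> \<tau> u f" and c: "\<tau> < c" and cd: "c < d"
    and b: "continuous_on UNIV b" and \<omega>: "continuous_on UNIV \<omega>" and u: "continuous_on {c..d} u"
    and f: "f \<in> borel_measurable (lebesgue_on {\<tau><..})"
    and bd: "\<And>r. \<tau> < r \<Longrightarrow> \<bar>b r\<bar> \<le> b1 \<and> \<bar>\<omega> r\<bar> \<le> w1 \<and> norm (u r) \<le> R"
  shows "AE r in lebesgue_on {c..d}. u r \<in> dom_A"
    and "AE r in lebesgue. c < r \<and> r < d \<longrightarrow>
      (u has_vector_derivative (b r *\<^sub>R f r + \<omega> r *\<^sub>R u r - op_A (u r))) (at r)"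
    and "abs_continuous_on_interval c d u"
proof -
  let ?M = "lebesgue_on {c..d}"
  define G where "G = b1 + w1 * R"
  interpret fm: finite_measure ?M by (rule finite_measure_lebesgue_on) auto
  define \<Phi> where "\<Phi> r = (\<Sum>k. ennreal ((eig k * coef (u r) k)\<^sup>2))" for r
  define h where "h r = b r *\<^sub>R f r + \<omega> r *\<^sub>R u r - ser_A (u r)" for r
  have um: "u \<in> borel_measurable ?M" by (rule continuous_imp_measurable_on_sets_lebesgue[OF u]) auto
  have bm: "b \<in> borel_measurable ?M" "\<omega> \<in> borel_measurable ?M"
    using b \<omega> by (auto intro!: continuous_imp_measurable_on_sets_lebesgue intro: continuous_on_subset)
  have fm: "f \<in> borel_measurable ?M"
  proof -
    have "f \<in> borel_measurable (restrict_space (lebesgue_on {\<tau><..}) {c..d})" by (rule measurable_restrict_space1[OF f])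
    moreover have "restrict_space (lebesgue_on {\<tau><..}) {c..d} = ?M"
      using c by (subst restrict_restrict_space) (auto intro!: arg_cong2[where f = restrict_space])
    ultimately show ?thesis by simp
  qed
  have coefm: "(\<lambda>r. coef (u r) k) \<in> borel_measurable ?M" for k using um by measurable
  have sm: "(\<lambda>r. ser_A (u r)) \<in> borel_measurable ?M"
    unfolding ser_A_def by (intro borel_measurable_lim_metric borel_measurable_sum borel_measurable_scaleR
      borel_measurable_times borel_measurable_const coefm)
  have hm: "h \<in> borel_measurable ?M" unfolding h_def using um bm fm sm by measurable
  have \<Phi>m: "\<Phi> \<in> borel_measurable ?M" unfolding \<Phi>_def using coefm by measurable
  have eq: "(\<integral>\<^sup>+r. \<Phi> r \<partial>?M) = (\<integral>\<^sup>+r\<in>{c..d}. \<Phi> r \<partial>lebesgue)"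
    by (rule nn_integral_restrict_space) simp
  have nn: "(\<integral>\<^sup>+r. \<Phi> r \<partial>?M) < \<infinity>"
    unfolding eq unfolding \<Phi>_def by (rule mild_H2_nn_bound[OF mild c less_imp_le[OF cd] bd])
  have fin: "AE r in ?M. \<Phi> r < \<infinity>"
    using nn_integral_PInf_AE[OF \<Phi>m] nn by (auto simp: less_top elim: eventually_mono)
  then show dom: "AE r in ?M. u r \<in> dom_A"
    by eventually_elim (auto simp: \<Phi>_def intro: ser_A_finite)
  have "(\<integral>\<^sup>+r. ennreal ((norm (ser_A (u r)))\<^sup>2) \<partial>?M) = (\<integral>\<^sup>+r. \<Phi> r \<partial>?M)"
    by (rule nn_integral_cong_AE, use fin in eventually_elim) (simp add: \<Phi>_def ser_A_finite(4))
  then have a2: "integrable ?M (\<lambda>r. (norm (ser_A (u r)))\<^sup>2)"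
    using nn sm by (intro integrableI_bounded) auto
  have gb: "norm (b r *\<^sub>R f r + \<omega> r *\<^sub>R u r) \<le> G" if "r \<in> {c..d}" for r
    unfolding G_def using bd[of r] c that mild by (intro forcing_bound) (auto simp: mild_solution_def)
  have hb: "(norm (h r))\<^sup>2 \<le> 2 * G\<^sup>2 + 2 * (norm (ser_A (u r)))\<^sup>2" if "r \<in> {c..d}" for r
  proof -
    have "norm (h r) \<le> norm (b r *\<^sub>R f r + \<omega> r *\<^sub>R u r) + norm (ser_A (u r))"
      unfolding h_def by (rule norm_triangle_ineq4)
    also have "\<dots> \<le> G + norm (ser_A (u r))" using gb[OF that] by simp
    finally have "(norm (h r))\<^sup>2 \<le> (G + norm (ser_A (u r)))\<^sup>2" by (intro power_mono) auto
    also have "\<dots> \<le> 2 * G\<^sup>2 + 2 * (norm (ser_A (u r)))\<^sup>2"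
      using sum_squares_ge_zero[of "G - norm (ser_A (u r))" 0] by (simp add: power2_eq_square algebra_simps)
    finally show ?thesis .
  qed
  have h2: "integrable ?M (\<lambda>r. (norm (h r))\<^sup>2)"
  proof (rule Bochner_Integration.integrable_bound)
    show "integrable ?M (\<lambda>r. 2 * G\<^sup>2 + 2 * (norm (ser_A (u r)))\<^sup>2)" using a2 by simp
    show "(\<lambda>r. (norm (h r))\<^sup>2) \<in> borel_measurable ?M" using hm by measurable
    show "AE r in ?M. norm ((norm (h r))\<^sup>2) \<le> norm (2 * G\<^sup>2 + 2 * (norm (ser_A (u r)))\<^sup>2)"
      by (rule AE_I2) (use hb in auto)
  qed
  have ih: "integrable ?M h"
  proof (rule Bochner_Integration.integrable_bound)
    show "integrable ?M (\<lambda>r. 1 + (norm (h r))\<^sup>2)" using h2 by simp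
    show "h \<in> borel_measurable ?M" by (rule hm)
    have "x \<le> 1 + x\<^sup>2" for x :: real
      using zero_le_power2[of "2 * x - 1"] by (simp add: power2_eq_square algebra_simps)
    then show "AE r in ?M. norm (h r) \<le> norm (1 + (norm (h r))\<^sup>2)" by (intro AE_I2) auto
  qed
  have seth: "set_integrable lebesgue {c..d} h"
    using ih by (simp add: set_integrable_def integrable_restrict_space)
  have seth2: "set_integrable lebesgue {c..d} (\<lambda>r. (norm (h r))\<^sup>2)"
    using h2 by (simp add: set_integrable_def integrable_restrict_space)
  have aeh: "AE r in lebesgue. r \<in> {c..d} \<longrightarrow> \<Phi> r < \<infinity>"
    using fin by (subst (asm) AE_restrict_space_iff) auto
  have V: "u t - u s = (LINT r:{s..t}|lebesgue. h r)" if st: "c \<le> s" "s \<le> t" "t \<le> d" for s t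
  proof (rule l2_eqI)
    fix k
    have sub: "set_integrable lebesgue {s..t} h" using st by (intro set_integrable_subset[OF seth]) auto
    have "coef (LINT r:{s..t}|lebesgue. h r) k = (LINT r:{s..t}|lebesgue. coef (h r) k)"
      using integral_inner_left[of "sinb k" lebesgue "\<lambda>r. indicator {s..t} r *\<^sub>R h r"] sub
      unfolding set_lebesgue_integral_def set_integrable_def by simp
    moreover have sc: "set_integrable lebesgue {s..t} (\<lambda>r. coef (h r) k)"
      using integrable_inner_left[of "sinb k" lebesgue "\<lambda>r. indicator {s..t} r *\<^sub>R h r"] sub
      unfolding set_integrable_def by simp
    then have "(LINT r:{s..t}|lebesgue. coef (h r) k) = integral {s..t} (\<lambda>r. coef (h r) k)"
      by (rule set_lebesgue_integral_eq_integral)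
    moreover have "((\<lambda>r. coef (h r) k) has_integral coef (u t) k - coef (u s) k) {s..t}"
    proof -
      obtain N where N: "N \<in> null_sets lebesgue" "\<And>r. r \<notin> N \<Longrightarrow> r \<in> {c..d} \<longrightarrow> \<Phi> r < \<infinity>"
        using aeh unfolding eventually_ae_filter by auto
      have "((\<lambda>r. b r * coef (f r) k + \<omega> r * coef (u r) k - eig k * coef (u r) k) has_integral coef (u t) k - coef (u s) k) {s..t}"
        using mild st c by (simp add: mild_solution_def)
      then show ?thesis
      proof (rule has_integral_spike[rotated 2])
        show "negligible N" using N(1) by (simp add: negligible_iff_null_sets)
        fix r assume r: "r \<in> {s..t} - N"
        then have "\<Phi> r < \<infinity>" using N(2)[of r] st by auto
        then show "coef (h r) k = b r * coef (f r) k + \<omega> r * coef (u r) k - eig k * coef (u r) k"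
          by (simp add: h_def inner_diff_left inner_add_left ser_A_finite(3) \<Phi>_def)
      qed
    qed
    ultimately show "coef (u t - u s) k = coef (LINT r:{s..t}|lebesgue. h r) k"
      by (simp add: integral_unique inner_diff_left)
  qed
  obtain N where N: "negligible N" "\<And>x. x \<in> {c<..<d} - N \<Longrightarrow> (u has_vector_derivative h x) (at x)"
    using lebesgue_differentiation_banach[OF seth V] by blast
  have "AE r in lebesgue. r \<notin> N" using N(1) by (simp add: negligible_iff_null_sets AE_not_in)
  then show "AE r in lebesgue. c < r \<and> r < d \<longrightarrow>
      (u has_vector_derivative (b r *\<^sub>R f r + \<omega> r *\<^sub>R u r - op_A (u r))) (at r)"
    using aeh
  proof eventually_elim
    case (elim r)
    show ?case
    proof
      assume r: "c < r \<and> r < d"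
      then have "\<Phi> r < \<infinity>" using elim by simp
      then have "op_A (u r) = ser_A (u r)" unfolding \<Phi>_def by (rule ser_A_finite(2))
      then show "(u has_vector_derivative (b r *\<^sub>R f r + \<omega> r *\<^sub>R u r - op_A (u r))) (at r)"
        using N(2)[of r] r elim(1) by (simp add: h_def)
    qed
  qed
  define E where "E = (LINT r:{c..d}|lebesgue. (norm (h r))\<^sup>2)"
  show "abs_continuous_on_interval c d u"
    unfolding abs_continuous_on_interval_def
  proof (intro allI impI)
    fix \<epsilon> :: real assume \<epsilon>: "\<epsilon> > 0"
    \<comment> \<open>From the inequality
      \<open>norm (h x) \<le> m + (norm (h x))\<^sup>2 / m\<close>: for intervals of total length
      below \<open>\<epsilon> / (2 * m)\<close> the first term contributes less than
      \<open>\<epsilon> / 2\<close>, and this \<open>m\<close> makes the second contribute at most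
      \<open>\<epsilon> / 2\<close>.\<close>
    define m where "m = 2 * (\<bar>E\<bar> + 1) / \<epsilon>"
    have m: "m > 0" unfolding m_def using \<epsilon> by (intro divide_pos_pos) auto
    have "(\<Sum>i<n. dist (u (l i)) (u (r i))) < \<epsilon>"
      if *: "(\<forall>i<n. c \<le> l i \<and> l i \<le> r i \<and> r i \<le> d) \<and>
        (\<forall>i<n. \<forall>j<n. i \<noteq> j \<longrightarrow> {l i<..<r i} \<inter> {l j<..<r j} = {}) \<and> (\<Sum>i<n. r i - l i) < \<epsilon> / (2 * m)" for n :: nat and l r
    proof -
      define S where "S i = {l i<..<r i}" for i
      have lr: "c \<le> l i" "l i \<le> r i" "r i \<le> d" if "i < n" for i using * that by auto
      have subS: "set_integrable lebesgue (S i) (\<lambda>x. (norm (h x))\<^sup>2)" if "i < n" for i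
        using lr[OF that] by (intro set_integrable_subset[OF seth2]) (auto simp: S_def)
      have one: "dist (u (l i)) (u (r i)) \<le> m * (r i - l i) + (1 / m) * (LINT x:S i|lebesgue. (norm (h x))\<^sup>2)" if i: "i < n" for i
      proof -
        have sub: "set_integrable lebesgue {l i..r i} h" "set_integrable lebesgue {l i..r i} (\<lambda>x. (norm (h x))\<^sup>2)"
          using lr[OF i] by (auto intro: set_integrable_subset[OF seth] set_integrable_subset[OF seth2])
        have const: "set_integrable lebesgue {l i..r i} (\<lambda>x. m)"
          by (rule absolutely_integrable_on_const) auto
        have "dist (u (l i)) (u (r i)) = norm (u (r i) - u (l i))" by (metis dist_commute dist_norm)
        also have "\<dots> = norm (LINT x:{l i..r i}|lebesgue. h x)" by (simp only: V[OF lr[OF i]])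
        also have "\<dots> \<le> (LINT x:{l i..r i}|lebesgue. norm (h x))"
          by (rule set_integral_norm_bound[OF sub(1)])
        also have "\<dots> \<le> (LINT x:{l i..r i}|lebesgue. m + (1 / m) * (norm (h x))\<^sup>2)"
        proof (rule set_integral_mono)
          show "norm (h x) \<le> m + (1 / m) * (norm (h x))\<^sup>2" for x
          proof -
            have "0 \<le> (norm (h x) - m)\<^sup>2 + m * norm (h x)" using m by simp
            then have "m * norm (h x) \<le> m * m + (norm (h x))\<^sup>2" by (simp add: power2_eq_square algebra_simps)
            then show ?thesis using m by (simp add: field_simps)
          qed
        qed (use sub const in \<open>auto intro!: set_integral_add(1) set_integrable_norm\<close>)
        also have "\<dots> = (LINT x:{l i..r i}|lebesgue. m) + (1 / m) * (LINT x:{l i..r i}|lebesgue. (norm (h x))\<^sup>2)"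
          using sub(2) const by (subst set_integral_add(2)) auto
        also have "(LINT x:{l i..r i}|lebesgue. m) = m * (r i - l i)"
          using lr[OF i] by (subst set_integral_const) (auto simp: mult.commute)
        \<comment> \<open>Only the open intervals are disjoint; adjacent closed ones share an
          endpoint. Dropping the endpoints allows the integrals to be summed without
          overlap.\<close>
        also have "(LINT x:{l i..r i}|lebesgue. (norm (h x))\<^sup>2) = (LINT x:S i|lebesgue. (norm (h x))\<^sup>2)"
        proof -
          have "AE x in lebesgue. x \<notin> {l i, r i}"
            by (intro AE_not_in) (simp add: negligible_iff_null_sets[symmetric])
          then have "AE x in lebesgue. indicator {l i..r i} x *\<^sub>R (norm (h x))\<^sup>2 = indicator (S i) x *\<^sub>R (norm (h x))\<^sup>2"
            by eventually_elim (auto simp: S_def indicator_def)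
          moreover have "(\<lambda>x. indicator {l i..r i} x *\<^sub>R (norm (h x))\<^sup>2) \<in> borel_measurable lebesgue"
            "(\<lambda>x. indicator (S i) x *\<^sub>R (norm (h x))\<^sup>2) \<in> borel_measurable lebesgue"
            using sub(2) subS[OF i] unfolding set_integrable_def by auto
          ultimately show ?thesis unfolding set_lebesgue_integral_def by (intro integral_cong_AE)
        qed
        finally show ?thesis .
      qed
      have "(\<Sum>i<n. (LINT x:S i|lebesgue. (norm (h x))\<^sup>2)) = (LINT x|lebesgue. (\<Sum>i<n. indicator (S i) x *\<^sub>R (norm (h x))\<^sup>2))"
        unfolding set_lebesgue_integral_def using subS
        by (subst Bochner_Integration.integral_sum) (auto simp: set_integrable_def)
      also have "\<dots> \<le> E"
        unfolding E_def set_lebesgue_integral_def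
      proof (rule integral_mono)
        show "integrable lebesgue (\<lambda>x. \<Sum>i<n. indicator (S i) x *\<^sub>R (norm (h x))\<^sup>2)"
          using subS by (intro Bochner_Integration.integrable_sum) (auto simp: set_integrable_def)
        show "integrable lebesgue (\<lambda>x. indicator {c..d} x *\<^sub>R (norm (h x))\<^sup>2)"
          using seth2 by (simp add: set_integrable_def)
        fix x
        have "(\<Sum>i<n. indicator (S i) x) \<le> (indicator {c..d} x :: real)"
        proof (cases "\<exists>i<n. x \<in> S i")
          case True
          then obtain i where i: "i < n" "x \<in> S i" by blast
          have "x \<notin> S j" if "j < n" "j \<noteq> i" for j using * i that unfolding S_def by blast
          then have "(\<Sum>j<n. indicator (S j) x) = (\<Sum>j<n. if j = i then 1 else 0 :: real)"
            using i by (intro sum.cong) (auto simp: indicator_def)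
          also have "\<dots> = 1" using i by simp
          also have "\<dots> = indicator {c..d} x" using lr[OF i(1)] i(2) by (auto simp: S_def)
          finally show ?thesis by simp
        next
          case False
          then have "(\<Sum>i<n. indicator (S i) x) = (0::real)" by (intro sum.neutral) (auto simp: indicator_def)
          then show ?thesis by simp
        qed
        then show "(\<Sum>i<n. indicator (S i) x *\<^sub>R (norm (h x))\<^sup>2) \<le> indicator {c..d} x *\<^sub>R (norm (h x))\<^sup>2"
          unfolding scaleR_sum_left[symmetric] by (simp add: mult_right_mono)
      qed
      finally have sumE: "(\<Sum>i<n. (LINT x:S i|lebesgue. (norm (h x))\<^sup>2)) \<le> E" .
      have "(\<Sum>i<n. dist (u (l i)) (u (r i))) \<le> (\<Sum>i<n. m * (r i - l i) + (1 / m) * (LINT x:S i|lebesgue. (norm (h x))\<^sup>2))"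
        using one by (intro sum_mono) auto
      also have "\<dots> = m * (\<Sum>i<n. r i - l i) + (1 / m) * (\<Sum>i<n. (LINT x:S i|lebesgue. (norm (h x))\<^sup>2))"
        by (simp add: sum.distrib sum_distrib_left)
      also have "\<dots> < m * (\<epsilon> / (2 * m)) + (1 / m) * (\<bar>E\<bar> + 1)"
        using * m sumE by (intro add_strict_mono mult_strict_left_mono) auto
      also have "m * (\<epsilon> / (2 * m)) = \<epsilon> / 2" using m by simp
      also have "(1 / m) * (\<bar>E\<bar> + 1) = \<epsilon> / 2" unfolding m_def using \<epsilon> by (simp add: field_simps add_nonneg_eq_0_iff)
      finally show ?thesis by simp
    qed
    then show "\<exists>\<delta>>0. \<forall>(n::nat) l r. (\<forall>i<n. c \<le> l i \<and> l i \<le> r i \<and> r i \<le> d) \<and>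
        (\<forall>i<n. \<forall>j<n. i \<noteq> j \<longrightarrow> {l i<..<r i} \<inter> {l j<..<r j} = {}) \<and> (\<Sum>i<n. r i - l i) < \<delta> \<longrightarrow>
        (\<Sum>i<n. dist (u (l i)) (u (r i))) < \<epsilon>"
      using \<epsilon> m by (intro exI[of _ "\<epsilon> / (2 * m)"] conjI) auto
  qed
qed

text \<open>All clauses except the selection are local in time and come from regularity on compact
  intervals away from \<open>\<tau>\<close>. The selection passes from almost every section to
  almost every point of the strip.\<close>

lemma mild_imp_strong:
  assumes mild: "mild_solution b \<omega> \<tau> u f" and FV: "heaviside_pair \<tau> u f F V"
    and b: "continuous_on UNIV b" and \<omega>: "continuous_on UNIV \<omega>" and u: "continuous_on {\<tau>..} u"
    and f: "f \<in> borel_measurable (lebesgue_on {\<tau><..})"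
    and bd: "\<And>r. \<tau> < r \<Longrightarrow> \<bar>b r\<bar> \<le> b1 \<and> \<bar>\<omega> r\<bar> \<le> w1 \<and> norm (u r) \<le> R"
  shows "strong_solution b \<omega> \<tau> (u \<tau>) u"
proof -
  have ucd: "continuous_on {c..d} u" if "\<tau> < c" for c d
    using that by (intro continuous_on_subset[OF u]) auto
  have reg: "AE r in lebesgue_on {c..d}. u r \<in> dom_A"
    "AE r in lebesgue. c < r \<and> r < d \<longrightarrow> (u has_vector_derivative (b r *\<^sub>R f r + \<omega> r *\<^sub>R u r - op_A (u r))) (at r)"
    "abs_continuous_on_interval c d u" if "\<tau> < c" "c < d" for c d
    using mild_regularity[OF mild that b \<omega> ucd[OF that(1)] f bd] by blast+
  have dom: "AE t in lebesgue_on {T1<..<T2}. u t \<in> dom_A" if "\<tau> < T1" "T1 < T2" for T1 T2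
  proof -
    have "AE r in lebesgue. r \<in> {T1..T2} \<longrightarrow> u r \<in> dom_A"
      using reg(1)[OF that] by (subst (asm) AE_restrict_space_iff) auto
    then show ?thesis by (subst AE_restrict_space_iff) (auto elim: eventually_mono)
  qed
  have fL2: "f \<in> L2_loc \<tau>"
    unfolding L2_loc_def
  proof (intro CollectI conjI allI impI f)
    fix T1 T2 assume T: "\<tau> < T1" "T1 < T2"
    interpret fm: finite_measure "lebesgue_on {T1..T2}" by (rule finite_measure_lebesgue_on) auto
    have "f \<in> borel_measurable (restrict_space (lebesgue_on {\<tau><..}) {T1..T2})" by (rule measurable_restrict_space1[OF f])
    moreover have "restrict_space (lebesgue_on {\<tau><..}) {T1..T2} = lebesgue_on {T1..T2}"
      using T by (subst restrict_restrict_space) (auto intro!: arg_cong2[where f = restrict_space])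
    ultimately have fm: "f \<in> borel_measurable (lebesgue_on {T1..T2})" by simp
    have "integrable (lebesgue_on {T1..T2}) (\<lambda>t. (norm (f t))\<^sup>2)"
    proof (rule fm.integrable_const_bound[of _ 1])
      show "AE t in lebesgue_on {T1..T2}. norm ((norm (f t))\<^sup>2) \<le> 1"
        using mild by (intro AE_I2) (auto simp: mild_solution_def power_le_one)
    qed (use fm in measurable)
    then show "set_integrable lebesgue {T1..T2} (\<lambda>t. (norm (f t))\<^sup>2)"
      by (simp add: set_integrable_def integrable_restrict_space)
  qed
  have Fm: "F \<in> borel_measurable borel" and Vm: "V \<in> borel_measurable borel" and Fb: "\<And>p. \<bar>F p\<bar> \<le> 1"
    and ae: "AE t in lborel. \<tau> < t \<longrightarrow>
        (AE x in lborel. 0 < x \<and> x < 1 \<longrightarrow> F (t, x) \<in> heaviside (V (t, x))) \<and>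
        abs_l2 (\<lambda>x. F (t, x)) = f t \<and>
        square_integrable (\<lambda>x. V (t, x)) \<and> abs_l2 (\<lambda>x. V (t, x)) = u t"
    using FV unfolding heaviside_pair_def by blast+
  have bl: "g \<in> borel_measurable (lebesgue_on ({\<tau><..} \<times> {0<..<1}))" if "g \<in> borel_measurable borel" for g :: "real \<times> real \<Rightarrow> real"
    using that by (intro measurable_restrict_space1 measurable_completion) simp
  have sel: "heaviside_selection \<tau> u f"
    unfolding heaviside_selection_def
  proof (intro exI conjI)
    have "square_integrable (\<lambda>x. F (t, x))" for t by (rule square_integrable_section[OF Fm Fb])
    then show "joint_rep \<tau> f F"
      unfolding joint_rep_def AE_gt_iff using bl[OF Fm] ae by (auto elim!: eventually_mono)
    show "joint_rep \<tau> u V"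
      unfolding joint_rep_def AE_gt_iff using bl[OF Vm] ae by (auto elim!: eventually_mono)
    show "AE p in lebesgue_on ({\<tau><..} \<times> {0<..<1}). F p \<in> heaviside (V p)"
    proof (rule AE_sections_strip)
      show "AE t in lborel. \<tau> < t \<longrightarrow> (AE x in lborel. 0 < x \<and> x < 1 \<longrightarrow> F (t, x) \<in> heaviside (V (t, x)))"
        using ae by (auto elim!: eventually_mono)
      have eq: "F p \<in> heaviside (V p) \<longleftrightarrow> (V p < 0 \<and> F p = -1) \<or> (V p = 0 \<and> -1 \<le> F p \<and> F p \<le> 1) \<or> (0 < V p \<and> F p = 1)" for p
        by (auto simp: heaviside_def)
      show "Measurable.pred borel (\<lambda>p. F p \<in> heaviside (V p))"
        unfolding eq using Fm Vm by measurable
    qed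
  qed
  \<comment> \<open>Countably many intervals, with left ends decreasing to \<open>\<tau>\<close> and
    lengths tending to infinity, exhaust the open half-line, so one null set suffices.\<close>
  have "AE t in lebesgue. \<forall>n. \<tau> + 1 / real (Suc n) < t \<and> t < \<tau> + 1 / real (Suc n) + real (Suc n) \<longrightarrow>
      (u has_vector_derivative (b t *\<^sub>R f t + \<omega> t *\<^sub>R u t - op_A (u t))) (at t)"
    unfolding AE_all_countable by (intro allI reg(2)) auto
  then have "AE t in lborel. \<tau> < t \<longrightarrow>
      (u has_vector_derivative (b t *\<^sub>R f t + \<omega> t *\<^sub>R u t - op_A (u t))) (at t)"
    unfolding AE_completion_iff
  proof eventually_elim
    case (elim t)
    show ?case
    proof
      assume t: "\<tau> < t"
      obtain n1 where n1: "1 / real (Suc n1) < t - \<tau>" using nat_approx_posE[of "t - \<tau>"] t by auto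
      obtain n2 where n2: "t - \<tau> < real n2" using reals_Archimedean2 by blast
      define n where "n = max n1 n2"
      have "1 / real (Suc n) \<le> 1 / real (Suc n1)" by (intro divide_left_mono) (auto simp: n_def)
      moreover have "real n2 \<le> real n" by (simp add: n_def)
      moreover have "0 < 1 / real (Suc n)" by simp
      ultimately have "\<tau> + 1 / real (Suc n) < t" "t < \<tau> + 1 / real (Suc n) + real (Suc n)"
        using n1 n2 by linarith+
      then show "(u has_vector_derivative (b t *\<^sub>R f t + \<omega> t *\<^sub>R u t - op_A (u t))) (at t)"
        using elim by blast
    qed
  qed
  then have "AE t in lebesgue_on {\<tau><..}. \<exists>du. (u has_vector_derivative du) (at t) \<and> du + op_A (u t) = b t *\<^sub>R f t + \<omega> t *\<^sub>R u t"
    unfolding AE_gt_iff by eventually_elim (metis diff_add_cancel)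
  then show ?thesis
    unfolding strong_solution_def using u dom fL2 sel reg(3) by blast
qed

section \<open>Weak limits by convex combinations\<close>

text \<open>Parseval's sum is split at \<open>K\<close>: finitely many modes converge by assumption,
  and the remaining ones are uniformly small. This is how compactness in \<open>l2\<close> is
  obtained throughout.\<close>

lemma l2_convergent_from_coefficients:
  assumes tail: "\<And>\<epsilon>. \<epsilon> > 0 \<Longrightarrow> \<exists>K. \<forall>n L. (\<Sum>k\<in>{K..<L}. (coef (x n) k)\<^sup>2) \<le> \<epsilon>"
    and lim: "\<And>k. (\<lambda>n. coef (x n) k) \<longlonglongrightarrow> a k"
  obtains y where "x \<longlonglongrightarrow> y" "\<And>k. coef y k = a k"
proof -
  have "Cauchy x"
  proof (rule metric_CauchyI)
    fix e :: real assume e: "e > 0"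
    \<comment> \<open>The low modes contribute at most \<open>4 * \<epsilon>\<close> and the tails
      another \<open>4 * \<epsilon>\<close>; a ninth of \<open>e\<^sup>2\<close> keeps the total
      strictly below it.\<close>
    define \<epsilon> where "\<epsilon> = e\<^sup>2 / 9"
    have \<epsilon>: "\<epsilon> > 0" using e by (simp add: \<epsilon>_def)
    obtain K where K: "\<And>n L. (\<Sum>k\<in>{K..<L}. (coef (x n) k)\<^sup>2) \<le> \<epsilon>" using tail[OF \<epsilon>] by blast
    define S where "S n = (\<Sum>k<K. (coef (x n) k - a k)\<^sup>2)" for n
    have "S \<longlonglongrightarrow> (\<Sum>k<K. (a k - a k)\<^sup>2)" unfolding S_def by (intro tendsto_intros lim)
    then have "\<forall>\<^sub>F n in sequentially. S n < \<epsilon>" using \<epsilon> by (intro order_tendstoD(2)) auto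
    then obtain N where N: "\<And>n. n \<ge> N \<Longrightarrow> S n < \<epsilon>" by (auto simp: eventually_sequentially)
    have sq: "(p - q)\<^sup>2 \<le> 2 * p\<^sup>2 + 2 * q\<^sup>2" for p q :: real
      using zero_le_power2[of "p + q"] by (simp add: power2_eq_square algebra_simps)
    have "dist (x m) (x n) < e" if "m \<ge> N" "n \<ge> N" for m n
    proof -
      have "(\<Sum>k<L. (coef (x m - x n) k)\<^sup>2) \<le> 8 * \<epsilon>" if "L \<ge> K" for L
      proof -
        have "(\<Sum>k<L. (coef (x m - x n) k)\<^sup>2) = (\<Sum>k<K. (coef (x m - x n) k)\<^sup>2) + (\<Sum>k\<in>{K..<L}. (coef (x m - x n) k)\<^sup>2)"
          using sum.atLeastLessThan_concat[of 0 K L "\<lambda>k. (coef (x m - x n) k)\<^sup>2"] that by (simp add: atLeast0LessThan)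
        also have "(\<Sum>k<K. (coef (x m - x n) k)\<^sup>2) \<le> (\<Sum>k<K. 2 * (coef (x m) k - a k)\<^sup>2 + 2 * (coef (x n) k - a k)\<^sup>2)"
          using sq[of "coef (x m) k - a k" "coef (x n) k - a k" for k] by (intro sum_mono) (simp add: inner_diff_left)
        also have "\<dots> = 2 * S m + 2 * S n" by (simp add: S_def sum.distrib sum_distrib_left)
        also have "(\<Sum>k\<in>{K..<L}. (coef (x m - x n) k)\<^sup>2) \<le> (\<Sum>k\<in>{K..<L}. 2 * (coef (x m) k)\<^sup>2 + 2 * (coef (x n) k)\<^sup>2)"
          using sq[of "coef (x m) k" "coef (x n) k" for k] by (intro sum_mono) (simp add: inner_diff_left)
        also have "\<dots> = 2 * (\<Sum>k\<in>{K..<L}. (coef (x m) k)\<^sup>2) + 2 * (\<Sum>k\<in>{K..<L}. (coef (x n) k)\<^sup>2)"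
          by (simp add: sum.distrib sum_distrib_left)
        finally show ?thesis using K[of m L] K[of n L] N[OF \<open>m \<ge> N\<close>] N[OF \<open>n \<ge> N\<close>] by linarith
      qed
      then have "(norm (x m - x n))\<^sup>2 \<le> 8 * \<epsilon>"
        using sin_parseval[of "x m - x n"] unfolding sums_def by (intro LIMSEQ_le_const2) blast+
      also have "\<dots> < e\<^sup>2" using e by (simp add: \<epsilon>_def)
      finally show ?thesis using e unfolding dist_norm by (rule power2_less_imp_less[OF _ less_imp_le])
    qed
    then show "\<exists>M. \<forall>m\<ge>M. \<forall>n\<ge>M. dist (x m) (x n) < e" by blast
  qed
  then obtain y where y: "x \<longlonglongrightarrow> y" by (auto simp: Cauchy_convergent_iff convergent_def)
  have "coef y k = a k" for k
    by (rule LIMSEQ_unique[OF _ lim]) (intro tendsto_intros y)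
  with y show ?thesis using that by blast
qed

subsection \<open>Midpoint combinations of tails\<close>

text \<open>For Mazur's argument the dyadic convex combinations of a tail are enough, because only
  midpoints enter the parallelogram law.\<close>

inductive_set midpoints :: "(nat \<Rightarrow> 'a \<Rightarrow> real) \<Rightarrow> nat \<Rightarrow> ('a \<Rightarrow> real) set" for F n where
  base: "n \<le> i \<Longrightarrow> F i \<in> midpoints F n"
| mid: "g \<in> midpoints F n \<Longrightarrow> h \<in> midpoints F n \<Longrightarrow> (\<lambda>p. (g p + h p) / 2) \<in> midpoints F n"

lemma midpoints_antimono:
  assumes "m \<le> n" "g \<in> midpoints F n"
  shows "g \<in> midpoints F m"
  using assms(2) by induction (use assms(1) in \<open>auto intro: midpoints.intros\<close>)

lemma midpoints_measurable:
  assumes "g \<in> midpoints F n" "\<And>i. F i \<in> borel_measurable M"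
  shows "g \<in> borel_measurable M"
  using assms(1) by induction (use assms(2) in auto)

text \<open>Convexity of an interval. With \<open>c = 0\<close> and \<open>B = 1\<close> it
  preserves the uniform bound; with \<open>B = 0\<close> it preserves an exact common value of the
  tail.\<close>

lemma midpoints_abs_le:
  assumes "g \<in> midpoints F n" "\<And>i. n \<le> i \<Longrightarrow> \<bar>F i p - c\<bar> \<le> B"
  shows "\<bar>g p - c\<bar> \<le> B"
  using assms(1)
proof induction
  case (mid g h)
  have eq: "(g p + h p) / 2 - c = ((g p - c) + (h p - c)) / 2" by (simp add: field_simps)
  have "\<bar>(g p + h p) / 2 - c\<bar> = \<bar>(g p - c) + (h p - c)\<bar> / 2" unfolding eq by simp
  also have "\<dots> \<le> (\<bar>g p - c\<bar> + \<bar>h p - c\<bar>) / 2" by (intro divide_right_mono abs_triangle_ineq) simp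
  also have "\<dots> \<le> (B + B) / 2" by (intro divide_right_mono add_mono mid.IH) simp
  finally show ?case by simp
qed (use assms(2) in auto)

text \<open>The infimum \<open>d n\<close> of the squared norm over combinations of the
  \<open>n\<close>-th tail increases with \<open>n\<close> to a finite limit. Almost minimisers
  \<open>c n\<close> are close to each other by the parallelogram law, because the midpoint of two
  of them still belongs to the tail and cannot have squared norm below \<open>d N\<close>. No weak
  limit has to be named.\<close>

lemma (in finite_measure) L2_Cauchy_midpoints:
  assumes F: "\<And>i. F i \<in> borel_measurable M" "\<And>i x. \<bar>F i x\<bar> \<le> 1"
  obtains c where "\<And>n. c n \<in> midpoints F n"
    "\<And>e. e > 0 \<Longrightarrow> \<exists>N. \<forall>i\<ge>N. \<forall>j\<ge>N. (LINT x|M. (c i x - c j x)\<^sup>2) < e"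
proof -
  define Q where "Q g = (LINT x|M. (g x)\<^sup>2)" for g :: "'a \<Rightarrow> real"
  have gm: "g \<in> borel_measurable M" and gb: "\<bar>g x\<bar> \<le> 1" if "g \<in> midpoints F n" for g n x
    using midpoints_measurable[OF that F(1)] midpoints_abs_le[OF that, of x 0 1] F(2) by auto
  have int: "integrable M (\<lambda>x. g x * h x)" if "g \<in> midpoints F n" "h \<in> midpoints F m" for g h n m
  proof (rule integrable_const_bound[of _ 1])
    show "AE x in M. norm (g x * h x) \<le> 1"
      using gb[OF that(1)] gb[OF that(2)] by (intro AE_I2) (auto simp: abs_mult intro!: mult_le_one)
  qed (use gm that in auto)
  define d where "d n = Inf (Q ` midpoints F n)" for n
  have Q0: "0 \<le> Q g" for g by (simp add: Q_def)
  have bdd: "bdd_below (Q ` midpoints F n)" for n using Q0 by (auto intro!: bdd_belowI)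
  have ne: "midpoints F n \<noteq> {}" for n using midpoints.base[of n n F] by auto
  have dle: "d n \<le> Q g" if "g \<in> midpoints F n" for n g
    unfolding d_def using that bdd by (intro cInf_lower) auto
  have dmono: "d m \<le> d n" if "m \<le> n" for m n
    unfolding d_def
  proof (rule cInf_superset_mono)
    show "Q ` midpoints F n \<subseteq> Q ` midpoints F m" using midpoints_antimono[OF that] by blast
  qed (use ne bdd in auto)
  have "Q (F n) \<le> measure M (space M)" for n
  proof -
    have "Q (F n) \<le> (LINT x|M. 1)" unfolding Q_def
    proof (rule integral_mono)
      show "integrable M (\<lambda>x. (F n x)\<^sup>2)" using int[OF midpoints.base midpoints.base, of n n n n] by (simp add: power2_eq_square)
      show "(F n x)\<^sup>2 \<le> 1" for x using F(2)[of n x] by (simp add: abs_square_le_1)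
    qed simp
    then show ?thesis by simp
  qed
  then have dub: "d n \<le> measure M (space M)" for n using dle[OF midpoints.base, of n n] order_trans by blast
  have "convergent d"
    using dmono dub by (intro Bseq_mono_convergent BseqI'[where K = "measure M (space M)"])
      (auto simp: abs_le_iff d_def intro!: order_trans[OF _ measure_nonneg] dub[unfolded d_def] cInf_greatest simp: ne Q0)
  then obtain D where D: "d \<longlonglongrightarrow> D" by (auto simp: convergent_def)
  have "\<exists>g\<in>midpoints F n. Q g < d n + 1 / real (Suc n)" for n
  proof -
    have "Inf (Q ` midpoints F n) < d n + 1 / real (Suc n)" by (simp add: d_def)
    then show ?thesis using cInf_lessD[of "Q ` midpoints F n"] ne by auto
  qed
  then obtain c where c: "\<And>n. c n \<in> midpoints F n" "\<And>n. Q (c n) < d n + 1 / real (Suc n)" by metis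
  have par: "(LINT x|M. (g x - h x)\<^sup>2) = 2 * Q g + 2 * Q h - 4 * Q (\<lambda>x. (g x + h x) / 2)"
    if g: "g \<in> midpoints F n" and h: "h \<in> midpoints F m" for g h n m
  proof -
    have "(LINT x|M. (g x - h x)\<^sup>2) + 4 * Q (\<lambda>x. (g x + h x) / 2)
        = (LINT x|M. g x * g x - 2 * (g x * h x) + h x * h x) + (LINT x|M. g x * g x + 2 * (g x * h x) + h x * h x)"
      unfolding Q_def by (subst integral_mult_right_zero[symmetric])
        (intro arg_cong2[where f = "(+)"] Bochner_Integration.integral_cong; simp add: power2_eq_square algebra_simps add_divide_distrib)
    also have "\<dots> = 2 * Q g + 2 * Q h"
      using int[OF g g] int[OF g h] int[OF h h] by (simp add: Q_def power2_eq_square)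
    finally show ?thesis by simp
  qed
  show ?thesis
  proof (rule that[OF c(1)])
    fix e :: real assume e: "e > 0"
    have "(\<lambda>n. 4 * (D + 1 / real (Suc n)) - 4 * d n) \<longlonglongrightarrow> 4 * (D + 0) - 4 * D"
      using LIMSEQ_inverse_real_of_nat by (intro tendsto_intros D) (simp add: inverse_eq_divide)
    then have "\<forall>\<^sub>F n in sequentially. 4 * (D + 1 / real (Suc n)) - 4 * d n < e"
      using e by (intro order_tendstoD(2)) auto
    then obtain N where N: "4 * (D + 1 / real (Suc N)) - 4 * d N < e" by (auto simp: eventually_sequentially)
    have dD: "d n \<le> D" for n by (rule incseq_le[OF _ D]) (use dmono in \<open>auto simp: incseq_def\<close>)
    have "(LINT x|M. (c i x - c j x)\<^sup>2) < e" if ij: "i \<ge> N" "j \<ge> N" for i j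
    proof -
      have cN: "c i \<in> midpoints F N" "c j \<in> midpoints F N" using c(1) midpoints_antimono ij by blast+
      define \<eta> where "\<eta> = 1 / real (Suc N)"
      have "1 / real (Suc i) \<le> \<eta>" "1 / real (Suc j) \<le> \<eta>"
        unfolding \<eta>_def using ij by (auto intro!: divide_left_mono)
      then have "Q (c i) \<le> D + \<eta>" "Q (c j) \<le> D + \<eta>"
        using c(2)[of i] c(2)[of j] dD[of i] dD[of j] by linarith+
      moreover define q where "q = Q (\<lambda>x. (c i x + c j x) / 2)"
      moreover have "d N \<le> q" unfolding q_def by (rule dle[OF midpoints.mid[OF cN]])
      ultimately show ?thesis unfolding par[OF cN] q_def[symmetric] using N[folded \<eta>_def]
        by (simp add: algebra_simps)
    qed
    then show "\<exists>N. \<forall>i\<ge>N. \<forall>j\<ge>N. (LINT x|M. (c i x - c j x)\<^sup>2) < e" by blast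
  qed
qed

text \<open>Finite measure gives Cauchy in L^1 and hence a subsequence that is Cauchy almost
  everywhere. Passing to it does no harm: combinations of a later tail are combinations of the
  earlier ones.\<close>

lemma (in finite_measure) midpoints_AE_Cauchy:
  assumes F: "\<And>i. F i \<in> borel_measurable M" "\<And>i x. \<bar>F i x\<bar> \<le> 1"
  obtains c where "\<And>n. c n \<in> midpoints F n" "AE x in M. Cauchy (\<lambda>n. c n x)"
proof -
  obtain c where c: "\<And>n. c n \<in> midpoints F n"
    and C: "\<And>e. e > 0 \<Longrightarrow> \<exists>N. \<forall>i\<ge>N. \<forall>j\<ge>N. (LINT x|M. (c i x - c j x)\<^sup>2) < e"
    by (rule L2_Cauchy_midpoints[OF F]) (rule that)
  have cm: "c n \<in> borel_measurable M" for n by (rule midpoints_measurable[OF c F(1)])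
  have cb: "\<bar>c n x\<bar> \<le> 1" for n x
  proof -
    have "\<bar>c n x - 0\<bar> \<le> 1" by (rule midpoints_abs_le[OF c]) (use F(2) in simp)
    then show ?thesis by simp
  qed
  have i1: "integrable M (c n)" for n
    by (rule integrable_const_bound[of _ 1]) (simp_all add: cm cb)
  have i2: "integrable M (\<lambda>x. (c i x - c j x)\<^sup>2)" for i j
  proof (rule integrable_const_bound[of _ 4])
    have "\<bar>c i x - c j x\<bar>\<^sup>2 \<le> 2\<^sup>2" for x using cb[of i x] cb[of j x] by (intro power_mono) auto
    then show "AE x in M. norm ((c i x - c j x)\<^sup>2) \<le> 4" by simp
  qed (use cm in auto)
  obtain r where r: "strict_mono r" "AE x in M. Cauchy (\<lambda>n. c (r n) x)"
  proof (rule cauchy_L1_AE_cauchy_subseq[OF i1])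
    fix e :: real assume e: "e > 0"
    \<comment> \<open>In \<open>norm z \<le> \<delta> + z\<^sup>2 / \<delta>\<close> the constant
      integrates to less than \<open>e / 2\<close> by this choice, and squares with integral below
      \<open>\<delta> * e / 2\<close> supply the other half.\<close>
    define \<delta> where "\<delta> = e / (2 * (measure M (space M) + 1))"
    have \<delta>: "\<delta> > 0" unfolding \<delta>_def using e by (intro divide_pos_pos) (auto simp: add_nonneg_pos)
    obtain N where N: "\<And>i j. i \<ge> N \<Longrightarrow> j \<ge> N \<Longrightarrow> (LINT x|M. (c i x - c j x)\<^sup>2) < \<delta> * e / 2"
      using C[of "\<delta> * e / 2"] \<delta> e by auto
    have "(LINT x|M. norm (c i x - c j x)) < e" if "i \<ge> N" "j \<ge> N" for i j
    proof -
      have "(LINT x|M. norm (c i x - c j x)) \<le> (LINT x|M. \<delta> + (1 / \<delta>) * (c i x - c j x)\<^sup>2)"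
      proof (rule integral_mono)
        fix x
        let ?z = "norm (c i x - c j x)"
        have "0 \<le> (?z - \<delta>)\<^sup>2 + \<delta> * ?z" using \<delta> by simp
        then have "\<delta> * ?z \<le> \<delta> * \<delta> + (c i x - c j x)\<^sup>2" by (simp add: power2_eq_square algebra_simps)
        then show "?z \<le> \<delta> + (1 / \<delta>) * (c i x - c j x)\<^sup>2" using \<delta> by (simp add: field_simps)
      qed (use i1 i2 in auto)
      also have "\<dots> = \<delta> * measure M (space M) + (1 / \<delta>) * (LINT x|M. (c i x - c j x)\<^sup>2)"
        using i2 by simp
      also have "\<dots> < \<delta> * (measure M (space M) + 1) + (1 / \<delta>) * (\<delta> * e / 2)"
        using N[OF that] \<delta> by (intro add_strict_mono mult_strict_left_mono) auto
      also have "\<dots> = e"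
      proof -
        have half: "e / (2 * D) * D = e / 2" if "D > 0" for D using that by simp
        have "\<delta> * (measure M (space M) + 1) = e / 2"
          unfolding \<delta>_def by (rule half) (simp add: add_nonneg_pos)
        then show ?thesis using \<delta> by simp
      qed
      finally show ?thesis .
    qed
    then show "\<exists>N. \<forall>i\<ge>N. \<forall>j\<ge>N. (LINT x|M. norm (c i x - c j x)) < e" by blast
  qed
  have "c (r n) \<in> midpoints F n" for n
    by (rule midpoints_antimono[OF seq_suble[OF r(1)] c])
  with r(2) show ?thesis using that[of "\<lambda>n. c (r n)"] by blast
qed

subsection \<open>A finite measure on the space-time strip\<close>

text \<open>The exponential weight makes the measure of the infinite strip finite, so that convergence in
  \<open>L\<^sup>2\<close> implies convergence in \<open>L\<^sup>1\<close>.\<close>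

definition time_measure :: "real measure" where
  "time_measure = density lborel (\<lambda>t. ennreal (indicator {0..} t * exp (- t)))"

text \<open>Built on \<open>lborel\<close> instead of \<open>unit_measure\<close>: the product
  sigma-algebra on the strip is then the Borel one.\<close>

definition space_measure :: "real measure" where
  "space_measure = density lborel (indicator {0<..<1})"

abbreviation strip_measure :: "(real \<times> real) measure" where
  "strip_measure \<equiv> time_measure \<Otimes>\<^sub>M space_measure"

lemma AE_time_measure: "(AE t in time_measure. P t) \<longleftrightarrow> (AE t in lborel. 0 < t \<longrightarrow> P t)"
proof -
  have ne: "AE t in lborel. t \<noteq> (0::real)" by (rule AE_lborel_singleton)
  have "(AE t in lborel. 0 \<le> t \<longrightarrow> P t) \<longleftrightarrow> (AE t in lborel. 0 < t \<longrightarrow> P t)"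
  proof
    assume "AE t in lborel. 0 \<le> t \<longrightarrow> P t"
    then show "AE t in lborel. 0 < t \<longrightarrow> P t" by eventually_elim auto
  next
    assume "AE t in lborel. 0 < t \<longrightarrow> P t"
    then show "AE t in lborel. 0 \<le> t \<longrightarrow> P t" using ne by eventually_elim auto
  qed
  then show ?thesis
    unfolding time_measure_def by (subst AE_density) (auto simp: indicator_def)
qed

lemma AE_space_measure: "(AE x in space_measure. P x) \<longleftrightarrow> (AE x in lborel. 0 < x \<and> x < 1 \<longrightarrow> P x)"
  unfolding space_measure_def by (subst AE_density) (auto simp: indicator_def)

lemma finite_time_measure: "finite_measure time_measure"
proof
  have "emeasure time_measure (space time_measure) = (\<integral>\<^sup>+t. ennreal (indicator {0..} t * exp (- t)) \<partial>lborel)"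
    unfolding time_measure_def by (subst emeasure_density) (auto intro!: nn_integral_cong)
  also have "\<dots> = ennreal 1"
    by (rule nn_integral_has_integral_lebesgue) (use has_integral_exp_minus_to_infinity[of 1 0] in auto)
  finally show "emeasure time_measure (space time_measure) \<noteq> \<infinity>" by simp
qed

lemma finite_space_measure: "finite_measure space_measure"
  by standard (simp add: space_measure_def emeasure_density)

lemma finite_strip_measure: "finite_measure strip_measure"
proof
  interpret T: finite_measure time_measure by (rule finite_time_measure)
  interpret S: finite_measure space_measure by (rule finite_space_measure)
  have "emeasure strip_measure (space strip_measure) = emeasure time_measure (space time_measure) * emeasure space_measure (space space_measure)"
    unfolding space_pair_measure by (rule S.emeasure_pair_measure_Times) auto
  then show "emeasure strip_measure (space strip_measure) \<noteq> \<infinity>"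
    using T.emeasure_finite S.emeasure_finite by (simp add: ennreal_mult_eq_top_iff)
qed

lemma sets_strip: "sets strip_measure = sets borel"
proof -
  have "sets strip_measure = sets (borel \<Otimes>\<^sub>M borel)"
    by (rule sets_pair_measure_cong) (simp_all add: time_measure_def space_measure_def)
  then show ?thesis unfolding borel_prod .
qed

lemma measurable_strip: "f \<in> borel_measurable strip_measure \<longleftrightarrow> f \<in> borel_measurable borel"
  using measurable_cong_sets[OF sets_strip refl] by blast

lemma space_strip: "space strip_measure = UNIV"
  by (simp add: space_pair_measure time_measure_def space_measure_def)

lemma AE_strip_measure_sections:
  assumes "AE p in strip_measure. P p"
  shows "AE t in lborel. 0 < t \<longrightarrow> (AE x in lborel. 0 < x \<and> x < 1 \<longrightarrow> P (t, x))"
proof -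
  interpret T: finite_measure time_measure by (rule finite_time_measure)
  interpret S: finite_measure space_measure by (rule finite_space_measure)
  interpret pair_sigma_finite time_measure space_measure ..
  show ?thesis using AE_pair[OF assms] by (simp only: AE_time_measure AE_space_measure)
qed

lemma AE_sections_strip_measure:
  assumes "AE t in lborel. 0 < t \<longrightarrow> (AE x in lborel. 0 < x \<and> x < 1 \<longrightarrow> P (t, x))"
    and P: "Measurable.pred borel P"
  shows "AE p in strip_measure. P p"
proof -
  interpret T: finite_measure time_measure by (rule finite_time_measure)
  interpret S: finite_measure space_measure by (rule finite_space_measure)
  interpret pair_sigma_finite time_measure space_measure ..
  show ?thesis
  proof (rule AE_pair_measure)
    show "{p \<in> space strip_measure. P p} \<in> sets strip_measure"
      using P unfolding sets_strip space_strip by (simp add: pred_def)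
    show "AE t in time_measure. AE x in space_measure. P (t, x)"
      using assms(1) by (simp only: AE_time_measure AE_space_measure)
  qed
qed

text \<open>Cauchy-Schwarz against the constant 1, whose norm is 1. It transfers bounds in
  \<open>l2\<close> at fixed times to L^1 bounds on the strip.\<close>

lemma nn_integral_space_measure_le:
  assumes g: "g \<in> borel_measurable borel" and sg: "square_integrable g"
  shows "(\<integral>\<^sup>+x. ennreal \<bar>g x\<bar> \<partial>space_measure) \<le> ennreal (norm (abs_l2 g))"
proof -
  have one: "square_integrable (\<lambda>_. 1)" by (rule square_integrable_continuous) auto
  have sa: "square_integrable (\<lambda>x. \<bar>g x\<bar>)" using sg by (auto simp: square_integrable_def)
  have i: "integrable unit_measure (\<lambda>x. \<bar>g x\<bar>)" using square_integrable_mult[OF sa one] by simp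
  have n1: "norm (abs_l2 (\<lambda>_. 1)) = 1"
  proof (rule power2_eq_imp_eq[OF _ norm_ge_zero])
    show "(norm (abs_l2 (\<lambda>_. 1)))\<^sup>2 = 1\<^sup>2" using norm_abs_l2[OF one] measure_unit by simp
  qed simp
  have na: "norm (abs_l2 (\<lambda>x. \<bar>g x\<bar>)) = norm (abs_l2 g)"
    by (rule power2_eq_imp_eq[OF _ norm_ge_zero norm_ge_zero]) (simp add: norm_abs_l2[OF sa] norm_abs_l2[OF sg])
  have "(\<integral>\<^sup>+x. ennreal \<bar>g x\<bar> \<partial>space_measure) = (\<integral>\<^sup>+x. ennreal \<bar>g x\<bar> * indicator {0<..<1} x \<partial>lborel)"
    unfolding space_measure_def using g by (subst nn_integral_density) (auto simp: mult.commute)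
  also have "\<dots> = (\<integral>\<^sup>+x. ennreal \<bar>g x\<bar> \<partial>unit_measure)"
    by (subst nn_integral_restrict_space) (auto simp: nn_integral_completion)
  also have "\<dots> = ennreal (LINT x|unit_measure. \<bar>g x\<bar>)"
    by (rule nn_integral_eq_integral[OF i]) simp
  also have "(LINT x|unit_measure. \<bar>g x\<bar>) = inner (abs_l2 (\<lambda>x. \<bar>g x\<bar>)) (abs_l2 (\<lambda>_. 1))"
    by (simp add: inner_abs[OF sa one])
  also have "\<dots> \<le> norm (abs_l2 g)"
    using norm_cauchy_schwarz[of "abs_l2 (\<lambda>x. \<bar>g x\<bar>)" "abs_l2 (\<lambda>_. 1)"] by (simp add: n1 na)
  finally show ?thesis by (simp add: ennreal_leI)
qed

subsection \<open>Sections of functions on the strip\<close>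

text \<open>For a bounded Borel \<open>F\<close> the section is square integrable at every time, so
  no exceptional null set accompanies it.\<close>

definition sect :: "(real \<times> real \<Rightarrow> real) \<Rightarrow> real \<Rightarrow> l2" where
  "sect F t = abs_l2 (\<lambda>x. F (t, x))"

lemma coef_sect:
  assumes F: "F \<in> borel_measurable borel" "\<And>p. \<bar>F p\<bar> \<le> 1"
  shows "coef (sect F t) k = (LINT x|unit_measure. F (t, x) * sinf k x)"
  unfolding sect_def sinb_def by (rule inner_abs[OF square_integrable_section[OF F] square_integrable_sinf])

lemma norm_sect_le:
  assumes F: "F \<in> borel_measurable borel" "\<And>p. \<bar>F p\<bar> \<le> 1"
  shows "norm (sect F t) \<le> 1"
  unfolding sect_def
  by (rule norm_abs_l2_bounded[OF borel_imp_unit_measurable[OF borel_section[OF F(1)]] F(2)])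

lemma coef_sect_measurable:
  assumes F: "F \<in> borel_measurable borel" "\<And>p. \<bar>F p\<bar> \<le> 1"
  shows "(\<lambda>t. coef (sect F t) k) \<in> borel_measurable borel"
proof -
  have sm: "sinf k \<in> borel_measurable borel"
    by (intro borel_measurable_continuous_onI continuous_sinf)
  have eq: "coef (sect F t) k = (LINT x|lborel. indicator {0<..<1} x * (F (t, x) * sinf k x))" for t
  proof -
    have m: "(\<lambda>x. indicator {0<..<1} x *\<^sub>R (F (t, x) * sinf k x)) \<in> borel_measurable lborel"
      using borel_section[OF F(1), of t] sm by simp
    show ?thesis
      unfolding coef_sect[OF F] by (subst integral_restrict_space) (use integral_completion[OF m] in auto)
  qed
  have "(\<lambda>(t, x). indicator {0<..<1} x * (F (t, x) * sinf k x)) \<in> borel_measurable (borel \<Otimes>\<^sub>M lborel)"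
  proof -
    have "F \<in> borel_measurable (borel \<Otimes>\<^sub>M borel)" using F(1) by (simp add: borel_prod)
    then show ?thesis using sm by (simp add: case_prod_beta')
  qed
  then show ?thesis unfolding eq by (rule lborel.borel_measurable_lebesgue_integral)
qed

text \<open>Each coefficient is a parameter integral, measurable by Fubini; the sine expansion
  assembles the \<open>l2\<close>-valued function as a limit.\<close>

lemma sect_measurable:
  assumes F: "F \<in> borel_measurable borel" "\<And>p. \<bar>F p\<bar> \<le> 1"
  shows "sect F \<in> borel_measurable borel"
proof (rule borel_measurable_LIMSEQ_metric)
  show "(\<lambda>t. \<Sum>k<n. coef (sect F t) k *\<^sub>R sinb k) \<in> borel_measurable borel" for n
    by (intro borel_measurable_sum borel_measurable_scaleR borel_measurable_const coef_sect_measurable[OF F])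
  show "(\<lambda>n. \<Sum>k<n. coef (sect F t) k *\<^sub>R sinb k) \<longlonglongrightarrow> sect F t" for t
    by (rule sin_expansion)
qed

lemma integrable_coef_sect:
  assumes F: "F \<in> borel_measurable borel" "\<And>p. \<bar>F p\<bar> \<le> 1"
  shows "set_integrable lborel {s..t} (\<lambda>r. coef (sect F r) k)"
  unfolding set_integrable_def
proof (rule Bochner_Integration.integrable_bound)
  show "integrable lborel (\<lambda>r. indicator {s..t} r :: real)"
    by (rule integrable_real_indicator) (auto simp: emeasure_lborel_Icc_eq)
  show "(\<lambda>r. indicator {s..t} r *\<^sub>R coef (sect F r) k) \<in> borel_measurable lborel"
    using coef_sect_measurable[OF F, of k] by simp
  have "\<bar>coef (sect F r) k\<bar> \<le> 1" for r
    by (rule order_trans[OF abs_coef_le norm_sect_le[OF F]])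
  then show "AE r in lborel. norm (indicator {s..t} r *\<^sub>R coef (sect F r) k) \<le> norm (indicator {s..t} r :: real)"
    by (intro AE_I2) (auto simp: indicator_def)
qed

lemma sect_midpoint:
  assumes F: "F \<in> borel_measurable borel" "\<And>p. \<bar>F p\<bar> \<le> 1" and G: "G \<in> borel_measurable borel" "\<And>p. \<bar>G p\<bar> \<le> 1"
  shows "sect (\<lambda>p. (F p + G p) / 2) t = (1/2) *\<^sub>R (sect F t + sect G t)"
  unfolding sect_def using square_integrable_section[OF F] square_integrable_section[OF G]
  by (simp add: add_abs scale_abs square_integrable_add add_divide_distrib)

text \<open>The forcing is replaced by sections of its Borel representative. From here on the
  selection is a function on the strip, on which convex combinations can be formed.\<close>

lemma mild_sect:
  assumes mild: "mild_solution b \<omega> \<tau> u f" and FV: "heaviside_pair \<tau> u f F V"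
  shows "mild_solution b \<omega> \<tau> u (sect F)"
proof -
  have F: "F \<in> borel_measurable borel" "\<And>p. \<bar>F p\<bar> \<le> 1"
    and ae: "AE t in lborel. \<tau> < t \<longrightarrow> abs_l2 (\<lambda>x. F (t, x)) = f t"
    using FV by (auto simp: heaviside_pair_def elim: eventually_mono)
  have "AE t in lebesgue. \<tau> < t \<longrightarrow> sect F t = f t"
    unfolding AE_completion_iff sect_def using ae .
  then obtain N where N: "N \<in> null_sets lebesgue" "\<And>t. t \<notin> N \<Longrightarrow> \<tau> < t \<longrightarrow> sect F t = f t"
    unfolding eventually_ae_filter by auto
  have neg: "negligible N" using N(1) by (simp add: negligible_iff_null_sets)
  show ?thesis
    unfolding mild_solution_def
  proof (intro conjI allI impI norm_sect_le[OF F])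
    fix k s t assume st: "\<tau> < s" "s \<le> t"
    then have "((\<lambda>r. b r * coef (f r) k + \<omega> r * coef (u r) k - eig k * coef (u r) k) has_integral coef (u t) k - coef (u s) k) {s..t}"
      using mild by (simp add: mild_solution_def)
    then show "((\<lambda>r. b r * coef (sect F r) k + \<omega> r * coef (u r) k - eig k * coef (u r) k) has_integral coef (u t) k - coef (u s) k) {s..t}"
      by (rule has_integral_spike[OF neg, rotated]) (use N(2) st in auto)
  qed
qed

section \<open>Limits of sequences of solutions\<close>

text \<open>The solutions start at time \<open>-2\<close>, although only their limit on \<open>[0,\<infinity>)\<close> is of interest: smoothing
  during the preceding unit of time provides the compactness at time \<open>0\<close>.\<close>

locale solution_sequence =
  fixes b w :: "nat \<Rightarrow> real \<Rightarrow> real" and b0 w0 b1 w1 R :: real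
    and u f :: "nat \<Rightarrow> real \<Rightarrow> l2" and F V :: "nat \<Rightarrow> real \<times> real \<Rightarrow> real"
  assumes mild: "\<And>n. mild_solution (b n) (w n) (-2) (u n) (f n)"
    and pair: "\<And>n. heaviside_pair (-2) (u n) (f n) (F n) (V n)"
    and cont_u: "\<And>n. continuous_on {-2<..} (u n)"
    and bd: "\<And>n r. -2 < r \<Longrightarrow> \<bar>b n r\<bar> \<le> b1 \<and> \<bar>w n r\<bar> \<le> w1 \<and> norm (u n r) \<le> R"
    and lim_b: "\<And>r. 0 \<le> r \<Longrightarrow> (\<lambda>n. b n r) \<longlonglongrightarrow> b0"
    and lim_w: "\<And>r. 0 \<le> r \<Longrightarrow> (\<lambda>n. w n r) \<longlonglongrightarrow> w0"
begin

lemma subsequence: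
  assumes r: "strict_mono r"
  shows "solution_sequence (\<lambda>n. b (r n)) (\<lambda>n. w (r n)) b0 w0 b1 w1 R (\<lambda>n. u (r n)) (\<lambda>n. f (r n)) (\<lambda>n. F (r n)) (\<lambda>n. V (r n))"
  by standard (use mild pair cont_u bd LIMSEQ_subseq_LIMSEQ[OF lim_b r] LIMSEQ_subseq_LIMSEQ[OF lim_w r] in \<open>auto simp: o_def\<close>)

lemma bounds_nonneg: "0 \<le> b1" "0 \<le> w1" "0 \<le> R"
proof -
  have "\<bar>b 0 0\<bar> \<le> b1" "\<bar>w 0 0\<bar> \<le> w1" "norm (u 0 0) \<le> R" using bd[of 0 0] by auto
  then show "0 \<le> b1" "0 \<le> w1" "0 \<le> R" using norm_ge_zero[of "u 0 0"] by linarith+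
qed

lemma limit_bounds: "\<bar>b0\<bar> \<le> b1" "\<bar>w0\<bar> \<le> w1"
proof -
  have "(\<lambda>n. \<bar>b n 0\<bar>) \<longlonglongrightarrow> \<bar>b0\<bar>" "(\<lambda>n. \<bar>w n 0\<bar>) \<longlonglongrightarrow> \<bar>w0\<bar>"
    by (intro tendsto_intros lim_b lim_w order_refl)+
  then show "\<bar>b0\<bar> \<le> b1" "\<bar>w0\<bar> \<le> w1" using bd[of 0] by (auto intro: LIMSEQ_le_const2)
qed

text \<open>A time window of length one before \<open>t\<close> makes both terms of the tail bound
  of order \<open>1 / eig K\<close>, uniformly in the solution and in \<open>t\<close>. The window
  stays after \<open>-2\<close> because \<open>t\<close> is nonnegative.\<close>

lemma uniform_tails:
  assumes \<epsilon>: "\<epsilon> > 0"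
  obtains K where "\<And>n t L. 0 \<le> t \<Longrightarrow> (\<Sum>k\<in>{K..<L}. (coef (u n t) k)\<^sup>2) \<le> \<epsilon>"
proof -
  define C where "C = R\<^sup>2 + (b1 + w1 * R)\<^sup>2"
  have C0: "C \<ge> 0" by (simp add: C_def)
  obtain K where K: "C / \<epsilon> < real K" using reals_Archimedean2 by blast
  have "(\<Sum>k\<in>{K..<L}. (coef (u n t) k)\<^sup>2) \<le> \<epsilon>" if t: "0 \<le> t" for n t L
  proof -
    have e: "eig K > 0" by (rule eig_pos)
    have "eig K \<le> exp (eig K)" using exp_ge_add_one_self[of "eig K"] by linarith
    then have ex: "exp (- eig K) \<le> 1 / eig K" using e by (simp add: exp_minus divide_inverse le_imp_inverse_le)
    have "(\<Sum>k\<in>{K..<L}. (coef (u n t) k)\<^sup>2) \<le> exp (- eig K * (t - (t - 1))) * R\<^sup>2 + (b1 + w1 * R)\<^sup>2 / eig K * (t - (t - 1))"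
      using t bd by (intro mild_tail_bound[OF mild]) auto
    also have "\<dots> = exp (- eig K) * R\<^sup>2 + (b1 + w1 * R)\<^sup>2 / eig K" by simp
    also have "\<dots> \<le> 1 / eig K * R\<^sup>2 + (b1 + w1 * R)\<^sup>2 / eig K"
      using ex by (intro add_right_mono mult_right_mono) auto
    also have "\<dots> = C / eig K" by (simp add: C_def add_divide_distrib)
    also have "\<dots> \<le> C / real (Suc K)" using eig_ge_Suc[of K] C0 e by (intro divide_left_mono) auto
    also have "\<dots> \<le> \<epsilon>"
    proof -
      have "C < real K * \<epsilon>" using K \<epsilon> by (simp add: pos_divide_less_eq)
      also have "\<dots> \<le> real (Suc K) * \<epsilon>" using \<epsilon> by (intro mult_right_mono) auto
      finally show ?thesis by (simp add: pos_divide_le_eq mult.commute)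
    qed
    finally show ?thesis .
  qed
  then show ?thesis using that by blast
qed

lemma equi_lipschitz:
  assumes "0 \<le> s" "0 \<le> t"
  shows "\<bar>coef (u n s) k - coef (u n t) k\<bar> \<le> (b1 + w1 * R + eig k * R) * \<bar>s - t\<bar>"
proof -
  have "(b1 + w1 * R + eig k * R)-lipschitz_on {min s t..max s t} (\<lambda>r. coef (u n r) k)"
    by (rule mild_lipschitz[OF mild]) (use assms bd in auto)
  from lipschitz_onD[OF this, of s t] show ?thesis by (simp add: dist_real_def)
qed

text \<open>A diagonal argument over the countably many pairs of a mode and a nonnegative rational
  time. Equi-Lipschitz continuity extends the convergence of each mode to all times, and the uniform
  tails raise it to convergence in norm; no further subsequence is chosen for individual
  times.\<close>

lemma subsequence_limit:
  obtains r v where "strict_mono r" "\<And>t. 0 \<le> t \<Longrightarrow> (\<lambda>n. u (r n) t) \<longlonglongrightarrow> v t"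
    "continuous_on {0..} v" "\<And>t. 0 \<le> t \<Longrightarrow> norm (v t) \<le> R"
proof -
  define Lk where "Lk k = b1 + w1 * R + eig k * R" for k
  have Lk0: "Lk k \<ge> 0" for k unfolding Lk_def using bounds_nonneg eig_pos[of k] by simp
  let ?S = "UNIV \<times> (\<rat> \<inter> {0..}) :: (nat \<times> real) set"
  have cS: "countable ?S" using countable_rat by (intro countable_SIGMA countable_Int1) auto
  have bS: "norm (coef (u n (snd p)) (fst p)) \<le> R" if "p \<in> ?S" for n p
    using abs_coef_le[of "u n (snd p)" "fst p"] bd[of "snd p" n] that by auto
  obtain r where r: "strict_mono r"
    and rl: "\<And>p. p \<in> ?S \<Longrightarrow> \<exists>l. (\<lambda>n. coef (u (r n) (snd p)) (fst p)) \<longlonglongrightarrow> l"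
    by (rule function_convergent_subsequence[where f = "\<lambda>n p. coef (u n (snd p)) (fst p)", OF cS bS]; (rule that)?)
  interpret S: solution_sequence "\<lambda>n. b (r n)" "\<lambda>n. w (r n)" b0 w0 b1 w1 R "\<lambda>n. u (r n)" "\<lambda>n. f (r n)" "\<lambda>n. F (r n)" "\<lambda>n. V (r n)"
    by (rule subsequence[OF r])
  have conv: "convergent (\<lambda>n. coef (u (r n) t) k)" if t: "0 \<le> t" for t k
  proof -
    have "Cauchy (\<lambda>n. coef (u (r n) t) k)"
    proof (rule metric_CauchyI)
      fix e :: real assume e: "e > 0"
      define d where "d = e / (3 * (Lk k + 1))"
      have d: "d > 0" unfolding d_def using e Lk0[of k] by (intro divide_pos_pos) auto
      obtain q where q: "q \<in> \<rat>" "t < q" "q < t + d" using Rats_dense_in_real[of t "t + d"] d by auto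
      have Ld: "Lk k * \<bar>t - q\<bar> \<le> e / 3"
      proof -
        have "Lk k * \<bar>t - q\<bar> \<le> (Lk k + 1) * d" using q Lk0[of k] by (intro mult_mono) auto
        also have "\<dots> = e / 3"
        proof -
          have third: "D * (e / (3 * D)) = e / 3" if "D > 0" for D using that by simp
          show ?thesis unfolding d_def by (rule third) (use Lk0[of k] in linarith)
        qed
        finally show ?thesis .
      qed
      have "\<exists>l. (\<lambda>n. coef (u (r n) q) k) \<longlonglongrightarrow> l" using rl[of "(k, q)"] q t by auto
      then have "Cauchy (\<lambda>n. coef (u (r n) q) k)" by (auto intro: LIMSEQ_imp_Cauchy)
      then obtain N where N: "\<And>m n. m \<ge> N \<Longrightarrow> n \<ge> N \<Longrightarrow> dist (coef (u (r m) q) k) (coef (u (r n) q) k) < e / 3"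
        using e unfolding Cauchy_def by (meson divide_pos_pos zero_less_numeral)
      have "dist (coef (u (r m) t) k) (coef (u (r n) t) k) < e" if "m \<ge> N" "n \<ge> N" for m n
        using N[OF that] Ld S.equi_lipschitz[of t q m k] S.equi_lipschitz[of t q n k] t q
        unfolding dist_real_def Lk_def by linarith
      then show "\<exists>M. \<forall>m\<ge>M. \<forall>n\<ge>M. dist (coef (u (r m) t) k) (coef (u (r n) t) k) < e" by blast
    qed
    then show ?thesis by (simp add: Cauchy_convergent_iff)
  qed
  have "\<exists>y. (\<lambda>n. u (r n) t) \<longlonglongrightarrow> y" if t: "0 \<le> t" for t
  proof -
    have tails: "\<exists>K. \<forall>n L. (\<Sum>k\<in>{K..<L}. (coef (u (r n) t) k)\<^sup>2) \<le> \<epsilon>" if "\<epsilon> > 0" for \<epsilon>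
      using S.uniform_tails[OF that] t by metis
    show ?thesis
      by (rule l2_convergent_from_coefficients[of "\<lambda>n. u (r n) t", OF tails convergent_LIMSEQ_iff[THEN iffD1, OF conv[OF t]]]) blast+
  qed
  then obtain v where v: "\<And>t. 0 \<le> t \<Longrightarrow> (\<lambda>n. u (r n) t) \<longlonglongrightarrow> v t" by metis
  have vR: "norm (v t) \<le> R" if t: "0 \<le> t" for t
    using LIMSEQ_le_const2[OF tendsto_norm[OF v[OF t]]] bd[of t] t by auto
  have cv: "(\<lambda>n. coef (u (r n) t) k) \<longlonglongrightarrow> coef (v t) k" if "0 \<le> t" for t k
    by (intro tendsto_intros v that)
  have vtail: "\<exists>K. \<forall>t L. 0 \<le> t \<longrightarrow> (\<Sum>k\<in>{K..<L}. (coef (v t) k)\<^sup>2) \<le> \<epsilon>" if \<epsilon>: "\<epsilon> > 0" for \<epsilon>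
  proof -
    obtain K where K: "\<And>n t L. 0 \<le> t \<Longrightarrow> (\<Sum>k\<in>{K..<L}. (coef (u (r n) t) k)\<^sup>2) \<le> \<epsilon>"
      by (rule S.uniform_tails[OF \<epsilon>]) (rule that)
    have "(\<Sum>k\<in>{K..<L}. (coef (v t) k)\<^sup>2) \<le> \<epsilon>" if t: "0 \<le> t" for t L
    proof (rule LIMSEQ_le_const2)
      show "(\<lambda>n. \<Sum>k\<in>{K..<L}. (coef (u (r n) t) k)\<^sup>2) \<longlonglongrightarrow> (\<Sum>k\<in>{K..<L}. (coef (v t) k)\<^sup>2)"
        by (intro tendsto_intros cv t)
    qed (use K t in auto)
    then show ?thesis by blast
  qed
  have vlip: "\<bar>coef (v s) k - coef (v t) k\<bar> \<le> Lk k * \<bar>s - t\<bar>" if st: "0 \<le> s" "0 \<le> t" for s t k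
  proof (rule LIMSEQ_le_const2)
    show "(\<lambda>n. \<bar>coef (u (r n) s) k - coef (u (r n) t) k\<bar>) \<longlonglongrightarrow> \<bar>coef (v s) k - coef (v t) k\<bar>"
      by (intro tendsto_intros cv st)
  qed (use S.equi_lipschitz[OF st] in \<open>auto simp: Lk_def\<close>)
  have "continuous_on {0..} v"
    unfolding continuous_on_sequentially
  proof (intro allI ballI impI)
    fix x :: "nat \<Rightarrow> real" and a assume a: "a \<in> {0..}" and x: "(\<forall>n. x n \<in> {0..}) \<and> x \<longlonglongrightarrow> a"
    \<comment> \<open>Continuity of the limit follows from the same criterion, now along a sequence
      of times instead of a sequence of solutions.\<close>
    have tails: "\<exists>K. \<forall>n L. (\<Sum>k\<in>{K..<L}. (coef ((v \<circ> x) n) k)\<^sup>2) \<le> \<epsilon>" if "\<epsilon> > 0" for \<epsilon>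
      using vtail[OF that] x by (auto simp: o_def)
    have lim: "(\<lambda>n. coef ((v \<circ> x) n) k) \<longlonglongrightarrow> coef (v a) k" for k
    proof -
      have "(\<lambda>n. Lk k * \<bar>x n - a\<bar>) \<longlonglongrightarrow> Lk k * \<bar>a - a\<bar>" using x by (intro tendsto_intros) auto
      then have "(\<lambda>n. Lk k * \<bar>x n - a\<bar>) \<longlonglongrightarrow> 0" by simp
      then have "(\<lambda>n. coef ((v \<circ> x) n) k - coef (v a) k) \<longlonglongrightarrow> 0"
        by (rule Lim_null_comparison[rotated]) (use vlip x a in \<open>auto intro!: always_eventually\<close>)
      then show ?thesis by (simp add: LIM_zero_iff)
    qed
    obtain y where y: "(v \<circ> x) \<longlonglongrightarrow> y" "\<And>k. coef y k = coef (v a) k"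
      by (rule l2_convergent_from_coefficients[OF tails lim]; (rule that)?)
    have "y = v a" by (rule l2_eqI) (rule y(2))
    with y(1) show "(v \<circ> x) \<longlonglongrightarrow> v a" by simp
  qed
  with r v vR show ?thesis using that by blast
qed

section \<open>Almost everywhere convergence in space-time\<close>

lemma F_borel: "F n \<in> borel_measurable borel" and F_abs: "\<bar>F n p\<bar> \<le> 1" and V_borel: "V n \<in> borel_measurable borel"
  using pair[of n] unfolding heaviside_pair_def by blast+

lemma pair_sections:
  "AE t in lborel. 0 < t \<longrightarrow> square_integrable (\<lambda>x. V n (t, x)) \<and> abs_l2 (\<lambda>x. V n (t, x)) = u n t"
  "AE t in lborel. 0 < t \<longrightarrow> (AE x in lborel. 0 < x \<and> x < 1 \<longrightarrow> F n (t, x) \<in> heaviside (V n (t, x)))"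
proof -
  have ae: "AE t in lborel. -2 < t \<longrightarrow>
        (AE x in lborel. 0 < x \<and> x < 1 \<longrightarrow> F n (t, x) \<in> heaviside (V n (t, x))) \<and>
        abs_l2 (\<lambda>x. F n (t, x)) = f n t \<and>
        square_integrable (\<lambda>x. V n (t, x)) \<and> abs_l2 (\<lambda>x. V n (t, x)) = u n t"
    using pair[of n] unfolding heaviside_pair_def by blast
  show "AE t in lborel. 0 < t \<longrightarrow> square_integrable (\<lambda>x. V n (t, x)) \<and> abs_l2 (\<lambda>x. V n (t, x)) = u n t"
    using ae by (rule eventually_mono) auto
  show "AE t in lborel. 0 < t \<longrightarrow> (AE x in lborel. 0 < x \<and> x < 1 \<longrightarrow> F n (t, x) \<in> heaviside (V n (t, x)))"
    using ae by (rule eventually_mono) auto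
qed

lemma nn_integral_strip_le:
  assumes W: "W \<in> borel_measurable borel"
    and ae: "AE t in lborel. 0 < t \<longrightarrow> square_integrable (\<lambda>x. W (t, x)) \<and> norm (abs_l2 (\<lambda>x. W (t, x))) \<le> g t"
  shows "(\<integral>\<^sup>+p. ennreal \<bar>W p\<bar> \<partial>strip_measure) \<le> (\<integral>\<^sup>+t. ennreal (g t) \<partial>time_measure)"
proof -
  interpret S: finite_measure space_measure by (rule finite_space_measure)
  have "(\<integral>\<^sup>+p. ennreal \<bar>W p\<bar> \<partial>strip_measure) = (\<integral>\<^sup>+t. \<integral>\<^sup>+x. ennreal \<bar>W (t, x)\<bar> \<partial>space_measure \<partial>time_measure)"
    using W by (intro S.nn_integral_fst[symmetric]) (simp add: measurable_strip[symmetric])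
  also have "\<dots> \<le> (\<integral>\<^sup>+t. ennreal (g t) \<partial>time_measure)"
  proof (rule nn_integral_mono_AE)
    show "AE t in time_measure. (\<integral>\<^sup>+x. ennreal \<bar>W (t, x)\<bar> \<partial>space_measure) \<le> ennreal (g t)"
      unfolding AE_time_measure using ae
    proof eventually_elim
      case (elim t)
      show ?case
      proof
        assume "0 < t"
        with elim have *: "square_integrable (\<lambda>x. W (t, x))" "norm (abs_l2 (\<lambda>x. W (t, x))) \<le> g t" by auto
        show "(\<integral>\<^sup>+x. ennreal \<bar>W (t, x)\<bar> \<partial>space_measure) \<le> ennreal (g t)"
          by (rule order_trans[OF nn_integral_space_measure_le[OF borel_section[OF W] *(1)] ennreal_leI[OF *(2)]])
      qed
    qed
  qed
  finally show ?thesis .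
qed

text \<open>Convergence in \<open>l2\<close> at each time becomes convergence in L^1 on the strip by
  dominated convergence in time, the bound \<open>2 * R\<close> being integrable for the weighted
  measure. The sign of the limit at a point then decides the sign of the approximating solutions
  there, for which a limit in norm would not suffice.\<close>

lemma V_subsequence:
  assumes conv: "\<And>t. 0 \<le> t \<Longrightarrow> (\<lambda>n. u n t) \<longlonglongrightarrow> v t" and v: "continuous_on {0..} v"
    and vR: "\<And>t. 0 \<le> t \<Longrightarrow> norm (v t) \<le> R"
  obtains r W where "strict_mono r" "W \<in> borel_measurable borel" "AE p in strip_measure. (\<lambda>n. V (r n) p) \<longlonglongrightarrow> W p"
proof -
  interpret T: finite_measure time_measure by (rule finite_time_measure)
  have Tfin: "(\<integral>\<^sup>+t. ennreal c \<partial>time_measure) < \<infinity>" for c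
  proof -
    have "emeasure time_measure (space time_measure) < top"
      using T.emeasure_finite[of "space time_measure"] unfolding less_top[symmetric] infinity_ennreal_def .
    then show ?thesis by (simp add: ennreal_mult_less_top)
  qed
  define g where "g i t = indicator {0<..} t *\<^sub>R norm (u i t - v t)" for i t
  have gm: "g i \<in> borel_measurable borel" for i
  proof -
    have cu: "continuous_on {0<..} (u i)" by (rule continuous_on_subset[OF cont_u]) auto
    have cv: "continuous_on {0<..} v" by (rule continuous_on_subset[OF v]) auto
    have "continuous_on {0<..} (\<lambda>t. norm (u i t - v t))" by (intro continuous_intros cu cv)
    then show ?thesis unfolding g_def by (intro borel_measurable_continuous_on_indicator) auto
  qed
  define a where "a i = (\<integral>\<^sup>+t. ennreal (g i t) \<partial>time_measure)" for i
  have "a \<longlonglongrightarrow> (\<integral>\<^sup>+t. 0 \<partial>time_measure)"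
    unfolding a_def
  proof (rule nn_integral_dominated_convergence[where w = "\<lambda>_. ennreal (2 * R)"])
    show "(\<lambda>t. ennreal (g i t)) \<in> borel_measurable time_measure" for i
      using gm[of i] by (simp add: time_measure_def)
    show "AE t in time_measure. ennreal (g i t) \<le> ennreal (2 * R)" for i
    proof (intro AE_I2 ennreal_leI)
      fix t
      show "g i t \<le> 2 * R"
      proof (cases "0 < t")
        case True
        then have "norm (u i t) \<le> R" "norm (v t) \<le> R" using bd[of t i] vR[of t] by auto
        then show ?thesis using True norm_triangle_ineq4[of "u i t" "v t"] by (simp add: g_def)
      qed (use bounds_nonneg in \<open>simp add: g_def\<close>)
    qed
    show "AE t in time_measure. (\<lambda>i. ennreal (g i t)) \<longlonglongrightarrow> 0"
    proof (rule AE_I2)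
      fix t
      have "(\<lambda>i. g i t) \<longlonglongrightarrow> 0"
      proof (cases "0 < t")
        case True
        then have "(\<lambda>i. norm (u i t - v t)) \<longlonglongrightarrow> norm (v t - v t)" by (intro tendsto_intros conv) auto
        then show ?thesis using True by (simp add: g_def)
      qed (simp add: g_def)
      then show "(\<lambda>i. ennreal (g i t)) \<longlonglongrightarrow> 0" using tendsto_ennrealI by force
    qed
  qed (use Tfin in auto)
  then have a0: "a \<longlonglongrightarrow> 0" by simp
  have iV: "integrable strip_measure (V n)" for n
  proof (rule integrableI_bounded)
    show "V n \<in> borel_measurable strip_measure" using V_borel by (simp add: measurable_strip)
    have "(\<integral>\<^sup>+p. ennreal \<bar>V n p\<bar> \<partial>strip_measure) \<le> (\<integral>\<^sup>+t. ennreal R \<partial>time_measure)"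
      by (rule nn_integral_strip_le[OF V_borel], use pair_sections(1)[of n] in eventually_elim) (use bd in auto)
    then show "(\<integral>\<^sup>+p. ennreal (norm (V n p)) \<partial>strip_measure) < \<infinity>" using Tfin[of R] by (simp add: order_le_less_trans)
  qed
  have Vij: "(\<integral>\<^sup>+p. ennreal \<bar>V i p - V j p\<bar> \<partial>strip_measure) \<le> a i + a j" for i j
  proof -
    have "(\<integral>\<^sup>+p. ennreal \<bar>V i p - V j p\<bar> \<partial>strip_measure) \<le> (\<integral>\<^sup>+t. ennreal (g i t + g j t) \<partial>time_measure)"
    proof (rule nn_integral_strip_le)
      show "(\<lambda>p. V i p - V j p) \<in> borel_measurable borel" using V_borel by simp
      show "AE t in lborel. 0 < t \<longrightarrow> square_integrable (\<lambda>x. V i (t, x) - V j (t, x)) \<and>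
          norm (abs_l2 (\<lambda>x. V i (t, x) - V j (t, x))) \<le> g i t + g j t"
        using pair_sections(1)[of i] pair_sections(1)[of j]
      proof eventually_elim
        case (elim t)
        show ?case
        proof
          assume t: "0 < t"
          with elim have s: "square_integrable (\<lambda>x. V i (t, x))" "square_integrable (\<lambda>x. V j (t, x))" by auto
          have "abs_l2 (\<lambda>x. V i (t, x) - V j (t, x)) = u i t - u j t"
            using elim t by (simp add: diff_abs[OF s, symmetric])
          moreover have "norm (u i t - u j t) \<le> norm (u i t - v t) + norm (u j t - v t)"
            using norm_triangle_ineq4[of "u i t - v t" "u j t - v t"] by simp
          ultimately show "square_integrable (\<lambda>x. V i (t, x) - V j (t, x)) \<and>
            norm (abs_l2 (\<lambda>x. V i (t, x) - V j (t, x))) \<le> g i t + g j t"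
            using square_integrable_diff[OF s] t by (simp add: g_def)
        qed
      qed
    qed
    also have "\<dots> = (\<integral>\<^sup>+t. ennreal (g i t) + ennreal (g j t) \<partial>time_measure)"
      by (intro nn_integral_cong ennreal_plus) (auto simp: g_def)
    also have "\<dots> = a i + a j"
      unfolding a_def using gm by (intro nn_integral_add) (simp_all add: time_measure_def)
    finally show ?thesis .
  qed
  obtain r where r: "strict_mono r" "AE p in strip_measure. Cauchy (\<lambda>n. V (r n) p)"
  proof (rule cauchy_L1_AE_cauchy_subseq[OF iV])
    fix e :: real assume e: "e > 0"
    have "\<forall>\<^sub>F i in sequentially. a i < ennreal (e / 2)" using e by (intro order_tendstoD(2)[OF a0]) simp
    then obtain N where N: "\<And>i. i \<ge> N \<Longrightarrow> a i < ennreal (e / 2)" by (auto simp: eventually_sequentially)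
    have "(LINT p|strip_measure. norm (V i p - V j p)) < e" if ij: "i \<ge> N" "j \<ge> N" for i j
    proof -
      have int: "integrable strip_measure (\<lambda>p. norm (V i p - V j p))" using iV by simp
      have "ennreal (LINT p|strip_measure. norm (V i p - V j p)) = (\<integral>\<^sup>+p. ennreal \<bar>V i p - V j p\<bar> \<partial>strip_measure)"
        using nn_integral_eq_integral[OF int] by simp
      also have "\<dots> \<le> a i + a j" by (rule Vij)
      also have "\<dots> < ennreal (e / 2) + ennreal (e / 2)" using N[OF ij(1)] N[OF ij(2)] by (rule add_strict_mono)
      also have "\<dots> = ennreal e" using e by (simp flip: ennreal_plus)
      finally show ?thesis using e by (simp add: ennreal_less_iff)
    qed
    then show "\<exists>N. \<forall>i\<ge>N. \<forall>j\<ge>N. (LINT p|strip_measure. norm (V i p - V j p)) < e" by blast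
  qed
  show ?thesis
  proof (rule that[OF r(1)])
    show "(\<lambda>p. lim (\<lambda>n. V (r n) p)) \<in> borel_measurable borel"
      using V_borel by (intro borel_measurable_lim_metric)
    show "AE p in strip_measure. (\<lambda>n. V (r n) p) \<longlonglongrightarrow> lim (\<lambda>n. V (r n) p)"
      using r(2) by eventually_elim (simp add: Cauchy_convergent_iff convergent_LIMSEQ_iff)
  qed
qed

text \<open>The only functionals of the selection that the integrated equation sees. They are linear
  in \<open>G\<close>, hence compatible with midpoint combinations.\<close>

definition forcing_integral :: "nat \<Rightarrow> real \<Rightarrow> real \<Rightarrow> (real \<times> real \<Rightarrow> real) \<Rightarrow> real" where
  "forcing_integral k s t G = (LINT r:{s..t}|lborel. coef (sect G r) k)"

text \<open>The \<open>F i\<close> need not converge in any strong sense, but the equation expresses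
  their contribution through quantities that do. Its limit is thus read off from the
  equation.\<close>

lemma forcing_integral_tendsto:
  assumes conv: "\<And>t. 0 \<le> t \<Longrightarrow> (\<lambda>n. u n t) \<longlonglongrightarrow> v t" and v: "continuous_on {0..} v"
    and vR: "\<And>t. 0 \<le> t \<Longrightarrow> norm (v t) \<le> R" and st: "0 < s" "s \<le> t"
  shows "(\<lambda>i. b0 * forcing_integral k s t (F i)) \<longlonglongrightarrow>
    coef (v t) k - coef (v s) k - (w0 - eig k) * integral {s..t} (\<lambda>r. coef (v r) k)"
proof -
  define y where "y r = coef (v r) k" for r
  define yi where "yi i r = coef (u i r) k" for i r
  define \<phi> where "\<phi> i r = coef (sect (F i) r) k" for i r
  define h where "h i r = b i r * \<phi> i r + w i r * yi i r - eig k * yi i r" for i r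
  \<comment> \<open>The error made by replacing coefficients and solution by their limits, while the
    forcing is kept. It vanishes pointwise because \<open>\<phi> i r\<close> stays bounded as
    \<open>b i r\<close> tends to \<open>b0\<close>.\<close>
  define er where "er i r = h i r - b0 * \<phi> i r - (w0 - eig k) * y r" for i r
  have hI: "(h i has_integral yi i t - yi i s) {s..t}" for i
    using mild_sect[OF mild[of i] pair[of i]] st by (simp add: mild_solution_def h_def[abs_def] yi_def \<phi>_def)
  have \<phi>I: "(\<phi> i has_integral forcing_integral k s t (F i)) {s..t}" for i
    unfolding \<phi>_def forcing_integral_def
    using set_borel_integral_eq_integral[OF integrable_coef_sect[OF F_borel F_abs]] by (metis integrable_integral)
  have "continuous_on {s..t} y"
    unfolding y_def using st by (intro continuous_intros continuous_on_subset[OF v]) auto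
  then have yI: "(y has_integral integral {s..t} y) {s..t}" by (intro integrable_integral integrable_continuous_real)
  have eI: "(er i has_integral (yi i t - yi i s) - b0 * forcing_integral k s t (F i) - (w0 - eig k) * integral {s..t} y) {s..t}" for i
    unfolding er_def by (intro has_integral_diff hI has_integral_mult_right \<phi>I yI)
  have \<phi>1: "\<bar>\<phi> i r\<bar> \<le> 1" for i r
    unfolding \<phi>_def by (rule order_trans[OF abs_coef_le norm_sect_le[OF F_borel F_abs]])
  have ylim: "(\<lambda>i. yi i r) \<longlonglongrightarrow> y r" if "0 \<le> r" for r
    unfolding yi_def y_def by (intro tendsto_intros conv that)
  have erb: "norm (er i r) \<le> (b1 + w1 * R + eig k * R) + b1 + (w1 + eig k) * R" if r: "r \<in> {s..t}" for i r
  proof -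
    have "\<bar>h i r\<bar> \<le> b1 + w1 * R + eig k * R"
      unfolding h_def yi_def \<phi>_def using bd[of r i] r st norm_sect_le[OF F_borel F_abs]
      by (intro mild_integrand_bound) auto
    moreover have "\<bar>b0 * \<phi> i r\<bar> \<le> b1 * 1"
      unfolding abs_mult using limit_bounds \<phi>1 bounds_nonneg by (intro mult_mono) auto
    moreover have "\<bar>(w0 - eig k) * y r\<bar> \<le> (w1 + eig k) * R"
      unfolding abs_mult y_def
    proof (intro mult_mono)
      show "\<bar>w0 - eig k\<bar> \<le> w1 + eig k" using limit_bounds(2) eig_pos[of k] by linarith
      show "\<bar>coef (v r) k\<bar> \<le> R" using abs_coef_le[of "v r" k] vR[of r] r st by auto
      show "0 \<le> w1 + eig k" using bounds_nonneg(2) eig_pos[of k] by linarith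
    qed simp
    ultimately show ?thesis unfolding er_def real_norm_def by linarith
  qed
  have erl: "(\<lambda>i. er i r) \<longlonglongrightarrow> 0" if r: "r \<in> {s..t}" for r
  proof -
    have r0: "0 \<le> r" using r st by simp
    have "(\<lambda>i. b i r - b0) \<longlonglongrightarrow> 0" using lim_b[OF r0] by (simp add: LIM_zero_iff)
    then have "(\<lambda>i. \<bar>b i r - b0\<bar>) \<longlonglongrightarrow> 0" by (rule tendsto_rabs_zero)
    then have 1: "(\<lambda>i. (b i r - b0) * \<phi> i r) \<longlonglongrightarrow> 0"
      by (rule Lim_null_comparison[rotated]) (auto simp: abs_mult \<phi>1 mult_left_le intro!: always_eventually)
    have 2: "(\<lambda>i. (w i r - eig k) * yi i r - (w0 - eig k) * y r) \<longlonglongrightarrow> (w0 - eig k) * y r - (w0 - eig k) * y r"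
      by (intro tendsto_intros lim_w[OF r0] ylim[OF r0])
    have "er i r = (b i r - b0) * \<phi> i r + ((w i r - eig k) * yi i r - (w0 - eig k) * y r)" for i
      by (simp add: er_def h_def algebra_simps)
    then show ?thesis using tendsto_add[OF 1 2] by simp
  qed
  have "(\<lambda>i. integral {s..t} (er i)) \<longlonglongrightarrow> integral {s..t} (\<lambda>_. 0)"
    by (rule dominated_convergence(2)[where h = "\<lambda>_. (b1 + w1 * R + eig k * R) + b1 + (w1 + eig k) * R"])
      (use eI erb erl in auto)
  then have "(\<lambda>i. (yi i t - yi i s) - (w0 - eig k) * integral {s..t} y - integral {s..t} (er i))
      \<longlonglongrightarrow> (y t - y s) - (w0 - eig k) * integral {s..t} y - 0"
    using st by (intro tendsto_intros ylim) auto
  moreover have "(yi i t - yi i s) - (w0 - eig k) * integral {s..t} y - integral {s..t} (er i) = b0 * forcing_integral k s t (F i)" for i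
    using integral_unique[OF eI[of i]] by simp
  ultimately show ?thesis by (simp add: y_def[abs_def])
qed

text \<open>A closed interval around \<open>A\<close> is convex and the functional is linear. The
  induction also carries measurability and boundedness, on which the linearity depends.\<close>

lemma forcing_integral_midpoints:
  assumes g: "g \<in> midpoints F N"
    and le: "\<And>i. N \<le> i \<Longrightarrow> \<bar>b0 * forcing_integral k s t (F i) - A\<bar> \<le> e"
  shows "\<bar>b0 * forcing_integral k s t g - A\<bar> \<le> e"
proof -
  have "g \<in> borel_measurable borel \<and> (\<forall>p. \<bar>g p\<bar> \<le> 1) \<and> \<bar>b0 * forcing_integral k s t g - A\<bar> \<le> e"
    using g
  proof induction
    case (base i)
    then show ?case using F_borel F_abs le by blast
  next
    case (mid g h)
    then have g: "g \<in> borel_measurable borel" "\<And>p. \<bar>g p\<bar> \<le> 1" and h: "h \<in> borel_measurable borel" "\<And>p. \<bar>h p\<bar> \<le> 1" by auto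
    have "\<bar>g p + h p\<bar> \<le> 2" for p using g(2)[of p] h(2)[of p] by linarith
    then have b: "\<bar>(g p + h p) / 2\<bar> \<le> 1" for p by simp
    have fi: "forcing_integral k s t (\<lambda>p. (g p + h p) / 2) = (forcing_integral k s t g + forcing_integral k s t h) / 2"
    proof -
      have "forcing_integral k s t (\<lambda>p. (g p + h p) / 2) = (LINT r:{s..t}|lborel. (1/2) * (coef (sect g r) k + coef (sect h r) k))"
        unfolding forcing_integral_def sect_midpoint[OF g h] by (simp add: inner_add_left)
      also have "\<dots> = (1/2) * (forcing_integral k s t g + forcing_integral k s t h)"
        unfolding forcing_integral_def
        using set_integral_add(2)[OF integrable_coef_sect[OF g] integrable_coef_sect[OF h]]
        by (subst set_integral_mult_right) simp
      finally show ?thesis by simp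
    qed
    have half: "\<bar>b0 * ((x + y) / 2) - A\<bar> \<le> e" if "\<bar>b0 * x - A\<bar> \<le> e" "\<bar>b0 * y - A\<bar> \<le> e" for x y
    proof -
      have eq: "b0 * ((x + y) / 2) - A = ((b0 * x - A) + (b0 * y - A)) / 2" by (simp add: field_simps)
      have "\<bar>(b0 * x - A) + (b0 * y - A)\<bar> \<le> 2 * e" using that by linarith
      then show ?thesis unfolding eq by simp
    qed
    have "(\<lambda>p. (g p + h p) / 2) \<in> borel_measurable borel" using g(1) h(1) by simp
    with b show ?case unfolding fi using half mid.IH by blast
  qed
  then show ?thesis by blast
qed

text \<open>One sequence \<open>c n\<close> serves two purposes: its pointwise limit inherits
  membership in the Heaviside graph, and its forcing integrals have the same limit as those of the
  \<open>F i\<close>. The limit \<open>H\<close> therefore both selects correctly and solves the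
  mode equations.\<close>

lemma limit_selection:
  assumes conv: "\<And>t. 0 \<le> t \<Longrightarrow> (\<lambda>n. u n t) \<longlonglongrightarrow> v t" and v: "continuous_on {0..} v"
    and vR: "\<And>t. 0 \<le> t \<Longrightarrow> norm (v t) \<le> R"
    and W: "W \<in> borel_measurable borel" and VW: "AE p in strip_measure. (\<lambda>n. V n p) \<longlonglongrightarrow> W p"
  obtains H where "heaviside_pair 0 v (sect H) H W" "mild_solution (\<lambda>_. b0) (\<lambda>_. w0) 0 v (sect H)"
proof -
  interpret M: finite_measure strip_measure by (rule finite_strip_measure)
  have Fm: "F i \<in> borel_measurable strip_measure" for i using F_borel by (simp add: measurable_strip)
  obtain c where c: "\<And>n. c n \<in> midpoints F n" and Cau: "AE p in strip_measure. Cauchy (\<lambda>n. c n p)"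
    by (rule M.midpoints_AE_Cauchy[OF Fm F_abs]) (rule that)
  have cm: "c n \<in> borel_measurable borel" for n by (rule midpoints_measurable[OF c F_borel])
  have cb: "\<bar>c n p\<bar> \<le> 1" for n p
  proof -
    have "\<bar>c n p - 0\<bar> \<le> 1" by (rule midpoints_abs_le[OF c]) (use F_abs in simp)
    then show ?thesis by simp
  qed
  \<comment> \<open>The clipping matters only where \<open>c n\<close> has no limit. It keeps the
    bound valid everywhere, so that \<open>sect H\<close> is meaningful at every time.\<close>
  define H where "H p = max (-1) (min 1 (lim (\<lambda>n. c n p)))" for p
  have Hm: "H \<in> borel_measurable borel" unfolding H_def using cm by measurable
  have Hb: "\<bar>H p\<bar> \<le> 1" for p by (auto simp: H_def)
  have cH: "AE p in strip_measure. (\<lambda>n. c n p) \<longlonglongrightarrow> H p"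
    using Cau
  proof eventually_elim
    case (elim p)
    then have l: "(\<lambda>n. c n p) \<longlonglongrightarrow> lim (\<lambda>n. c n p)" by (simp add: Cauchy_convergent_iff convergent_LIMSEQ_iff)
    have "\<bar>lim (\<lambda>n. c n p)\<bar> \<le> 1" by (rule LIMSEQ_le_const2[OF tendsto_rabs[OF l]]) (use cb in auto)
    then have "H p = lim (\<lambda>n. c n p)" by (auto simp: H_def)
    with l show ?case by simp
  qed
  have heav_pred: "Measurable.pred borel (\<lambda>p. F n p \<in> heaviside (V n p))" for n
  proof -
    have eq: "F n p \<in> heaviside (V n p) \<longleftrightarrow> (V n p < 0 \<and> F n p = -1) \<or> (V n p = 0 \<and> -1 \<le> F n p \<and> F n p \<le> 1) \<or> (0 < V n p \<and> F n p = 1)" for p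
      by (auto simp: heaviside_def)
    show ?thesis unfolding eq using F_borel[of n] V_borel[of n] by measurable
  qed
  have FV: "AE p in strip_measure. \<forall>n. F n p \<in> heaviside (V n p)"
    unfolding AE_all_countable using AE_sections_strip_measure[OF pair_sections(2) heav_pred] by blast
  have HW: "AE p in strip_measure. H p \<in> heaviside (W p)"
    using FV VW cH
  proof eventually_elim
    case (elim p)
    \<comment> \<open>Eventual constancy of \<open>F i p\<close> is inherited by the averages
      because \<open>c n\<close> involves indices from \<open>n\<close> on only.\<close>
    have pos: "H p = z" if ev: "\<forall>\<^sub>F i in sequentially. F i p = z" for z
    proof -
      obtain N where N: "\<And>i. N \<le> i \<Longrightarrow> F i p = z" using ev by (auto simp: eventually_sequentially)
      have "\<bar>c n p - z\<bar> \<le> 0" if "n \<ge> N" for n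
        by (rule midpoints_abs_le[OF c]) (use N that in auto)
      then have "\<forall>\<^sub>F n in sequentially. c n p = z" by (intro eventually_sequentiallyI[of N]) auto
      then have "(\<lambda>n. c n p) \<longlonglongrightarrow> z" by (rule tendsto_eventually)
      with elim(3) show ?thesis by (rule LIMSEQ_unique)
    qed
    consider "W p < 0" | "W p = 0" | "W p > 0" by linarith
    then show ?case
    proof cases
      case 1
      have "\<forall>\<^sub>F i in sequentially. V i p < 0" by (rule order_tendstoD(2)[OF elim(2) 1])
      then have "\<forall>\<^sub>F i in sequentially. F i p = -1"
      proof eventually_elim
        case (elim i)
        then show ?case using \<open>\<forall>n. F n p \<in> heaviside (V n p)\<close>[rule_format, of i] by (simp add: heaviside_def)
      qed
      then show ?thesis using pos 1 by (auto simp: heaviside_def)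
    next
      case 2 then show ?thesis using Hb[of p] by (auto simp: heaviside_def abs_le_iff)
    next
      case 3
      have "\<forall>\<^sub>F i in sequentially. V i p > 0" by (rule order_tendstoD(1)[OF elim(2) 3])
      then have "\<forall>\<^sub>F i in sequentially. F i p = 1"
      proof eventually_elim
        case (elim i)
        then show ?case using \<open>\<forall>n. F n p \<in> heaviside (V n p)\<close>[rule_format, of i] by (simp add: heaviside_def)
      qed
      then show ?thesis using pos 3 by (auto simp: heaviside_def)
    qed
  qed
  have sec: "AE t in lborel. \<forall>n. 0 < t \<longrightarrow> square_integrable (\<lambda>x. V n (t, x)) \<and> abs_l2 (\<lambda>x. V n (t, x)) = u n t"
    unfolding AE_all_countable using pair_sections(1) by blast
  have pairH: "heaviside_pair 0 v (sect H) H W"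
    unfolding heaviside_pair_def
  proof (intro conjI allI Hm W Hb)
    show "AE t in lborel. 0 < t \<longrightarrow> (AE x in lborel. 0 < x \<and> x < 1 \<longrightarrow> H (t, x) \<in> heaviside (W (t, x))) \<and>
        abs_l2 (\<lambda>x. H (t, x)) = sect H t \<and> square_integrable (\<lambda>x. W (t, x)) \<and> abs_l2 (\<lambda>x. W (t, x)) = v t"
      using AE_strip_measure_sections[OF HW] AE_strip_measure_sections[OF VW] sec
    proof eventually_elim
      case (elim t)
      show ?case
      proof
        assume t: "0 < t"
        have lim: "(\<lambda>n. abs_l2 (\<lambda>x. V n (t, x))) \<longlonglongrightarrow> v t" using elim(3) t conv[of t] by simp
        have sq: "square_integrable (\<lambda>x. V n (t, x))" for n using elim(3) t by simp
        have ae: "AE x in unit_measure. (\<lambda>n. V n (t, x)) \<longlonglongrightarrow> W (t, x)"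
          unfolding AE_unit_iff using elim(2) t by simp
        note abs_l2_limit_unique[OF sq lim borel_imp_unit_measurable[OF borel_section[OF W]] ae]
        then show "(AE x in lborel. 0 < x \<and> x < 1 \<longrightarrow> H (t, x) \<in> heaviside (W (t, x))) \<and>
          abs_l2 (\<lambda>x. H (t, x)) = sect H t \<and> square_integrable (\<lambda>x. W (t, x)) \<and> abs_l2 (\<lambda>x. W (t, x)) = v t"
          using elim(1) t by (simp add: sect_def)
      qed
    qed
  qed
  have "((\<lambda>r. b0 * coef (sect H r) k + w0 * coef (v r) k - eig k * coef (v r) k) has_integral coef (v t) k - coef (v s) k) {s..t}"
    if st: "0 < s" "s \<le> t" for k s t
  proof -
    define A where "A = coef (v t) k - coef (v s) k - (w0 - eig k) * integral {s..t} (\<lambda>r. coef (v r) k)"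
    have FA: "(\<lambda>i. b0 * forcing_integral k s t (F i)) \<longlonglongrightarrow> A"
      unfolding A_def by (rule forcing_integral_tendsto[OF conv v vR st])
    have cA: "(\<lambda>n. b0 * forcing_integral k s t (c n)) \<longlonglongrightarrow> A"
    proof (rule LIMSEQ_I)
      fix e :: real assume e: "e > 0"
      then obtain N where N: "\<And>i. N \<le> i \<Longrightarrow> norm (b0 * forcing_integral k s t (F i) - A) < e / 2"
        using LIMSEQ_D[OF FA, of "e / 2"] by auto
      have "\<bar>b0 * forcing_integral k s t (c n) - A\<bar> \<le> e / 2" if "n \<ge> N" for n
        by (rule forcing_integral_midpoints[OF c]) (use N that in \<open>fastforce intro: less_imp_le\<close>)
      then show "\<exists>no. \<forall>n\<ge>no. norm (b0 * forcing_integral k s t (c n) - A) < e"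
        using e by (intro exI[of _ N]) force
    qed
    \<comment> \<open>Dominated convergence twice: in time here, with the pointwise limits supplied
      by dominated convergence in space on almost every section.\<close>
    have "(\<lambda>n. forcing_integral k s t (c n)) \<longlonglongrightarrow> forcing_integral k s t H"
      unfolding forcing_integral_def set_lebesgue_integral_def
    proof (rule integral_dominated_convergence[where w = "\<lambda>r. indicator {s..t} r"])
      show "integrable lborel (indicator {s..t} :: real \<Rightarrow> real)"
        by (rule integrable_real_indicator) (auto simp: emeasure_lborel_Icc_eq)
      show "(\<lambda>r. indicator {s..t} r *\<^sub>R coef (sect H r) k) \<in> borel_measurable lborel"
        using coef_sect_measurable[OF Hm Hb, of k] by simp
      show "(\<lambda>r. indicator {s..t} r *\<^sub>R coef (sect (c n) r) k) \<in> borel_measurable lborel" for n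
        using coef_sect_measurable[OF cm cb, of n k] by simp
      show "AE r in lborel. norm (indicator {s..t} r *\<^sub>R coef (sect (c n) r) k) \<le> indicator {s..t} r" for n
        using order_trans[OF abs_coef_le norm_sect_le[OF cm cb], of n] by (intro AE_I2) (auto simp: indicator_def)
      show "AE r in lborel. (\<lambda>n. indicator {s..t} r *\<^sub>R coef (sect (c n) r) k) \<longlonglongrightarrow> indicator {s..t} r *\<^sub>R coef (sect H r) k"
        using AE_strip_measure_sections[OF cH]
      proof eventually_elim
        case (elim r)
        show ?case
        proof (cases "r \<in> {s..t}")
          case True
          then have "0 < r" using st by simp
          then have ae: "AE x in unit_measure. (\<lambda>n. c n (r, x)) \<longlonglongrightarrow> H (r, x)"
            unfolding AE_unit_iff using elim by simp
          have "(\<lambda>n. coef (sect (c n) r) k) \<longlonglongrightarrow> coef (sect H r) k"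
            unfolding coef_sect[OF cm cb] coef_sect[OF Hm Hb]
          proof (rule integral_dominated_convergence[where w = "\<lambda>x. \<bar>sinf k x\<bar>"])
            have sm: "sinf k \<in> borel_measurable unit_measure" using square_integrable_sinf[of k] by (simp add: square_integrable_def)
            show "(\<lambda>x. H (r, x) * sinf k x) \<in> borel_measurable unit_measure"
              using sm borel_imp_unit_measurable[OF borel_section[OF Hm, of r]] by simp
            show "(\<lambda>x. c n (r, x) * sinf k x) \<in> borel_measurable unit_measure" for n
              using sm borel_imp_unit_measurable[OF borel_section[OF cm, of n r]] by simp
            have one: "square_integrable (\<lambda>_. 1)" by (rule square_integrable_continuous) auto
            show "integrable unit_measure (\<lambda>x. \<bar>sinf k x\<bar>)"
              using square_integrable_mult[OF square_integrable_sinf[of k] one] by simp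
            show "AE x in unit_measure. (\<lambda>n. c n (r, x) * sinf k x) \<longlonglongrightarrow> H (r, x) * sinf k x"
              using ae by eventually_elim (intro tendsto_intros)
            show "AE x in unit_measure. norm (c n (r, x) * sinf k x) \<le> \<bar>sinf k x\<bar>" for n
              using cb by (intro AE_I2) (simp add: abs_mult mult_left_le_one_le)
          qed
          then show ?thesis using True by simp
        qed simp
      qed
    qed
    then have "(\<lambda>n. b0 * forcing_integral k s t (c n)) \<longlonglongrightarrow> b0 * forcing_integral k s t H" by (rule tendsto_mult_left)
    with cA have eq: "b0 * forcing_integral k s t H = A" by (rule LIMSEQ_unique[rotated])
    have HI: "((\<lambda>r. coef (sect H r) k) has_integral forcing_integral k s t H) {s..t}"
      unfolding forcing_integral_def
      using set_borel_integral_eq_integral[OF integrable_coef_sect[OF Hm Hb]] by (metis integrable_integral)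
    have "continuous_on {s..t} (\<lambda>r. coef (v r) k)"
      using st by (intro continuous_intros continuous_on_subset[OF v]) auto
    then have vI: "((\<lambda>r. coef (v r) k) has_integral integral {s..t} (\<lambda>r. coef (v r) k)) {s..t}"
      by (intro integrable_integral integrable_continuous_real)
    have "((\<lambda>r. b0 * coef (sect H r) k + (w0 - eig k) * coef (v r) k) has_integral
        b0 * forcing_integral k s t H + (w0 - eig k) * integral {s..t} (\<lambda>r. coef (v r) k)) {s..t}"
      by (intro has_integral_add has_integral_mult_right HI vI)
    then show ?thesis unfolding eq A_def by (simp add: algebra_simps)
  qed
  then have "mild_solution (\<lambda>_. b0) (\<lambda>_. w0) 0 v (sect H)"
    unfolding mild_solution_def using norm_sect_le[OF Hm Hb] by blast
  with pairH show ?thesis using that by blast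
qed

text \<open>The second subsequence \<open>q\<close> is used only to find a selection. The limit
  \<open>v\<close> is already determined along \<open>r\<close>, so \<open>r\<close> is what is
  returned.\<close>

lemma limit_strong_solution:
  obtains r v where "strict_mono r" "\<And>t. 0 \<le> t \<Longrightarrow> (\<lambda>n. u (r n) t) \<longlonglongrightarrow> v t"
    "strong_solution (\<lambda>_. b0) (\<lambda>_. w0) 0 (v 0) v" "norm (v 0) \<le> R"
proof -
  obtain r v where r: "strict_mono r" and conv: "\<And>t. 0 \<le> t \<Longrightarrow> (\<lambda>n. u (r n) t) \<longlonglongrightarrow> v t"
    and v: "continuous_on {0..} v" and vR: "\<And>t. 0 \<le> t \<Longrightarrow> norm (v t) \<le> R"
    by (rule subsequence_limit) (rule that)
  interpret S: solution_sequence "\<lambda>n. b (r n)" "\<lambda>n. w (r n)" b0 w0 b1 w1 R "\<lambda>n. u (r n)" "\<lambda>n. f (r n)" "\<lambda>n. F (r n)" "\<lambda>n. V (r n)"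
    by (rule subsequence[OF r])
  obtain q W where q: "strict_mono q" and W: "W \<in> borel_measurable borel"
    and VW: "AE p in strip_measure. (\<lambda>n. V (r (q n)) p) \<longlonglongrightarrow> W p"
    by (rule S.V_subsequence[OF conv v vR]; (rule that)?)
  interpret Q: solution_sequence "\<lambda>n. b (r (q n))" "\<lambda>n. w (r (q n))" b0 w0 b1 w1 R "\<lambda>n. u (r (q n))"
    "\<lambda>n. f (r (q n))" "\<lambda>n. F (r (q n))" "\<lambda>n. V (r (q n))"
    by (rule S.subsequence[OF q])
  have conv': "(\<lambda>n. u (r (q n)) t) \<longlonglongrightarrow> v t" if "0 \<le> t" for t
    using LIMSEQ_subseq_LIMSEQ[OF conv[OF that] q] by (simp add: o_def)
  obtain H where H: "heaviside_pair 0 v (sect H) H W" "mild_solution (\<lambda>_. b0) (\<lambda>_. w0) 0 v (sect H)"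
    by (rule Q.limit_selection[OF conv' v vR W VW]; (rule that)?)
  have Hm: "H \<in> borel_measurable borel" and Hb: "\<And>p. \<bar>H p\<bar> \<le> 1" using H(1) by (auto simp: heaviside_pair_def)
  have sm: "sect H \<in> borel_measurable (lebesgue_on {0<..})"
    using sect_measurable[OF Hm Hb] by (intro measurable_restrict_space1 measurable_completion) simp
  have "strong_solution (\<lambda>_. b0) (\<lambda>_. w0) 0 (v 0) v"
    by (rule mild_imp_strong[OF H(2,1) _ _ v sm, where ?b1.0 = b1 and ?w1.0 = w1 and R = R])
      (use limit_bounds vR in auto)
  then show ?thesis by (intro that[of r v] r conv vR order_refl)
qed

end

section \<open>Upper semicontinuity of the attractors\<close>

text \<open>The new initial time may lie later than the translated one, so solutions shifted by
  different amounts can share one initial time.\<close>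

lemma mild_solution_shift:
  assumes "mild_solution b \<omega> \<tau> u f" and \<sigma>: "\<tau> - a \<le> \<sigma>"
  shows "mild_solution (\<lambda>t. b (t + a)) (\<lambda>t. \<omega> (t + a)) \<sigma> (\<lambda>t. u (t + a)) (\<lambda>t. f (t + a))"
  unfolding mild_solution_def
proof (intro conjI allI impI)
  show "norm (f (t + a)) \<le> 1" for t using assms by (simp add: mild_solution_def)
  fix k s t assume "\<sigma> < s" "s \<le> t"
  then have "((\<lambda>r. b r * coef (f r) k + \<omega> r * coef (u r) k - eig k * coef (u r) k) has_integral coef (u (t + a)) k - coef (u (s + a)) k) {s + a..t + a}"
    using assms by (simp add: mild_solution_def)
  from has_integral_shift_cbox[OF this[unfolded box_real(2)[symmetric]], of a]
  show "((\<lambda>r. b (r + a) * coef (f (r + a)) k + \<omega> (r + a) * coef (u (r + a)) k - eig k * coef (u (r + a)) k) has_integral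
      coef (u (t + a)) k - coef (u (s + a)) k) {s..t}"
    by simp
qed

lemma AE_lborel_shift:
  fixes a :: real
  assumes "AE t in lborel. P t"
  shows "AE t in lborel. P (t + a)"
proof -
  obtain N where N: "N \<in> null_sets lborel" "\<And>t. t \<notin> N \<Longrightarrow> P t"
    using assms unfolding eventually_ae_filter by auto
  have "(\<lambda>t. t + a) -` N \<inter> space lborel \<in> null_sets lborel"
  proof (rule null_setsI)
    have m: "(\<lambda>t. t + a) \<in> measurable lborel lborel" by simp
    have "emeasure lborel ((\<lambda>t. t + a) -` N \<inter> space lborel) = emeasure (distr lborel borel (\<lambda>t. t + a)) N"
      using N(1) by (subst emeasure_distr) auto
    also have "distr lborel borel (\<lambda>t. t + a) = lborel"
    proof -
      have "(\<lambda>t. t + a) = (+) a" by (auto simp: add.commute)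
      then show ?thesis using lborel_distr_plus[of a] by simp
    qed
    finally show "emeasure lborel ((\<lambda>t. t + a) -` N \<inter> space lborel) = 0" using N(1) by auto
    show "(\<lambda>t. t + a) -` N \<inter> space lborel \<in> sets lborel"
      using N(1) by (intro measurable_sets[OF m]) auto
  qed
  then have "AE t in lborel. t \<notin> (\<lambda>t. t + a) -` N \<inter> space lborel" by (rule AE_not_in)
  then show ?thesis by eventually_elim (use N(2) in auto)
qed

lemma heaviside_pair_shift:
  assumes "heaviside_pair \<tau> u f F V" and \<sigma>: "\<tau> - a \<le> \<sigma>"
  shows "heaviside_pair \<sigma> (\<lambda>t. u (t + a)) (\<lambda>t. f (t + a)) (\<lambda>p. F (fst p + a, snd p)) (\<lambda>p. V (fst p + a, snd p))"
proof -
  have F: "F \<in> borel_measurable borel" "\<And>p. \<bar>F p\<bar> \<le> 1" and V: "V \<in> borel_measurable borel"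
    and ae: "AE t in lborel. \<tau> < t \<longrightarrow>
        (AE x in lborel. 0 < x \<and> x < 1 \<longrightarrow> F (t, x) \<in> heaviside (V (t, x))) \<and>
        abs_l2 (\<lambda>x. F (t, x)) = f t \<and>
        square_integrable (\<lambda>x. V (t, x)) \<and> abs_l2 (\<lambda>x. V (t, x)) = u t"
    using assms(1) unfolding heaviside_pair_def by blast+
  have "(\<lambda>p::real \<times> real. (fst p + a, snd p)) \<in> borel_measurable borel"
    by (intro borel_measurable_continuous_onI continuous_intros)
  note m = measurable_compose[OF this]
  show ?thesis
    unfolding heaviside_pair_def
  proof (intro conjI allI m[OF F(1)] m[OF V] F(2))
    show "AE t in lborel. \<sigma> < t \<longrightarrow>
        (AE x in lborel. 0 < x \<and> x < 1 \<longrightarrow> F (fst (t, x) + a, snd (t, x)) \<in> heaviside (V (fst (t, x) + a, snd (t, x)))) \<and>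
        abs_l2 (\<lambda>x. F (fst (t, x) + a, snd (t, x))) = f (t + a) \<and>
        square_integrable (\<lambda>x. V (fst (t, x) + a, snd (t, x))) \<and> abs_l2 (\<lambda>x. V (fst (t, x) + a, snd (t, x))) = u (t + a)"
      using AE_lborel_shift[OF ae, of a] by (rule eventually_mono) (use \<sigma> in auto)
  qed
qed

section \<open>From semidistances to points\<close>

lemma semidist_lessD:
  assumes "semidist B A < c" "y \<in> B"
  obtains a where "a \<in> A" "ennreal (dist y a) < c"
proof -
  have "(INF a\<in>A. ennreal (dist y a)) \<le> semidist B A"
    unfolding semidist_def using assms(2) by (rule SUP_upper)
  also have "\<dots> < c" by (rule assms(1))
  finally show ?thesis using that by (auto simp: INF_less_iff)
qed

lemma semidist_geD:
  assumes "c < semidist B A"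
  obtains y where "y \<in> B" "\<And>a. a \<in> A \<Longrightarrow> c < ennreal (dist y a)"
proof -
  obtain y where "y \<in> B" "c < (INF a\<in>A. ennreal (dist y a))"
    using assms by (auto simp: semidist_def less_SUP_iff)
  then show ?thesis using that by (meson INF_lower order.strict_trans2)
qed

theorem theorem18:
  fixes b \<omega> :: "real \<Rightarrow> real"
    and \<beta>0 b1 \<gamma>0 \<omega>1 b0 \<omega>0 :: real
    and \<A> :: "real \<Rightarrow> l2 set" and \<A>lim :: "l2 set"
  assumes "continuous_on UNIV b" and "continuous_on UNIV \<omega>"
    and "0 < \<beta>0" and "\<And>t. \<beta>0 \<le> b t \<and> b t \<le> b1"
    and "0 \<le> \<gamma>0" and "\<And>t. \<gamma>0 \<le> \<omega> t \<and> \<omega> t \<le> \<omega>1" and "\<omega>1 < pi\<^sup>2"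
    and "(b \<longlongrightarrow> b0) at_top" and "b0 \<ge> \<beta>0"
    and "(\<omega> \<longlongrightarrow> \<omega>0) at_top" and "\<omega>0 \<ge> \<gamma>0"
    and "pullback_attractor (evolution_process b \<omega>) \<A>"
    and "global_attractor (semiflow b0 \<omega>0) \<A>lim"
  shows "((\<lambda>t. semidist (\<A> t) \<A>lim) \<longlongrightarrow> 0) at_top"
proof (rule ccontr)
  assume "\<not> ?thesis"
  then obtain \<epsilon> where \<epsilon>: "0 < \<epsilon>" and notev: "\<not> (\<forall>\<^sub>F t in at_top. semidist (\<A> t) \<A>lim < \<epsilon>)"
    using order_tendstoI[of 0 "\<lambda>t. semidist (\<A> t) \<A>lim" at_top] by (auto simp: not_less_zero)
  \<comment> \<open>\<open>\<epsilon>\<close> is an extended number and possibly infinite; a finite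
    \<open>e\<close> below it serves the distance estimates.\<close>
  obtain e where e: "0 < e" "ennreal e < \<epsilon>"
  proof -
    obtain c where c: "0 < c" "c < \<epsilon>" using dense[OF \<epsilon>] by blast
    then have "c < top" by (simp add: less_top order.strict_trans2[of c \<epsilon> top])
    then obtain e where "c = ennreal e" "0 \<le> e" by (cases c) auto
    with c that show ?thesis by (auto simp: ennreal_zero_less_top order_less_le)
  qed
  have bad: "\<exists>t\<ge>N. ennreal e < semidist (\<A> t) \<A>lim" for N
    using notev e(2) unfolding eventually_at_top_linorder by (meson not_le order.strict_trans1 not_less)
  have "compact (\<A> 0)" using assms(12) by (simp add: pullback_attractor_def)
  then have "bounded (\<A> 0)" by (rule compact_imp_bounded)
  then obtain R where R: "\<And>x. x \<in> \<A> 0 \<Longrightarrow> norm x \<le> R" unfolding bounded_iff by blast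
  \<comment> \<open>The barrier of \<open>strong_solution_bound\<close> for all data in
    \<open>\<A> 0\<close> at once.\<close>
  define M where "M = max R (b1 / (pi\<^sup>2 - \<omega>1))"
  have gb: "\<bar>b t\<bar> \<le> b1" "\<bar>\<omega> t\<bar> \<le> \<omega>1" "\<omega> t \<le> \<omega>1" for t
  proof -
    have "\<beta>0 \<le> b t" "b t \<le> b1" "\<gamma>0 \<le> \<omega> t" "\<omega> t \<le> \<omega>1" using assms(4)[of t] assms(6)[of t] by blast+
    with assms(3,5) show "\<bar>b t\<bar> \<le> b1" "\<bar>\<omega> t\<bar> \<le> \<omega>1" "\<omega> t \<le> \<omega>1" by linarith+
  qed
  have solution: "\<exists>u x. strong_solution b \<omega> 0 x u \<and> u t = y \<and> (\<forall>r\<ge>0. norm (u r) \<le> M)"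
    if y: "y \<in> \<A> t" and t: "0 \<le> t" for y t
  proof -
    have "\<A> t \<subseteq> (\<Union>x\<in>\<A> 0. evolution_process b \<omega> t 0 x)" using assms(12) t by (simp add: pullback_attractor_def)
    then obtain x u where x: "x \<in> \<A> 0" and u: "strong_solution b \<omega> 0 x u" "u t = y"
      using y by (auto simp: evolution_process_def)
    have "norm (u r) \<le> M" if "r \<ge> 0" for r
      using strong_solution_bound[OF u(1) gb(1,3) assms(7) that] R[OF x] by (simp add: M_def max_def split: if_splits)
    with u show ?thesis by blast
  qed
  \<comment> \<open>Attraction is used with tolerance \<open>e / 2\<close>; the other half is left
    for the distance between the counterexamples and the limit solution.\<close>
  have "((\<lambda>t. semidist (\<Union>x\<in>cball 0 M. semiflow b0 \<omega>0 t x) \<A>lim) \<longlongrightarrow> 0) at_top"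
    using assms(13) by (simp add: global_attractor_def)
  then have "\<forall>\<^sub>F t in at_top. semidist (\<Union>x\<in>cball 0 M. semiflow b0 \<omega>0 t x) \<A>lim < ennreal (e / 2)"
    using e(1) by (intro order_tendstoD(2)) auto
  then have "\<forall>\<^sub>F t in at_top. 0 \<le> t \<and> semidist (\<Union>x\<in>cball 0 M. semiflow b0 \<omega>0 t x) \<A>lim < ennreal (e / 2)"
    using eventually_ge_at_top[of 0] by eventually_elim auto
  then obtain T where T: "0 \<le> T" "semidist (\<Union>x\<in>cball 0 M. semiflow b0 \<omega>0 T x) \<A>lim < ennreal (e / 2)"
    by (auto simp: eventually_at_top_linorder)
  \<comment> \<open>The summand \<open>real n\<close> drives the shifts to infinity, where the
    coefficients reach their limits; the summand 2 lets each shifted solution start at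
    \<open>-2\<close>.\<close>
  have "\<exists>t y u x f F V. T + 2 + real n \<le> t \<and> y \<in> \<A> t \<and> (\<forall>a\<in>\<A>lim. e < dist y a) \<and>
      strong_solution b \<omega> 0 x u \<and> u t = y \<and> (\<forall>r\<ge>0. norm (u r) \<le> M) \<and>
      mild_solution b \<omega> 0 u f \<and> heaviside_pair 0 u f F V" for n
  proof -
    obtain t where t: "T + 2 + real n \<le> t" "ennreal e < semidist (\<A> t) \<A>lim" using bad by blast
    obtain y where y: "y \<in> \<A> t" "\<And>a. a \<in> \<A>lim \<Longrightarrow> ennreal e < ennreal (dist y a)"
      by (rule semidist_geD[OF t(2)]) (rule that)
    obtain u x where u: "strong_solution b \<omega> 0 x u" "u t = y" "\<forall>r\<ge>0. norm (u r) \<le> M"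
      using solution[OF y(1)] t(1) T(1) by auto
    obtain f F V where "mild_solution b \<omega> 0 u f" "heaviside_pair 0 u f F V"
      by (rule strong_imp_mild[OF u(1)]) (rule that)
    with t(1) y u e(1) show ?thesis by (force simp: ennreal_less_iff)
  qed
  then obtain t y u x f F V where t: "\<And>n. T + 2 + real n \<le> t n" and far: "\<And>n a. a \<in> \<A>lim \<Longrightarrow> e < dist (y n) a"
    and sol: "\<And>n. strong_solution b \<omega> 0 (x n) (u n)" and ut: "\<And>n. u n (t n) = y n"
    and uM: "\<And>n r. r \<ge> 0 \<Longrightarrow> norm (u n r) \<le> M"
    and mild: "\<And>n. mild_solution b \<omega> 0 (u n) (f n)" and pair: "\<And>n. heaviside_pair 0 (u n) (f n) (F n) (V n)"
    by metis
  \<comment> \<open>With this shift the point \<open>y n\<close> is reached at the time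
    \<open>T\<close> of the shifted problem, the same for all \<open>n\<close>.\<close>
  define a where "a n = t n - T" for n
  have a: "2 + real n \<le> a n" for n using t[of n] by (simp add: a_def)
  have a_ge: "real n \<le> a n" for n using a[of n] by simp
  have a_lim: "filterlim (\<lambda>n. r + a n) at_top sequentially" for r
    by (rule filterlim_at_top_mono[OF filterlim_tendsto_add_at_top[OF tendsto_const filterlim_real_sequentially, of r]])
      (use a_ge in simp)
  interpret solution_sequence "\<lambda>n t. b (t + a n)" "\<lambda>n t. \<omega> (t + a n)" b0 \<omega>0 b1 \<omega>1 M
    "\<lambda>n t. u n (t + a n)" "\<lambda>n t. f n (t + a n)" "\<lambda>n p. F n (fst p + a n, snd p)" "\<lambda>n p. V n (fst p + a n, snd p)"
  proof
    fix n
    have an: "0 - a n \<le> -2" using a[of n] by simp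
    show "mild_solution (\<lambda>t. b (t + a n)) (\<lambda>t. \<omega> (t + a n)) (-2) (\<lambda>t. u n (t + a n)) (\<lambda>t. f n (t + a n))"
      by (rule mild_solution_shift[OF mild an])
    show "heaviside_pair (-2) (\<lambda>t. u n (t + a n)) (\<lambda>t. f n (t + a n)) (\<lambda>p. F n (fst p + a n, snd p)) (\<lambda>p. V n (fst p + a n, snd p))"
      by (rule heaviside_pair_shift[OF pair an])
    have "continuous_on {0..} (u n)" using sol[of n] by (simp add: strong_solution_def)
    then show "continuous_on {-2<..} (\<lambda>t. u n (t + a n))"
      by (rule continuous_on_compose2) (use an in \<open>auto intro!: continuous_intros\<close>)
    show "\<bar>b (r + a n)\<bar> \<le> b1 \<and> \<bar>\<omega> (r + a n)\<bar> \<le> \<omega>1 \<and> norm (u n (r + a n)) \<le> M" if "-2 < r" for r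
      using gb uM[of "r + a n" n] an that by auto
  next
    fix r :: real
    show "(\<lambda>n. b (r + a n)) \<longlonglongrightarrow> b0" by (rule filterlim_compose[OF assms(8) a_lim])
    show "(\<lambda>n. \<omega> (r + a n)) \<longlonglongrightarrow> \<omega>0" by (rule filterlim_compose[OF assms(10) a_lim])
  qed
  obtain r v where r: "strict_mono r" and conv: "\<And>t. 0 \<le> t \<Longrightarrow> (\<lambda>n. u (r n) (t + a (r n))) \<longlonglongrightarrow> v t"
    and v: "strong_solution (\<lambda>_. b0) (\<lambda>_. \<omega>0) 0 (v 0) v" "norm (v 0) \<le> M"
    by (rule limit_strong_solution; (rule that)?)
  \<comment> \<open>Only the norm of \<open>v 0\<close> is controlled, and \<open>T\<close> was
    chosen for every datum in that ball.\<close>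
  have "v T \<in> (\<Union>x\<in>cball 0 M. semiflow b0 \<omega>0 T x)"
    using v by (auto simp: semiflow_def intro!: bexI[of _ "v 0"])
  then obtain z where z: "z \<in> \<A>lim" "ennreal (dist (v T) z) < ennreal (e / 2)" using semidist_lessD[OF T(2)] by blast
  then have zd: "dist (v T) z < e / 2" using e(1) by (simp add: ennreal_less_iff)
  have "(\<lambda>n. y (r n)) \<longlonglongrightarrow> v T" using conv[OF T(1)] ut by (simp add: a_def)
  then obtain n where "dist (y (r n)) (v T) < e / 2" using e(1) metric_LIMSEQ_D[of "\<lambda>n. y (r n)" "v T" "e / 2"] by auto
  then have "dist (y (r n)) z < e" using zd dist_triangle[of "y (r n)" z "v T"] by linarith
  then show False using far[OF z(1), of "r n"] by simp
qed

end
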